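(* Assume that there exists an accessible point $x^{\ast}\in M$ at which the weak Hörmander condition is satisfied. Suppose that the pair $(\Gamma,i)$ is such that: 1. $\Gamma$ is a closed subset of $\mathrm{int}(M)$ and $i\in E$; 2. $\Gamma$ is backwards invariant under $\varphi^i$: if $x\in\Gamma$ then $\varphi^i_{-t}(x)\in\Gamma$ for all $t\ge0$; 3. there exists an open neighbourhood $N\supseteq\Gamma$ such that every point $x\in N$ is accessible; 4. every point $x\in\Gamma$ satisfies the weak Hörmander condition; 5. $\sup_{x\in\Gamma}\mathrm{tr}(Dv^i(x))<0$. Define $R(\Gamma,i):=\inf_{x\in\Gamma}\big(-\mathrm{tr}(Dv^i(x))\big)>0$, and suppose that $Q\in\mathcal{Q}$ satisfies $$-Q_{ii}\le R(\Gamma,i).$$ Then every lower semi-continuous version of the stationary density $\pi^Q$ of $PDMP(Q)$ satisfies $$\pi^Q\equiv+\infty\quad\text{on}\quad\Gamma\times\{i\}.$$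
   Context: Setting. Let $E=\{1,\ldots,n\}$ and let $v^1,\ldots,v^n$ be bounded $C^\infty$ vector fields on $\mathbb{R}^d$; $Dv^i$ is the Jacobian matrix of $v^i$. For $i\in E$ let $\varphi^i_t$ ($t\in\mathbb{R}$) be the flow of $v^i$: $\varphi^i_t(x)=x_t$ where $x_0=x$, $\dot x_t=v^i(x_t)$. Let $M\subset\mathbb{R}^d$ be a compact set which is forward invariant under all the flows: $\varphi^i_t(x)\in M$ for all $i\in E$, $x\in M$, $t\ge 0$. Process. A rate matrix $Q$ on $E$ is an $n\times n$ matrix with $Q_{ij}\ge 0$ for $i\ne j$ and $Q_{ii}=-\sum_{j\neq i}Q_{ij}$. $\mathcal{Q}$ is the set of rate matrices on $E$ all of whose off-diagonal entries are strictly positive. For $Q\in\mathcal{Q}$, $(I_t)_{t\ge0}$ is the continuous-time Markov chain on $E$ jumping from $i$ to $j$ at rate $Q_{ij}$, and $X_t$ solves $\dot X_t=v^{I_t}(X_t)$, $X_0\in M$. The Markov process $(X_t,I_t)_{t\ge 0}$ on $M\times E$ is denoted $PDMP(Q)$. Accessibility. For $\underline{i}=(i_1,\ldots,i_\ell)\in E^\ell$ and $\underline{t}=(t_1,\ldots,t_\ell)\in\mathbb{R}_{\ge0}^\ell$ let $\Phi^{\underline{i}}(x,\underline{t})=\varphi^{i_\ell}_{t_\ell}\circ\cdots\circ\varphi^{i_1}_{t_1}(x)$. A point $x^\ast$ is accessible if for every open neighbourhood $U\ni x^\ast$ and every $x\in M$ there exist $1\le\ell<\infty$, $\underline{i}\in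 E^\ell$, $\underline{t}\in\mathbb{R}_{\ge0}^\ell$ with $\Phi^{\underline{i}}(x,\underline{t})\in U$. Bracket condition. Let $[V,W]$ be the Lie bracket of vector fields, $\mathcal{V}_0=\{v^i:i\in E\}$, $\mathcal{V}_{k+1}=\{[v,w]:v\in\mathcal{V}_0,\ w\in\mathcal{V}_k\}\cup\mathcal{V}_k$, $\mathcal{V}_\infty=\bigcup_k\mathcal{V}_k$, $\mathcal{V}_k(x)=\{V(x):V\in\mathcal{V}_k\}$ for $0\le k\le\infty$. The weak Hörmander condition holds at $x$ if $\mathrm{span}(\mathcal{V}_\infty(x))=\mathbb{R}^d$. Stationary density. Under the first hypothesis of the theorem it is known that for every $Q\in\mathcal{Q}$, $PDMP(Q)$ has a unique stationary distribution, and it is absolutely continuous with respect to Lebesgue measure on $M\times E$ (Lebesgue measure on each copy $M\times\{j\}$, $j\in E$); both the distribution and its density are denoted $\pi^Q$. A version of the density is a function equal to it Lebesgue-a.e.; lower semi-continuous versions are allowed to take values in $[0,\infty]$.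
   Formalization: Since Γ is a closed Lebesgue-null set, any lower semi-continuous version can be set to 0 on Γ×{i}; so the formal claim is that the greatest lower semi-continuous version is +∞ on Γ×{i}, and that every lower semi-continuous version has essential lower limit +∞ at each point of Γ×{i}. *)

theory Defs
  imports "HOL-Probability.Probability"
begin

section \<open>Vector fields and flows\<close>

text \<open>The index set of the vector fields is a finite type \<open>'e\<close>; vector fields live on \<open>real ^ 'd\<close>.\<close>

primrec Ck :: "nat \<Rightarrow> ('a::real_normed_vector \<Rightarrow> 'b::real_normed_vector) \<Rightarrow> bool" where
  "Ck 0 f \<longleftrightarrow> continuous_on UNIV f"
| "Ck (Suc k) f \<longleftrightarrow>
     (\<forall>x. f differentiable (at x)) \<and> (\<forall>h. Ck k (\<lambda>x. frechet_derivative f (at x) h))"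

definition smooth :: "('a::real_normed_vector \<Rightarrow> 'b::real_normed_vector) \<Rightarrow> bool" where
  "smooth f \<longleftrightarrow> (\<forall>k. Ck k f)"

definition is_flow :: "(real ^ 'd \<Rightarrow> real ^ 'd) \<Rightarrow> (real \<Rightarrow> real ^ 'd \<Rightarrow> real ^ 'd) \<Rightarrow> bool" where
  "is_flow w \<phi> \<longleftrightarrow>
     (\<forall>x. \<phi> 0 x = x \<and> (\<forall>t. ((\<lambda>s. \<phi> s x) has_vector_derivative w (\<phi> t x)) (at t)))"

definition forward_invariant :: "('e \<Rightarrow> real \<Rightarrow> real ^ 'd \<Rightarrow> real ^ 'd) \<Rightarrow> (real ^ 'd) set \<Rightarrow> bool" where
  "forward_invariant \<phi> M \<longleftrightarrow> (\<forall>j. \<forall>x\<in>M. \<forall>t\<ge>0. \<phi> j t x \<in> M)"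

definition backward_invariant :: "(real \<Rightarrow> real ^ 'd \<Rightarrow> real ^ 'd) \<Rightarrow> (real ^ 'd) set \<Rightarrow> bool" where
  "backward_invariant \<phi> \<Gamma> \<longleftrightarrow> (\<forall>x\<in>\<Gamma>. \<forall>t\<ge>0. \<phi> (- t) x \<in> \<Gamma>)"

text \<open>A pair of words \<open>(i\<^sub>1,\<dots>,i\<^sub>l)\<close>, \<open>(t\<^sub>1,\<dots>,t\<^sub>l)\<close> is a list of pairs; its head is the flow applied first.\<close>

definition flow_comp ::
    "('e \<Rightarrow> real \<Rightarrow> real ^ 'd \<Rightarrow> real ^ 'd) \<Rightarrow> ('e \<times> real) list \<Rightarrow> real ^ 'd \<Rightarrow> real ^ 'd" where
  "flow_comp \<phi> its x = fold (\<lambda>(j, t). \<phi> j t) its x"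

definition accessible ::
    "('e \<Rightarrow> real \<Rightarrow> real ^ 'd \<Rightarrow> real ^ 'd) \<Rightarrow> (real ^ 'd) set \<Rightarrow> real ^ 'd \<Rightarrow> bool" where
  "accessible \<phi> M y \<longleftrightarrow>
     (\<forall>U. open U \<and> y \<in> U \<longrightarrow>
       (\<forall>x\<in>M. \<exists>its. its \<noteq> [] \<and> (\<forall>(j, t)\<in>set its. 0 \<le> t) \<and> flow_comp \<phi> its x \<in> U))"

definition lie_bracket ::
    "(real ^ 'd \<Rightarrow> real ^ 'd) \<Rightarrow> (real ^ 'd \<Rightarrow> real ^ 'd) \<Rightarrow> real ^ 'd \<Rightarrow> real ^ 'd" where
  "lie_bracket V W x = jacobian W (at x) *v V x - jacobian V (at x) *v W x"

primrec bracket_fields ::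
    "('e \<Rightarrow> real ^ 'd \<Rightarrow> real ^ 'd) \<Rightarrow> nat \<Rightarrow> (real ^ 'd \<Rightarrow> real ^ 'd) set" where
  "bracket_fields v 0 = range v"
| "bracket_fields v (Suc k) =
     {lie_bracket V W | V W. V \<in> range v \<and> W \<in> bracket_fields v k} \<union> bracket_fields v k"

definition weak_hormander :: "('e \<Rightarrow> real ^ 'd \<Rightarrow> real ^ 'd) \<Rightarrow> real ^ 'd \<Rightarrow> bool" where
  "weak_hormander v x \<longleftrightarrow> span {V x | V. V \<in> (\<Union>k. bracket_fields v k)} = UNIV"

definition contraction_rate :: "(real ^ 'd \<Rightarrow> real ^ 'd) \<Rightarrow> (real ^ 'd) set \<Rightarrow> real" where
  "contraction_rate w \<Gamma> = (INF x\<in>\<Gamma>. - trace (jacobian w (at x)))"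

section \<open>The process\<close>

definition positive_rate_matrices :: "(real ^ 'e ^ 'e) set" where
  "positive_rate_matrices =
     {Q. (\<forall>i j. i \<noteq> j \<longrightarrow> 0 < Q $ i $ j) \<and> (\<forall>i. Q $ i $ i = - (\<Sum>j\<in>UNIV - {i}. Q $ i $ j))}"

text \<open>Transition probabilities of the jump chain; a state with zero exit rate is absorbing
  (for \<open>Q \<in> positive_rate_matrices\<close> this occurs only if \<open>'e\<close> has one element).\<close>

definition jump_prob :: "real ^ 'e ^ 'e \<Rightarrow> 'e \<Rightarrow> 'e \<Rightarrow> real" where
  "jump_prob Q i j =
     (if Q $ i $ i = 0 then (if j = i then 1 else 0)
      else (if j = i then 0 else Q $ i $ j / (- Q $ i $ i)))"

text \<open>Jump chain and holding times of a continuous-time Markov chain: \<open>Y k\<close> is the state after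
  \<open>k\<close> jumps and \<open>S k\<close> the time spent there. Conditionally on \<open>(X0, Y 0)\<close>, the sequence \<open>Y\<close> is a
  Markov chain with transition matrix \<open>jump_prob Q\<close>, and conditionally on \<open>X0\<close> and \<open>Y\<close> the \<open>S k\<close>
  are independent exponential variables of rates \<open>- Q $ Y k $ Y k\<close> (infinite if the rate is \<open>0\<close>).
  The random variable \<open>X0\<close> is carried along because the initial position of the continuous
  component may be correlated with the initial state, but must not influence the later jumps.\<close>

definition jump_holding ::
    "'w measure \<Rightarrow> real ^ 'e ^ 'e \<Rightarrow> ('w \<Rightarrow> 'x::topological_space) \<Rightarrow>
     (nat \<Rightarrow> 'w \<Rightarrow> 'e) \<Rightarrow> (nat \<Rightarrow> 'w \<Rightarrow> ennreal) \<Rightarrow> bool" where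
  "jump_holding P Q X0 Y S \<longleftrightarrow>
     (\<forall>k. Y k \<in> P \<rightarrow>\<^sub>M count_space UNIV) \<and>
     (\<forall>k. S k \<in> borel_measurable P) \<and>
     (\<forall>n A y c. A \<in> sets borel \<and> (\<forall>k<n. 0 \<le> c k) \<longrightarrow>
        measure P {\<omega> \<in> space P. X0 \<omega> \<in> A \<and> (\<forall>k\<le>n. Y k \<omega> = y k) \<and> (\<forall>k<n. ennreal (c k) < S k \<omega>)} =
        measure P {\<omega> \<in> space P. X0 \<omega> \<in> A \<and> Y 0 \<omega> = y 0} *
          (\<Prod>k<n. exp (Q $ y k $ y k * c k) * jump_prob Q (y k) (y (Suc k))))"

definition markov_chain_path :: "(nat \<Rightarrow> 'e) \<Rightarrow> (nat \<Rightarrow> ennreal) \<Rightarrow> (real \<Rightarrow> 'e) \<Rightarrow> bool" where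
  "markov_chain_path y s p \<longleftrightarrow>
     (\<forall>t\<ge>0. \<forall>k. (\<Sum>l<k. s l) \<le> ennreal t \<and> ennreal t < (\<Sum>l<Suc k. s l) \<longrightarrow> p t = y k)"

definition state_space :: "(real ^ 'd) set \<Rightarrow> ((real ^ 'd) \<times> 'e) measure" where
  "state_space M = restrict_space borel M \<Otimes>\<^sub>M count_space UNIV"

text \<open>\<open>(X, I)\<close> is a realisation of \<open>PDMP(Q)\<close> on the probability space \<open>P\<close>, with arbitrary initial
  law on \<open>M \<times> E\<close>. As \<open>I\<close> is piecewise constant, the differential equation for \<open>X\<close> is
  understood in integrated form.\<close>

definition is_pdmp ::
    "'w measure \<Rightarrow> (real ^ 'd) set \<Rightarrow> ('e::finite \<Rightarrow> real ^ 'd \<Rightarrow> real ^ 'd) \<Rightarrow> real ^ 'e ^ 'e \<Rightarrow>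
     (real \<Rightarrow> 'w \<Rightarrow> real ^ 'd) \<Rightarrow> (real \<Rightarrow> 'w \<Rightarrow> 'e) \<Rightarrow> bool" where
  "is_pdmp P M v Q X I \<longleftrightarrow>
     prob_space P \<and>
     (\<forall>t\<ge>0. (\<lambda>\<omega>. (X t \<omega>, I t \<omega>)) \<in> P \<rightarrow>\<^sub>M state_space M) \<and>
     (\<exists>Y S. jump_holding P Q (X 0) Y S \<and>
        (AE \<omega> in P. markov_chain_path (\<lambda>k. Y k \<omega>) (\<lambda>k. S k \<omega>) (\<lambda>t. I t \<omega>))) \<and>
     (AE \<omega> in P. \<forall>t\<ge>0. ((\<lambda>s. v (I s \<omega>) (X s \<omega>)) has_integral (X t \<omega> - X 0 \<omega>)) {0..t})"

text \<open>\<open>\<pi>\<close> is the law at all times of the realisation \<open>(X, I)\<close> of \<open>PDMP(Q)\<close>. A stationary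
  distribution is a \<open>\<pi>\<close> for which such a realisation exists on some probability space; this
  existential over sample space types is expressed by leaving \<open>P\<close>, \<open>X\<close>, \<open>I\<close> as parameters.\<close>

definition stationary_realisation ::
    "'w measure \<Rightarrow> (real ^ 'd) set \<Rightarrow> ('e::finite \<Rightarrow> real ^ 'd \<Rightarrow> real ^ 'd) \<Rightarrow> real ^ 'e ^ 'e \<Rightarrow>
     (real \<Rightarrow> 'w \<Rightarrow> real ^ 'd) \<Rightarrow> (real \<Rightarrow> 'w \<Rightarrow> 'e) \<Rightarrow> ((real ^ 'd) \<times> 'e) measure \<Rightarrow> bool" where
  "stationary_realisation P M v Q X I \<pi> \<longleftrightarrow>
     is_pdmp P M v Q X I \<and> (\<forall>t\<ge>0. distr P (state_space M) (\<lambda>\<omega>. (X t \<omega>, I t \<omega>)) = \<pi>)"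

section \<open>Densities\<close>

definition lebesgue_on_states :: "(real ^ 'd) set \<Rightarrow> ((real ^ 'd) \<times> 'e) measure" where
  "lebesgue_on_states M = restrict_space lborel M \<Otimes>\<^sub>M count_space UNIV"

definition density_version ::
    "(real ^ 'd) set \<Rightarrow> ((real ^ 'd) \<times> 'e) measure \<Rightarrow> ((real ^ 'd) \<times> 'e \<Rightarrow> ennreal) \<Rightarrow> bool" where
  "density_version M \<pi> \<rho> \<longleftrightarrow>
     (\<exists>f \<in> borel_measurable (lebesgue_on_states M).
        \<pi> = density (lebesgue_on_states M) f \<and> (AE z in lebesgue_on_states M. \<rho> z = f z))"

text \<open>Lower semi-continuity on \<open>M \<times> E\<close>, where \<open>E\<close> is discrete and \<open>M\<close> carries the subspace
  topology.\<close>

definition lsc_on_states :: "(real ^ 'd) set \<Rightarrow> ((real ^ 'd) \<times> 'e \<Rightarrow> ennreal) \<Rightarrow> bool" where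
  "lsc_on_states M \<rho> \<longleftrightarrow>
     (\<forall>j. \<forall>x\<in>M. \<forall>a < \<rho> (x, j). eventually (\<lambda>y. a < \<rho> (y, j)) (at x within M))"

definition lsc_version ::
    "(real ^ 'd) set \<Rightarrow> ((real ^ 'd) \<times> 'e) measure \<Rightarrow> ((real ^ 'd) \<times> 'e \<Rightarrow> ennreal) \<Rightarrow> bool" where
  "lsc_version M \<pi> \<rho> \<longleftrightarrow> density_version M \<pi> \<rho> \<and> lsc_on_states M \<rho>"

text \<open>A lower semi-continuous version is not determined by \<open>\<pi>\<close> on null sets: it may be lowered to
  \<open>0\<close> on any closed null set (\<open>lsc_version_lowered\<close>). The value of the stationary density at points
  of a null set is therefore read off from the pointwise greatest lower semi-continuous version,
  which exists as soon as some lower semi-continuous version does (\<open>greatest_lsc_version_exists\<close>),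
  or, for an arbitrary version, as an essential lower limit.\<close>

definition greatest_lsc_version ::
    "(real ^ 'd) set \<Rightarrow> ((real ^ 'd) \<times> 'e) measure \<Rightarrow> ((real ^ 'd) \<times> 'e \<Rightarrow> ennreal) \<Rightarrow> bool" where
  "greatest_lsc_version M \<pi> \<rho> \<longleftrightarrow>
     lsc_version M \<pi> \<rho> \<and> (\<forall>\<sigma>. lsc_version M \<pi> \<sigma> \<longrightarrow> (\<forall>x\<in>M. \<forall>j. \<sigma> (x, j) \<le> \<rho> (x, j)))"

definition ess_infinite_at ::
    "(real ^ 'd) set \<Rightarrow> (real ^ 'd \<Rightarrow> ennreal) \<Rightarrow> real ^ 'd \<Rightarrow> bool" where
  "ess_infinite_at M f x \<longleftrightarrow>
     (\<forall>K<\<infinity>. \<exists>U. open U \<and> x \<in> U \<and> (AE y in lborel. y \<in> U \<inter> M \<longrightarrow> K \<le> f y))"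

lemma pair_sigma_finite_lebesgue_on_states:
  assumes "M \<in> sets borel"
  shows "pair_sigma_finite (restrict_space lborel M :: (real ^ 'd) measure)
           (count_space (UNIV :: 'e::finite set))"
proof -
  have "sigma_finite_measure (restrict_space lborel M :: (real ^ 'd) measure)"
    using assms by (intro sigma_finite_measure_restrict_space sigma_finite_lborel) auto
  moreover have "sigma_finite_measure (count_space (UNIV :: 'e set))"
    by (intro sigma_finite_measure_count_space_countable) auto
  ultimately show ?thesis by (simp add: pair_sigma_finite_def)
qed

lemma AE_lebesgue_on_states:
  fixes R :: "(real ^ 'd) \<times> 'e::finite \<Rightarrow> bool"
  assumes M: "M \<in> sets borel"
  shows "(AE z in lebesgue_on_states M. R z) \<longleftrightarrow> (\<forall>j. AE x in lborel. x \<in> M \<longrightarrow> R (x, j))"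
proof
  interpret pair_sigma_finite "restrict_space lborel M :: (real ^ 'd) measure" "count_space (UNIV :: 'e set)"
    by (rule pair_sigma_finite_lebesgue_on_states[OF M])
  have M': "M \<inter> space lborel \<in> sets lborel"
    using M by simp
  {
    assume "AE z in lebesgue_on_states M. R z"
    then have "AE x in restrict_space lborel M. \<forall>j. R (x, j)"
      unfolding lebesgue_on_states_def by (drule_tac AE_pair) (simp add: AE_count_space)
    then have "AE x in lborel. x \<in> M \<longrightarrow> (\<forall>j. R (x, j))"
      using M' by (simp add: AE_restrict_space_iff)
    then show "\<forall>j. AE x in lborel. x \<in> M \<longrightarrow> R (x, j)"
      by (auto elim: eventually_mono)
  }
  {
    assume *: "\<forall>j. AE x in lborel. x \<in> M \<longrightarrow> R (x, j)"
    have "\<forall>j. \<exists>N. N \<in> null_sets lborel \<and> {x. \<not> (x \<in> M \<longrightarrow> R (x, j))} \<subseteq> N"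
    proof
      fix j
      from *[rule_format, of j] show "\<exists>N. N \<in> null_sets lborel \<and> {x. \<not> (x \<in> M \<longrightarrow> R (x, j))} \<subseteq> N"
        by (auto simp: eventually_ae_filter)
    qed
    then obtain N where N: "\<And>j. N j \<in> null_sets lborel"
        "\<And>j. {x. \<not> (x \<in> M \<longrightarrow> R (x, j))} \<subseteq> N j"
      by metis
    let ?L = "restrict_space lborel M \<Otimes>\<^sub>M count_space (UNIV :: 'e set)"
    have sets: "{z \<in> space ?L. fst z \<notin> N (snd z)} \<in> sets ?L"
    proof -
      have "{z \<in> space ?L. fst z \<notin> N (snd z)} = (\<Union>j. (M - N j) \<times> {j})"
        by (auto simp: space_pair_measure space_restrict_space)
      moreover have "(M - N j) \<times> {j} \<in> sets ?L" for j
      proof (rule pair_measureI)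
        have "N j \<in> sets lborel" using N(1)[of j] by auto
        then show "M - N j \<in> sets (restrict_space lborel M)"
          using M by (subst sets_restrict_space_iff) auto
      qed simp
      ultimately show ?thesis by (simp add: sets.finite_UN)
    qed
    have "AE x in lborel. \<forall>j\<in>UNIV. x \<notin> N j"
      using N(1) by (intro AE_finite_allI AE_not_in) auto
    then have "AE x in restrict_space lborel M. \<forall>j. x \<notin> N j"
      unfolding AE_restrict_space_iff[OF M'] by eventually_elim auto
    then have "AE z in ?L. fst z \<notin> N (snd z)"
      using sets by (intro AE_pair_measure) (auto simp: AE_count_space)
    then have "AE z in ?L. R z"
    proof (rule AE_mp, intro AE_I2 impI)
      fix z assume "z \<in> space ?L" "fst z \<notin> N (snd z)"
      then show "R z"
        using N(2)[of "snd z"] by (auto simp: space_pair_measure space_restrict_space)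
    qed
    then show "AE z in lebesgue_on_states M. R z"
      unfolding lebesgue_on_states_def .
  }
qed

lemma lsc_version_lowered:
  fixes \<rho> :: "(real ^ 'd) \<times> 'e::finite \<Rightarrow> ennreal"
  assumes M: "M \<in> sets borel" and \<rho>: "lsc_version M \<pi> \<rho>"
    and C: "closed C" "C \<in> null_sets lborel"
  shows "lsc_version M \<pi> (\<lambda>z. if z \<in> C \<times> {i} then 0 else \<rho> z)"
proof -
  obtain f where f: "f \<in> borel_measurable (lebesgue_on_states M)"
      "\<pi> = density (lebesgue_on_states M) f" "AE z in lebesgue_on_states M. \<rho> z = f z"
    and lsc: "lsc_on_states M \<rho>"
    using \<rho> by (auto simp: lsc_version_def density_version_def)
  have "AE z in lebesgue_on_states M. z \<notin> C \<times> {i}"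
    unfolding AE_lebesgue_on_states[OF M]
    using AE_not_in[OF C(2)] by (auto elim: eventually_mono)
  with f(3) have "AE z in lebesgue_on_states M. (if z \<in> C \<times> {i} then 0 else \<rho> z) = f z"
    by eventually_elim auto
  moreover have "lsc_on_states M (\<lambda>z. if z \<in> C \<times> {i} then 0 else \<rho> z)"
    unfolding lsc_on_states_def
  proof (intro allI ballI impI)
    fix j x a
    assume x: "x \<in> M" and a: "a < (if (x, j) \<in> C \<times> {i} then 0 else \<rho> (x, j))"
    then have nC: "\<not> (x \<in> C \<and> j = i)" and a': "a < \<rho> (x, j)"
      by (auto split: if_splits)
    have ev: "eventually (\<lambda>y. a < \<rho> (y, j)) (at x within M)"
      using lsc x a' by (auto simp: lsc_on_states_def)
    have "eventually (\<lambda>y. \<not> (y \<in> C \<and> j = i)) (at x within M)"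
    proof (cases "j = i")
      case True
      with nC have "x \<in> - C" by auto
      then have "eventually (\<lambda>y. y \<in> - C) (at x within M)"
        using C(1) by (intro eventually_at_topological[THEN iffD2]) (auto intro!: exI[of _ "- C"])
      then show ?thesis by eventually_elim auto
    qed simp
    with ev show "eventually (\<lambda>y. a < (if (y, j) \<in> C \<times> {i} then 0 else \<rho> (y, j))) (at x within M)"
      by eventually_elim auto
  qed
  ultimately show ?thesis
    using f by (auto simp: lsc_version_def density_version_def)
qed

lemma greatest_lsc_version_exists:
  fixes \<rho> :: "(real ^ 'd) \<times> 'e::finite \<Rightarrow> ennreal"
  assumes M: "M \<in> sets borel" and \<rho>: "lsc_version M \<pi> \<rho>"
  shows "\<exists>\<sigma>. greatest_lsc_version M \<pi> \<sigma>"
proof -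
  interpret pair_sigma_finite "restrict_space lborel M :: (real ^ 'd) measure" "count_space (UNIV :: 'e set)"
    by (rule pair_sigma_finite_lebesgue_on_states[OF M])
  interpret L: sigma_finite_measure "lebesgue_on_states M :: ((real ^ 'd) \<times> 'e) measure"
    unfolding lebesgue_on_states_def by unfold_locales
  define V where "V = {\<sigma>. lsc_version M \<pi> \<sigma>}"
  define \<tau> where "\<tau> z = (SUP \<sigma>\<in>V. \<sigma> z)" for z
  obtain f where f: "f \<in> borel_measurable (lebesgue_on_states M)"
      "\<pi> = density (lebesgue_on_states M) f" "AE z in lebesgue_on_states M. \<rho> z = f z"
    using \<rho> by (auto simp: lsc_version_def density_version_def)
  have V_AE: "AE z in lebesgue_on_states M. \<sigma> z = f z" if "\<sigma> \<in> V" for \<sigma>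
  proof -
    obtain g where g: "g \<in> borel_measurable (lebesgue_on_states M)"
        "\<pi> = density (lebesgue_on_states M) g" "AE z in lebesgue_on_states M. \<sigma> z = g z"
      using \<open>\<sigma> \<in> V\<close> by (auto simp: V_def lsc_version_def density_version_def)
    have "AE z in lebesgue_on_states M. g z = f z"
      using L.density_unique_iff[OF g(1) f(1)] f(2) g(2) by simp
    with g(3) show ?thesis by eventually_elim simp
  qed
  have V_lsc: "lsc_on_states M \<sigma>" if "\<sigma> \<in> V" for \<sigma>
    using that by (simp add: V_def lsc_version_def)
  have upper: "\<sigma> z \<le> \<tau> z" if "\<sigma> \<in> V" for \<sigma> z
    unfolding \<tau>_def using that by (rule SUP_upper)
  have lsc: "lsc_on_states M \<tau>"
    unfolding lsc_on_states_def
  proof (intro allI ballI impI)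
    fix j x a assume x: "x \<in> M" and "a < \<tau> (x, j)"
    then obtain \<sigma> where \<sigma>: "\<sigma> \<in> V" "a < \<sigma> (x, j)"
      by (auto simp: \<tau>_def less_SUP_iff)
    then have "eventually (\<lambda>y. a < \<sigma> (y, j)) (at x within M)"
      using V_lsc x by (auto simp: lsc_on_states_def)
    then show "eventually (\<lambda>y. a < \<tau> (y, j)) (at x within M)"
      by eventually_elim (use upper[OF \<sigma>(1)] in \<open>auto intro: less_le_trans\<close>)
  qed
  have level: "AE x in lborel. x \<in> M \<longrightarrow> a < \<tau> (x, j) \<longrightarrow> a < f (x, j)" for a j
  proof -
    define F where "F = (\<lambda>\<sigma>. {x \<in> M. a < \<sigma> (x, j)}) ` V"
    have "openin (top_of_set M) S" if "S \<in> F" for S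
    proof -
      from that obtain \<sigma> where \<sigma>: "\<sigma> \<in> V" "S = {x \<in> M. a < \<sigma> (x, j)}"
        by (auto simp: F_def)
      have "\<exists>T. open T \<and> x \<in> T \<and> T \<inter> M \<subseteq> S" if "x \<in> S" for x
      proof -
        have "eventually (\<lambda>y. a < \<sigma> (y, j)) (at x within M)"
          using V_lsc[OF \<sigma>(1)] that \<sigma>(2) by (auto simp: lsc_on_states_def)
        then obtain T where "open T" "x \<in> T" "\<forall>y\<in>T. y \<noteq> x \<longrightarrow> y \<in> M \<longrightarrow> a < \<sigma> (y, j)"
          by (auto simp: eventually_at_topological)
        then show ?thesis
          using that \<sigma>(2) by (intro exI[of _ T]) auto
      qed
      then have "S = M \<inter> \<Union>{T. open T \<and> T \<inter> M \<subseteq> S}"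
        using \<sigma>(2) by blast
      then show ?thesis
        unfolding openin_open by (intro exI[of _ "\<Union>{T. open T \<and> T \<inter> M \<subseteq> S}"] conjI open_Union) auto
    qed
    then obtain F' where F': "F' \<subseteq> F" "countable F'" "\<Union>F' = \<Union>F"
      using Lindelof_openin[of F M] by blast
    have "AE x in lborel. \<forall>S\<in>F'. x \<in> S \<longrightarrow> a < f (x, j)"
    proof (subst AE_ball_countable[OF F'(2)], intro ballI)
      fix S assume "S \<in> F'"
      then obtain \<sigma> where \<sigma>: "\<sigma> \<in> V" "S = {x \<in> M. a < \<sigma> (x, j)}"
        using F'(1) by (auto simp: F_def)
      have "AE x in lborel. x \<in> M \<longrightarrow> \<sigma> (x, j) = f (x, j)"
        using V_AE[OF \<sigma>(1)] by (simp add: AE_lebesgue_on_states[OF M])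
      then show "AE x in lborel. x \<in> S \<longrightarrow> a < f (x, j)"
        by eventually_elim (auto simp: \<sigma>(2))
    qed
    then show ?thesis
    proof eventually_elim
      case (elim x)
      show ?case
      proof (intro impI)
        assume "x \<in> M" "a < \<tau> (x, j)"
        then have "x \<in> \<Union>F"
          by (auto simp: \<tau>_def less_SUP_iff F_def)
        then show "a < f (x, j)" using elim F'(3) by blast
      qed
    qed
  qed
  have "AE x in lborel. x \<in> M \<longrightarrow> \<tau> (x, j) = f (x, j)" for j
  proof -
    have "AE x in lborel. \<forall>q. x \<in> M \<longrightarrow> ennreal (real_of_rat q) < \<tau> (x, j) \<longrightarrow> ennreal (real_of_rat q) < f (x, j)"
      by (subst AE_all_countable) (use level in blast)
    moreover have "AE x in lborel. x \<in> M \<longrightarrow> \<rho> (x, j) = f (x, j)"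
      using f(3) by (simp add: AE_lebesgue_on_states[OF M])
    ultimately show ?thesis
    proof eventually_elim
      case (elim x)
      show ?case
      proof
        assume x: "x \<in> M"
        have "f (x, j) \<le> \<tau> (x, j)"
          using elim(2) x upper[of \<rho> "(x, j)"] \<rho> by (simp add: V_def)
        moreover have "\<tau> (x, j) \<le> f (x, j)"
        proof (rule ccontr)
          assume "\<not> \<tau> (x, j) \<le> f (x, j)"
          then obtain q where "f (x, j) < ennreal (real_of_rat q)" "ennreal (real_of_rat q) < \<tau> (x, j)"
            using ennreal_rat_dense[of "f (x, j)" "\<tau> (x, j)"] by (auto simp: not_le)
          with elim(1) x show False by (meson less_asym)
        qed
        ultimately show "\<tau> (x, j) = f (x, j)" by simp
      qed
    qed
  qed
  then have "AE z in lebesgue_on_states M. \<tau> z = f z"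
    by (simp add: AE_lebesgue_on_states[OF M])
  then have "lsc_version M \<pi> \<tau>"
    using f lsc by (auto simp: lsc_version_def density_version_def)
  then have "greatest_lsc_version M \<pi> \<tau>"
    using upper by (auto simp: greatest_lsc_version_def V_def)
  then show ?thesis by blast
qed

end

theory Submission
  imports Defs
begin

text \<open>The density at \<open>(y, i)\<close> collects the mass carried along the backward orbit of \<open>y\<close> under
  \<open>\<phi> i\<close>. Near \<open>\<Gamma>\<close> the field \<open>v i\<close> contracts volume at rate almost \<open>R(\<Gamma>, i)\<close>, so pulling back a
  small set \<open>B\<close> by time \<open>t\<close> multiplies its volume by almost \<open>exp (R t)\<close>, while the probability of not
  leaving state \<open>i\<close> is \<open>exp (Q $ i $ i * t) \<ge> exp (- R t)\<close>. If the other densities are bounded below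
  near \<open>\<Gamma>\<close>, jumps into \<open>i\<close> feed the density at a rate bounded below at all times \<open>t \<le> T\<close>, and the
  contributions add up to a multiple of \<open>T\<close>, for every \<open>T\<close>.

  The points near which the density is bounded below form an open set \<open>O\<close>, invariant under all
  forward flows, and non-empty by lower semi-continuity since an accessible point lies in the
  support. By accessibility \<open>O\<close> is dense near \<open>\<Gamma>\<close>. If \<open>x \<in> \<Gamma>\<close> were outside \<open>O\<close>, the complement of
  \<open>O\<close> would be a backward invariant set containing \<open>x\<close>; by Krener's theorem for the reversed flows
  it would have interior points near \<open>x\<close>, contradicting density.\<close>

section \<open>Flows of continuously differentiable vector fields\<close>

text \<open>The obstacle is the critical case \<open>- Q $ i $ i = R(\<Gamma>, i)\<close>. On a
  neighbourhood of \<open>\<Gamma>\<close> the divergence is only known to be at most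
  \<open>- r\<close> with \<open>r < R\<close>, so on a fixed neighbourhood the bounds for the
  contributions may decay geometrically in time. The order of choice resolves this: step length
  \<open>h\<close> and gain per step are fixed first, then the horizon \<open>T\<close>, then
  \<open>r = R - 1 / T\<close> and a neighbourhood depending on \<open>T\<close>. Over that horizon
  the total loss is at most a factor \<open>exp (- 1)\<close>, so \<open>m\<close> steps contribute
  \<open>m\<close> times a constant.

  No transition semigroup and no equation for the density is used. Each state carries the measure
  \<open>occ j\<close>, and stationarity turns two kinds of path, those without a jump and those
  with exactly one jump up to time \<open>h\<close>, into inequalities between these measures.
  Density bounds are therefore stated on Borel sets (\<open>dominates\<close>); versions of the
  density occur only where positivity is first found and where the conclusion is read off.\<close>

lemma gronwall:
  fixes u :: "real \<Rightarrow> 'a::real_inner"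
  assumes T: "0 \<le> T" and cont: "continuous_on {0..T} u"
    and der: "\<And>t. 0 < t \<Longrightarrow> t < T \<Longrightarrow> (u has_vector_derivative u' t) (at t)"
    and bnd: "\<And>t. 0 < t \<Longrightarrow> t < T \<Longrightarrow> norm (u' t) \<le> L * norm (u t) + e"
    and L: "0 \<le> L" and e: "0 \<le> e"
  shows "norm (u T) \<le> (norm (u 0) + e * T) * exp (L * T)"
proof -
  have *: "norm (u T) * exp (- (L * T)) - e * T \<le> norm (u 0) + d" if "d > 0" for d
  proof -
    \<comment> \<open>The norm is not differentiable at 0; \<open>f\<close> is a smooth majorant of
      \<open>norm (u t)\<close> which exceeds it by at most \<open>d\<close>, and \<open>d\<close>
      tends to 0 at the end. In \<open>g\<close> the term \<open>e * t\<close> absorbs the source,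
      as \<open>exp (- (L * t)) \<le> 1\<close>.\<close>
    define f where "f t = sqrt (u t \<bullet> u t + d\<^sup>2)" for t
    define g where "g t = f t * exp (- (L * t)) - e * t" for t
    have pos: "u t \<bullet> u t + d\<^sup>2 > 0" for t
      using \<open>d > 0\<close> by (simp add: add_nonneg_pos)
    have f_pos: "f t > 0" for t
      using pos[of t] by (simp add: f_def)
    have f_ge: "norm (u t) \<le> f t" for t
      by (simp add: f_def norm_eq_sqrt_inner)
    have "g T \<le> g 0"
    proof (rule DERIV_nonpos_imp_decreasing_open[OF T])
      show "continuous_on {0..T} g"
        unfolding g_def f_def by (intro continuous_intros cont)
      fix t assume t: "0 < t" "t < T"
      have "((\<lambda>t. u t \<bullet> u t) has_vector_derivative (u t \<bullet> u' t + u' t \<bullet> u t)) (at t)"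
        by (rule bounded_bilinear.has_vector_derivative[OF bounded_bilinear_inner der der]) (use t in auto)
      then have d1: "((\<lambda>t. u t \<bullet> u t) has_real_derivative 2 * (u t \<bullet> u' t)) (at t)"
        by (simp add: has_real_derivative_iff_has_vector_derivative inner_commute)
      have "(f has_real_derivative ((u t \<bullet> u' t) / f t)) (at t)"
        unfolding f_def using pos[of t]
        by (auto intro!: derivative_eq_intros d1 simp: field_simps)
      then have "(g has_real_derivative ((u t \<bullet> u' t) / f t - L * f t) * exp (- (L * t)) - e) (at t)"
        unfolding g_def by (auto intro!: derivative_eq_intros simp: algebra_simps)
      moreover have "((u t \<bullet> u' t) / f t - L * f t) * exp (- (L * t)) - e \<le> 0"
      proof -
        have "u t \<bullet> u' t \<le> norm (u t) * norm (u' t)"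
          by (rule norm_cauchy_schwarz)
        also have "\<dots> \<le> f t * (L * f t + e)"
          using bnd[OF t] f_ge[of t] f_pos[of t] L e
          by (intro mult_mono order.trans[OF bnd[OF t]] add_mono mult_left_mono) auto
        finally have "(u t \<bullet> u' t) / f t - L * f t \<le> e"
          using f_pos[of t] by (simp add: field_simps)
        moreover have "exp (- (L * t)) \<le> 1" using L t by simp
        ultimately have "((u t \<bullet> u' t) / f t - L * f t) * exp (- (L * t)) \<le> e * 1"
          using e by (intro order.trans[OF mult_right_mono mult_left_mono]) auto
        then show ?thesis by simp
      qed
      ultimately show "\<exists>y. DERIV g t :> y \<and> y \<le> 0" by blast
    qed
    moreover have "f 0 \<le> norm (u 0) + d"
      using \<open>d > 0\<close> sqrt_add_le_add_sqrt[of "u 0 \<bullet> u 0" "d\<^sup>2"] by (simp add: f_def norm_eq_sqrt_inner)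
    moreover have "norm (u T) * exp (- (L * T)) \<le> f T * exp (- (L * T))"
      using f_ge by (intro mult_right_mono) auto
    ultimately show ?thesis by (simp only: g_def mult_zero_right minus_zero exp_zero mult_1_right)
  qed
  have "norm (u T) * exp (- (L * T)) - e * T \<le> norm (u 0)"
    using * by (rule field_le_epsilon)
  then have "norm (u T) * exp (- (L * T)) * exp (L * T) \<le> (norm (u 0) + e * T) * exp (L * T)"
    by (intro mult_right_mono) auto
  then show ?thesis by (simp add: mult.assoc flip: exp_add)
qed

lemma gronwall_two_sided:
  fixes u :: "real \<Rightarrow> 'a::real_inner"
  assumes der: "\<And>t. \<bar>t\<bar> \<le> T \<Longrightarrow> (u has_vector_derivative u' t) (at t)"
    and bnd: "\<And>t. \<bar>t\<bar> \<le> T \<Longrightarrow> norm (u' t) \<le> L * norm (u t) + e"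
    and L: "0 \<le> L" and e: "0 \<le> e" and t: "\<bar>t\<bar> \<le> T"
  shows "norm (u t) \<le> (norm (u 0) + e * T) * exp (L * T)"
proof -
  have "norm (u t) \<le> (norm (u 0) + e * \<bar>t\<bar>) * exp (L * \<bar>t\<bar>)"
  proof (cases "t \<ge> 0")
    case True
    then show ?thesis
      using t by (simp, intro gronwall[where u' = u'])
        (auto intro!: der bnd L e continuous_at_imp_continuous_on has_vector_derivative_continuous)
  next
    case False
    have d: "((\<lambda>s. u (- s)) has_vector_derivative - u' (- s)) (at s)" if "\<bar>s\<bar> \<le> T" for s
      using vector_diff_chain_at[of "uminus" "-1" s u "u' (- s)"] der[of "- s"] that
        has_vector_derivative_minus[OF has_vector_derivative_id, of "at s"]
      by (simp add: o_def)
    have "norm (u (- (- t))) \<le> (norm (u (- 0)) + e * (- t)) * exp (L * (- t))"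
      using False t bnd[of "- s" for s]
      by (intro gronwall[where u' = "\<lambda>s. - u' (- s)"])
        (auto intro!: d L e continuous_at_imp_continuous_on has_vector_derivative_continuous)
    then show ?thesis using False by simp
  qed
  also have "\<dots> \<le> (norm (u 0) + e * T) * exp (L * T)"
    using t e L by (intro mult_mono add_mono mult_left_mono) (auto intro!: mult_left_mono)
  finally show ?thesis .
qed

text \<open>The axioms only say that each orbit solves the equation; the group law, joint continuity
  and differentiability in the initial point are derived. Boundedness of \<open>v\<close> keeps
  orbits over bounded times in a ball, so that constants on balls suffice.\<close>

locale C1_flow =
  fixes v :: "'a::euclidean_space \<Rightarrow> 'a" and v' :: "'a \<Rightarrow> 'a \<Rightarrow>\<^sub>L 'a" and \<phi> :: "real \<Rightarrow> 'a \<Rightarrow> 'a"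
  assumes v_deriv: "(v has_derivative blinfun_apply (v' x)) (at x)"
    and v'_cont: "continuous_on UNIV v'"
    and v_bdd: "bounded (range v)"
    and flow_0 [simp]: "\<phi> 0 x = x"
    and flow_deriv: "((\<lambda>s. \<phi> s x) has_vector_derivative v (\<phi> t x)) (at t)"
begin

definition speed :: real where "speed = (SOME V. 0 \<le> V \<and> (\<forall>x. norm (v x) \<le> V))"

lemma speed: "0 \<le> speed" "norm (v x) \<le> speed"
proof -
  from v_bdd obtain B where "\<forall>x. norm (v x) \<le> B" by (auto simp: bounded_iff)
  then have "\<exists>V. 0 \<le> V \<and> (\<forall>x. norm (v x) \<le> V)"
    by (intro exI[of _ "\<bar>B\<bar>"]) (auto intro: order.trans abs_ge_self)
  from someI_ex[OF this] show "0 \<le> speed" "norm (v x) \<le> speed"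
    by (auto simp: speed_def)
qed

lemma flow_cont_time: "continuous_on S (\<lambda>t. \<phi> t x)"
  by (intro continuous_at_imp_continuous_on ballI has_vector_derivative_continuous[OF flow_deriv])

lemma flow_dist: "norm (\<phi> t x - x) \<le> speed * \<bar>t\<bar>"
proof -
  have "norm (\<phi> t x - \<phi> 0 x) \<le> speed * norm (t - 0)"
    by (rule differentiable_bound[of UNIV _ "\<lambda>t h. h *\<^sub>R v (\<phi> t x)"])
      (use flow_deriv speed in \<open>auto simp: has_vector_derivative_def onorm_scaleR_left onorm_id\<close>)
  then show ?thesis by simp
qed

lemma flow_in_cball: "x \<in> cball 0 R \<Longrightarrow> \<bar>t\<bar> \<le> T \<Longrightarrow> \<phi> t x \<in> cball 0 (R + speed * T)"
proof -
  assume x: "x \<in> cball 0 R" and t: "\<bar>t\<bar> \<le> T"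
  have "norm (\<phi> t x) \<le> norm x + norm (\<phi> t x - x)"
    by (metis add_diff_cancel_left' diff_add_cancel norm_triangle_ineq)
  also have "\<dots> \<le> R + speed * T"
    using x t flow_dist[of t x] mult_left_mono[OF t speed(1)] by auto
  finally show ?thesis by simp
qed

lemma v_lipschitz: "\<exists>L\<ge>0. (\<forall>x\<in>cball 0 R. norm (v' x) \<le> L) \<and>
   (\<forall>x\<in>cball 0 R. \<forall>y\<in>cball 0 R. norm (v x - v y) \<le> L * norm (x - y))"
proof -
  have "compact (v' ` cball 0 R)"
    by (rule compact_continuous_image[OF continuous_on_subset[OF v'_cont subset_UNIV] compact_cball])
  from compact_imp_bounded[OF this] obtain L where L0: "L > 0" "\<forall>y\<in>v' ` cball 0 R. norm y \<le> L"
    unfolding bounded_pos by blast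
  then have L: "L > 0" "\<And>x. x \<in> cball 0 R \<Longrightarrow> norm (v' x) \<le> L"
    by blast+
  have "norm (v x - v y) \<le> L * norm (x - y)" if "x \<in> cball 0 R" "y \<in> cball 0 R" for x y
  proof (rule differentiable_bound[of "cball 0 R" _ "\<lambda>x. blinfun_apply (v' x)"])
    show "(v has_derivative blinfun_apply (v' z)) (at z within cball 0 R)" for z
      by (rule has_derivative_at_withinI[OF v_deriv])
    show "onorm (blinfun_apply (v' z)) \<le> L" if "z \<in> cball 0 R" for z
      using L(2)[OF that] by (simp only: norm_blinfun.rep_eq)
  qed (use that in auto)
  with L(2) show ?thesis by (intro exI[of _ L] conjI ballI less_imp_le[OF L(1)])
qed

text \<open>Uniform continuity of \<open>v'\<close> on the ball enlarged by 1 makes \<open>d\<close>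
  independent of the base point, which later makes all estimates on difference quotients
  uniform.\<close>

lemma v_linearization:
  assumes "e > 0"
  shows "\<exists>d>0. \<forall>x\<in>cball 0 R. \<forall>y z. dist y x < d \<longrightarrow> dist z x < d \<longrightarrow>
    norm (v y - v z - blinfun_apply (v' x) (y - z)) \<le> e * norm (y - z)"
proof -
  have "uniformly_continuous_on (cball 0 (R + 1)) v'"
    by (rule compact_uniformly_continuous[OF continuous_on_subset[OF v'_cont subset_UNIV] compact_cball])
  from this[unfolded uniformly_continuous_on_def, rule_format, OF assms]
  obtain d where d: "d > 0" and d2: "\<forall>x\<in>cball 0 (R + 1). \<forall>y\<in>cball 0 (R + 1). dist y x < d \<longrightarrow> dist (v' y) (v' x) < e"
    by blast
  show ?thesis
  proof (intro exI[of _ "min d 1"] conjI ballI allI impI)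
    fix x y z :: 'a assume x: "x \<in> cball 0 R" and yz: "dist y x < min d 1" "dist z x < min d 1"
    have "norm (v y - v z - blinfun_apply (v' x) (y - z)) \<le> norm (y - z) * e"
    proof (rule differentiable_bound_linearization[of z y "ball x (min d 1)" v "\<lambda>x. blinfun_apply (v' x)" x])
      fix w assume w: "w \<in> ball x (min d 1)"
      show "(v has_derivative blinfun_apply (v' w)) (at w within ball x (min d 1))"
        by (rule has_derivative_at_withinI[OF v_deriv])
      have "norm w \<le> R + 1"
        using w x norm_triangle_sub[of w x] by (simp add: dist_norm norm_minus_commute)
      then have "dist (v' w) (v' x) < e"
        using w x d2 by (simp add: dist_commute)
      moreover have "blinfun_apply (v' w) - blinfun_apply (v' x) = blinfun_apply (v' w - v' x)"
        by (simp add: fun_eq_iff blinfun.diff_left)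
      ultimately show "onorm (blinfun_apply (v' w) - blinfun_apply (v' x)) \<le> e"
        by (simp only: dist_norm norm_blinfun.rep_eq[symmetric] less_imp_le)
    next
      fix t :: real assume "t \<in> {0..1}"
      moreover have "z + t *\<^sub>R (y - z) = (1 - t) *\<^sub>R z + t *\<^sub>R y" by (simp add: algebra_simps)
      ultimately show "z + t *\<^sub>R (y - z) \<in> ball x (min d 1)"
        using convexD[OF convex_ball[of x "min d 1"], of z y "1 - t" t] yz by (simp add: dist_commute)
    qed (use d in auto)
    then show "norm (v y - v z - blinfun_apply (v' x) (y - z)) \<le> e * norm (y - z)" by (simp add: mult.commute)
  qed (use d in auto)
qed

lemma flow_lipschitz:
  "\<exists>L\<ge>0. \<forall>x\<in>cball 0 R. \<forall>y\<in>cball 0 R. \<forall>t. \<bar>t\<bar> \<le> T \<longrightarrow> norm (\<phi> t x - \<phi> t y) \<le> L * norm (x - y)"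
proof -
  obtain L where L: "L \<ge> 0" "\<And>x y. x \<in> cball 0 (R + speed * T) \<Longrightarrow> y \<in> cball 0 (R + speed * T) \<Longrightarrow>
      norm (v x - v y) \<le> L * norm (x - y)"
    using v_lipschitz[of "R + speed * T"] by blast
  have "norm (\<phi> t x - \<phi> t y) \<le> exp (L * T) * norm (x - y)"
    if "x \<in> cball 0 R" "y \<in> cball 0 R" "\<bar>t\<bar> \<le> T" for x y t
  proof -
    have "norm (\<phi> t x - \<phi> t y) \<le> (norm (\<phi> 0 x - \<phi> 0 y) + 0 * T) * exp (L * T)"
    proof (rule gronwall_two_sided[where u' = "\<lambda>t. v (\<phi> t x) - v (\<phi> t y)"])
      show "((\<lambda>t. \<phi> t x - \<phi> t y) has_vector_derivative v (\<phi> s x) - v (\<phi> s y)) (at s)" for s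
        by (intro has_vector_derivative_diff flow_deriv)
      show "norm (v (\<phi> s x) - v (\<phi> s y)) \<le> L * norm (\<phi> s x - \<phi> s y) + 0" if "\<bar>s\<bar> \<le> T" for s
        using L(2)[OF flow_in_cball flow_in_cball] that \<open>x \<in> _\<close> \<open>y \<in> _\<close> by simp
    qed (use L that in auto)
    then show ?thesis by (simp add: mult.commute)
  qed
  then show ?thesis by (intro exI[of _ "exp (L * T)"]) auto
qed

text \<open>As functions of \<open>s\<close> both sides solve the same equation with the same value
  at 0, so Gronwall with zero initial difference and zero source identifies them. \<open>R\<close>
  is the radius of a ball containing both curves.\<close>

lemma flow_add: "\<phi> (s + t) x = \<phi> s (\<phi> t x)"
proof -
  define R where "R = norm x + speed * (\<bar>s\<bar> + \<bar>t\<bar>)"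
  have in_R: "\<phi> (r + t) x \<in> cball 0 R" "\<phi> r (\<phi> t x) \<in> cball 0 R" if "\<bar>r\<bar> \<le> \<bar>s\<bar>" for r
    using flow_in_cball[of x "norm x" "r + t" "\<bar>s\<bar> + \<bar>t\<bar>"] that
      flow_in_cball[OF flow_in_cball[of x "norm x" t "\<bar>t\<bar>"], of r "\<bar>s\<bar>"]
    by (auto simp: R_def algebra_simps)
  obtain L where L: "L \<ge> 0" "\<And>x y. x \<in> cball 0 R \<Longrightarrow> y \<in> cball 0 R \<Longrightarrow> norm (v x - v y) \<le> L * norm (x - y)"
    using v_lipschitz[of R] by blast
  have d: "((\<lambda>r. \<phi> (r + t) x) has_vector_derivative v (\<phi> (r + t) x)) (at r)" for r
    using vector_diff_chain_at[OF has_vector_derivative_add_const[THEN iffD2, OF has_vector_derivative_id] flow_deriv[of x "r + t"]]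
    by (simp add: o_def)
  have "norm (\<phi> (s + t) x - \<phi> s (\<phi> t x)) \<le> (norm (\<phi> (0 + t) x - \<phi> 0 (\<phi> t x)) + 0 * \<bar>s\<bar>) * exp (L * \<bar>s\<bar>)"
  proof (rule gronwall_two_sided[where u' = "\<lambda>r. v (\<phi> (r + t) x) - v (\<phi> r (\<phi> t x))"])
    show "((\<lambda>r. \<phi> (r + t) x - \<phi> r (\<phi> t x)) has_vector_derivative
        v (\<phi> (r + t) x) - v (\<phi> r (\<phi> t x))) (at r)" for r
      by (intro has_vector_derivative_diff d flow_deriv)
    show "norm (v (\<phi> (r + t) x) - v (\<phi> r (\<phi> t x))) \<le> L * norm (\<phi> (r + t) x - \<phi> r (\<phi> t x)) + 0"
      if "\<bar>r\<bar> \<le> \<bar>s\<bar>" for r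
      using L(2)[OF in_R[OF that]] by simp
  qed (use L in auto)
  then show ?thesis by simp
qed

lemma flow_inverse [simp]: "\<phi> t (\<phi> (- t) x) = x" "\<phi> (- t) (\<phi> t x) = x"
  using flow_add[of t "- t" x] flow_add[of "- t" t x] by auto

text \<open>Stated for curves that solve the equation only inside \<open>{0..T}\<close>, since a
  path of the process follows one field only between two jumps.\<close>

lemma flow_unique:
  assumes "0 \<le> T" and cont: "continuous_on {0..T} u"
    and der: "\<And>t. 0 < t \<Longrightarrow> t < T \<Longrightarrow> (u has_vector_derivative v (u t)) (at t)"
  shows "u T = \<phi> T (u 0)"
proof -
  have "compact (u ` {0..T} \<union> (\<lambda>t. \<phi> t (u 0)) ` {0..T})"
    by (intro compact_Un compact_continuous_image cont flow_cont_time) auto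
  then obtain R where R: "\<forall>y \<in> u ` {0..T} \<union> (\<lambda>t. \<phi> t (u 0)) ` {0..T}. norm y \<le> R"
    using compact_imp_bounded bounded_iff by metis
  obtain L where L: "L \<ge> 0" "\<And>x y. x \<in> cball 0 R \<Longrightarrow> y \<in> cball 0 R \<Longrightarrow> norm (v x - v y) \<le> L * norm (x - y)"
    using v_lipschitz[of R] by blast
  have "norm (u T - \<phi> T (u 0)) \<le> (norm (u 0 - \<phi> 0 (u 0)) + 0 * T) * exp (L * T)"
  proof (rule gronwall[where u' = "\<lambda>t. v (u t) - v (\<phi> t (u 0))"])
    show "continuous_on {0..T} (\<lambda>t. u t - \<phi> t (u 0))"
      by (intro continuous_on_diff cont flow_cont_time)
    show "((\<lambda>t. u t - \<phi> t (u 0)) has_vector_derivative v (u t) - v (\<phi> t (u 0))) (at t)"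
      if "0 < t" "t < T" for t
      by (intro has_vector_derivative_diff der flow_deriv that)
    show "norm (v (u t) - v (\<phi> t (u 0))) \<le> L * norm (u t - \<phi> t (u 0)) + 0" if "0 < t" "t < T" for t
      using L(2)[of "u t" "\<phi> t (u 0)"] R that by simp
  qed (use assms L in auto)
  then show ?thesis by simp
qed

lemma flow_cont: "continuous_on UNIV (\<lambda>(t, x). \<phi> t x)"
proof (intro continuous_at_imp_continuous_on ballI)
  fix p :: "real \<times> 'a"
  obtain t0 x0 where p: "p = (t0, x0)" by force
  obtain L where L: "L \<ge> 0" "\<And>x y t. x \<in> cball 0 (norm x0 + 1) \<Longrightarrow> y \<in> cball 0 (norm x0 + 1) \<Longrightarrow>
      \<bar>t\<bar> \<le> \<bar>t0\<bar> + 1 \<Longrightarrow> norm (\<phi> t x - \<phi> t y) \<le> L * norm (x - y)"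
    using flow_lipschitz[of "norm x0 + 1" "\<bar>t0\<bar> + 1"] by metis
  have "(\<lambda>(t, x). \<phi> t x) \<midarrow>p\<rightarrow> \<phi> t0 x0"
  proof (rule LIM_zero_cancel, rule Lim_null_comparison)
    have "eventually (\<lambda>q. dist q p < 1) (at p)"
      unfolding eventually_at by (rule exI[of _ 1]) auto
    then show "\<forall>\<^sub>F q in at p. norm ((case q of (t, x) \<Rightarrow> \<phi> t x) - \<phi> t0 x0) \<le>
        L * norm (snd q - x0) + speed * norm (fst q - t0)"
    proof eventually_elim
      case (elim q)
      obtain t x where q: "q = (t, x)" by force
      have tx: "dist t t0 < 1" "dist x x0 < 1"
        using elim dist_fst_le[of q p] dist_snd_le[of q p] by (auto simp: q p)
      have "norm x \<le> norm x0 + 1"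
        using tx norm_triangle_sub[of x x0] by (auto simp: dist_norm)
      then have "norm (\<phi> t x - \<phi> t x0) \<le> L * norm (x - x0)"
        using tx by (intro L(2)) (auto simp: dist_norm)
      moreover have "norm (\<phi> t x0 - \<phi> t0 x0) \<le> speed * norm (t - t0)"
        using flow_dist[of "t - t0" "\<phi> t0 x0"] flow_add[of "t - t0" t0 x0] by simp
      ultimately show ?case
        using norm_triangle_ineq[of "\<phi> t x - \<phi> t x0" "\<phi> t x0 - \<phi> t0 x0"] by (simp add: q)
    qed
    show "((\<lambda>q. L * norm (snd q - x0) + speed * norm (fst q - t0)) \<longlongrightarrow> 0) (at p)"
      by (auto simp: p intro!: tendsto_eq_intros)
  qed
  then show "isCont (\<lambda>(t, x). \<phi> t x) p" by (simp add: isCont_def p)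
qed

lemma flow_cont_compose [continuous_intros]:
  "continuous_on S f \<Longrightarrow> continuous_on S g \<Longrightarrow> continuous_on S (\<lambda>a. \<phi> (f a) (g a))"
  using continuous_on_compose2[OF flow_cont continuous_on_Pair[of S f g]] by simp

lemma flow_vimage_borel: "B \<in> sets borel \<Longrightarrow> \<phi> t -` B \<in> sets borel"
  using measurable_sets[OF borel_measurable_continuous_onI[OF flow_cont_compose[OF continuous_on_const continuous_on_id]], of B t]
  by simp

lemma flow_vimage_open: "open B \<Longrightarrow> open (\<phi> t -` B)"
  using open_vimage[OF _ flow_cont_compose[OF continuous_on_const continuous_on_id], of B t] by simp

lemma flow_image: "\<phi> t ` A = \<phi> (- t) -` A"
  by (force simp: image_iff intro: bexI[of _ "\<phi> (- t) _"])

end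

context C1_flow begin

text \<open>The derivative in the initial point is the uniform limit of the difference quotients, which are
  Cauchy by Gronwall's inequality. No existence theorem for the variational equation is needed.\<close>

definition quot :: "real \<Rightarrow> real \<Rightarrow> 'a \<Rightarrow> 'a \<Rightarrow> 'a" where
  "quot h t x e = (\<phi> t (x + h *\<^sub>R e) - \<phi> t x) /\<^sub>R h"

lemma quot_deriv:
  "((\<lambda>t. quot h t x e) has_vector_derivative (v (\<phi> t (x + h *\<^sub>R e)) - v (\<phi> t x)) /\<^sub>R h) (at t)"
  unfolding quot_def
  by (rule bounded_linear.has_vector_derivative[OF bounded_linear_scaleR_right])
    (rule has_vector_derivative_diff[OF flow_deriv flow_deriv])

lemma quot_0: "h \<noteq> 0 \<Longrightarrow> quot h 0 x e = e"
  by (simp add: quot_def)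

lemma flow_increment:
  "\<exists>K\<ge>0. \<forall>x\<in>cball 0 R. \<forall>e\<in>cball 0 E. \<forall>h t. \<bar>h\<bar> \<le> 1 \<longrightarrow> \<bar>t\<bar> \<le> T \<longrightarrow>
     norm (\<phi> t (x + h *\<^sub>R e) - \<phi> t x) \<le> K * \<bar>h\<bar> \<and> norm (quot h t x e) \<le> K"
proof -
  obtain L where L: "L \<ge> 0" "\<forall>x\<in>cball 0 (R + E). \<forall>y\<in>cball 0 (R + E). \<forall>t. \<bar>t\<bar> \<le> T \<longrightarrow>
      norm (\<phi> t x - \<phi> t y) \<le> L * norm (x - y)"
    using flow_lipschitz by blast
  define K where "K = L * \<bar>E\<bar>"
  have K: "K \<ge> 0" using L by (simp add: K_def)
  show ?thesis
  proof (intro exI[of _ K] conjI ballI allI impI K)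
    fix x e :: 'a and h t :: real
    assume a: "x \<in> cball 0 R" "e \<in> cball 0 E" "\<bar>h\<bar> \<le> 1" "\<bar>t\<bar> \<le> T"
    have E: "norm e \<le> E" "0 \<le> E" using a(2) norm_ge_zero[of e] by (auto simp del: norm_ge_zero)
    have he: "norm (h *\<^sub>R e) \<le> \<bar>h\<bar> * E" using E by (simp add: mult_left_mono)
    also have "\<dots> \<le> E" using a(3) E by (simp add: mult_left_le_one_le)
    finally have "norm (h *\<^sub>R e) \<le> E" .
    then have "norm (x + h *\<^sub>R e) \<le> R + E"
      using a(1) norm_triangle_ineq[of x "h *\<^sub>R e"] unfolding mem_cball dist_0_norm by linarith
    then have "norm (\<phi> t (x + h *\<^sub>R e) - \<phi> t x) \<le> L * norm (h *\<^sub>R e)"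
      using L(2)[rule_format, of "x + h *\<^sub>R e" x t] a E by simp
    also have "\<dots> \<le> K * \<bar>h\<bar>"
      using mult_left_mono[OF he L(1)] E by (simp add: K_def mult.commute mult.left_commute)
    finally show *: "norm (\<phi> t (x + h *\<^sub>R e) - \<phi> t x) \<le> K * \<bar>h\<bar>" .
    have "norm (quot h t x e) = norm (\<phi> t (x + h *\<^sub>R e) - \<phi> t x) / \<bar>h\<bar>"
      by (simp add: quot_def divide_inverse mult.commute)
    with * K show "norm (quot h t x e) \<le> K"
      by (cases "h = 0") (simp_all add: pos_divide_le_eq)
  qed
qed

text \<open>Up to an error \<open>\<eta>\<close> that is uniform in \<open>x\<close>,
  \<open>e\<close> and \<open>t\<close>, difference quotients solve the linearised equation along
  the orbit.\<close>

lemma quot_deriv_approx: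
  assumes "\<eta> > 0"
  shows "\<exists>d>0. \<forall>x\<in>cball 0 R. \<forall>e\<in>cball 0 E. \<forall>h t. \<bar>h\<bar> < d \<longrightarrow> \<bar>t\<bar> \<le> T \<longrightarrow>
    norm ((v (\<phi> t (x + h *\<^sub>R e)) - v (\<phi> t x)) /\<^sub>R h - v' (\<phi> t x) (quot h t x e)) \<le> \<eta>"
proof -
  obtain K where K: "K \<ge> 0" "\<forall>x\<in>cball 0 R. \<forall>e\<in>cball 0 E. \<forall>h t. \<bar>h\<bar> \<le> 1 \<longrightarrow> \<bar>t\<bar> \<le> T \<longrightarrow>
     norm (\<phi> t (x + h *\<^sub>R e) - \<phi> t x) \<le> K * \<bar>h\<bar> \<and> norm (quot h t x e) \<le> K"
    using flow_increment by blast
  \<comment> \<open>The linearisation error is relative to the increment, which is at most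
    \<open>K * \<bar>h\<bar>\<close>; the denominator \<open>K + 1\<close> covers
    \<open>K = 0\<close>.\<close>
  define c where "c = \<eta> / (K + 1)"
  have c: "c > 0" "c * K \<le> \<eta>" using K assms by (auto simp: c_def field_simps)
  obtain d0 where d0: "d0 > 0" "\<forall>x\<in>cball 0 (R + speed * T). \<forall>y z. dist y x < d0 \<longrightarrow> dist z x < d0 \<longrightarrow>
    norm (v y - v z - blinfun_apply (v' x) (y - z)) \<le> c * norm (y - z)"
    using v_linearization[OF c(1)] by blast
  show ?thesis
  proof (intro exI[of _ "min 1 (d0 / (K + 1))"] conjI ballI allI impI)
    show "0 < min 1 (d0 / (K + 1))" using d0 K by simp
    fix x e :: 'a and h t :: real
    assume a: "x \<in> cball 0 R" "e \<in> cball 0 E" "\<bar>h\<bar> < min 1 (d0 / (K + 1))" "\<bar>t\<bar> \<le> T"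
    let ?y = "\<phi> t (x + h *\<^sub>R e)" and ?x = "\<phi> t x"
    show "norm ((v ?y - v ?x) /\<^sub>R h - v' ?x (quot h t x e)) \<le> \<eta>"
    proof (cases "h = 0")
      case True
      then show ?thesis using assms by (simp add: quot_def blinfun.zero_right)
    next
      case False
      have 1: "norm (?y - ?x) \<le> K * \<bar>h\<bar>" using K(2) a by simp
      also have "\<dots> \<le> (K + 1) * \<bar>h\<bar>" by (intro mult_right_mono) auto
      also have "\<dots> < d0" using a(3) K by (simp add: field_simps)
      finally have "dist ?y ?x < d0" by (simp add: dist_norm)
      then have "norm (v ?y - v ?x - v' ?x (?y - ?x)) \<le> c * norm (?y - ?x)"
        using d0 flow_in_cball[OF a(1) a(4)] by (simp add: d0(2)[rule_format])
      also have "\<dots> \<le> c * (K * \<bar>h\<bar>)" using 1 c by (intro mult_left_mono) auto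
      also have "\<dots> \<le> \<eta> * \<bar>h\<bar>" using mult_right_mono[OF c(2), of "\<bar>h\<bar>"] by simp
      finally have "norm (v ?y - v ?x - v' ?x (?y - ?x)) / \<bar>h\<bar> \<le> \<eta>"
        using False by (simp add: field_simps)
      moreover have "(v ?y - v ?x) /\<^sub>R h - v' ?x (quot h t x e) = (v ?y - v ?x - v' ?x (?y - ?x)) /\<^sub>R h"
        by (simp add: quot_def blinfun.bilinear_simps algebra_simps)
      ultimately show ?thesis by (simp add: divide_inverse mult.commute)
    qed
  qed
qed

lemma quot_cauchy:
  assumes "\<epsilon> > 0"
  shows "\<exists>d>0. \<forall>x\<in>cball 0 R. \<forall>e\<in>cball 0 E. \<forall>h k t. h \<noteq> 0 \<longrightarrow> k \<noteq> 0 \<longrightarrow> \<bar>h\<bar> < d \<longrightarrow> \<bar>k\<bar> < d \<longrightarrow> \<bar>t\<bar> \<le> T \<longrightarrow>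
    norm (quot h t x e - quot k t x e) \<le> \<epsilon>"
proof -
  obtain L where L: "L \<ge> 0" "\<forall>x\<in>cball 0 (R + speed * T). norm (v' x) \<le> L"
    using v_lipschitz by blast
  \<comment> \<open>Two quotients start at the same vector \<open>e\<close> and each solves the
    linear equation up to \<open>\<eta>\<close>, so Gronwall leaves
    \<open>2 * \<eta> * T * exp (L * T)\<close>.\<close>
  define \<eta> where "\<eta> = \<epsilon> / (2 * (\<bar>T\<bar> + 1) * exp (L * T))"
  have "0 < 2 * (\<bar>T\<bar> + 1) * exp (L * T)" by (intro mult_pos_pos) auto
  then have \<eta>: "\<eta> > 0" "\<eta> * (2 * (\<bar>T\<bar> + 1) * exp (L * T)) = \<epsilon>"
    using assms by (auto simp: \<eta>_def)
  obtain d where d: "d > 0" "\<forall>x\<in>cball 0 R. \<forall>e\<in>cball 0 E. \<forall>h t. \<bar>h\<bar> < d \<longrightarrow> \<bar>t\<bar> \<le> T \<longrightarrow>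
    norm ((v (\<phi> t (x + h *\<^sub>R e)) - v (\<phi> t x)) /\<^sub>R h - v' (\<phi> t x) (quot h t x e)) \<le> \<eta>"
    using quot_deriv_approx[OF \<eta>(1)] by blast
  show ?thesis
  proof (intro exI[of _ d] conjI ballI allI impI d(1))
    fix x e :: 'a and h k t :: real
    assume x: "x \<in> cball 0 R" and e: "e \<in> cball 0 E"
      and hk: "h \<noteq> 0" "k \<noteq> 0" "\<bar>h\<bar> < d" "\<bar>k\<bar> < d" and t: "\<bar>t\<bar> \<le> T"
    define q where "q h t = (v (\<phi> t (x + h *\<^sub>R e)) - v (\<phi> t x)) /\<^sub>R h" for h t
    have "norm (quot h t x e - quot k t x e) \<le> (norm (quot h 0 x e - quot k 0 x e) + (2 * \<eta>) * T) * exp (L * T)"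
    proof (rule gronwall_two_sided[where u' = "\<lambda>t. q h t - q k t"])
      fix s assume s: "\<bar>s\<bar> \<le> T"
      show "((\<lambda>t. quot h t x e - quot k t x e) has_vector_derivative q h s - q k s) (at s)"
        unfolding q_def by (intro has_vector_derivative_diff quot_deriv)
      let ?A = "v' (\<phi> s x)"
      have A: "norm ?A \<le> L"
        using L(2) flow_in_cball[OF x s] by blast
      have r: "norm (q h s - ?A (quot h s x e)) \<le> \<eta>" "norm (q k s - ?A (quot k s x e)) \<le> \<eta>"
        using d(2)[rule_format, OF x e _ s] hk by (auto simp: q_def)
      have eq: "q h s - q k s = (q h s - ?A (quot h s x e)) - (q k s - ?A (quot k s x e)) + ?A (quot h s x e - quot k s x e)"
        by (simp add: blinfun.bilinear_simps)
      have "norm (q h s - q k s) \<le> norm (q h s - ?A (quot h s x e)) + norm (q k s - ?A (quot k s x e))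
          + norm (?A (quot h s x e - quot k s x e))"
        by (subst eq, rule norm_triangle_mono[OF norm_triangle_ineq4 order.refl])
      moreover have "norm (?A (quot h s x e - quot k s x e)) \<le> L * norm (quot h s x e - quot k s x e)"
        by (rule order.trans[OF norm_blinfun mult_right_mono[OF A norm_ge_zero]])
      ultimately show "norm (q h s - q k s) \<le> L * norm (quot h s x e - quot k s x e) + 2 * \<eta>"
        using r by linarith
    qed (use L \<eta> t in auto)
    also have "\<dots> = \<eta> * (2 * T * exp (L * T))" using hk by (simp add: quot_0)
    also have "\<dots> \<le> \<eta> * (2 * (\<bar>T\<bar> + 1) * exp (L * T))"
      using \<eta>(1) by (intro mult_left_mono mult_right_mono) auto
    finally show "norm (quot h t x e - quot k t x e) \<le> \<epsilon>" using \<eta>(2) by simp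
  qed
qed

definition Dflow :: "real \<Rightarrow> 'a \<Rightarrow> 'a \<Rightarrow> 'a" where
  "Dflow t x e = lim (\<lambda>n. quot (inverse (real (Suc n))) t x e)"

lemma quot_uniform:
  assumes "\<epsilon> > 0"
  shows "\<exists>d>0. \<forall>x\<in>cball 0 R. \<forall>e\<in>cball 0 E. \<forall>h t. h \<noteq> 0 \<longrightarrow> \<bar>h\<bar> < d \<longrightarrow> \<bar>t\<bar> \<le> T \<longrightarrow>
    norm (quot h t x e - Dflow t x e) \<le> \<epsilon>"
proof -
  have small: "\<exists>N. \<forall>n\<ge>N. inverse (real (Suc n)) < d" if "d > 0" for d
    using LIMSEQ_inverse_real_of_nat that
    by (metis (no_types, lifting) eventually_sequentially order_tendstoD(2))
  have conv: "(\<lambda>n. quot (inverse (real (Suc n))) t x e) \<longlonglongrightarrow> Dflow t x e" for t x e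
  proof -
    have "Cauchy (\<lambda>n. quot (inverse (real (Suc n))) t x e)"
    proof (rule metric_CauchyI)
      fix c :: real assume c: "c > 0"
      then obtain d where d: "d > 0" "\<forall>y\<in>cball 0 (norm x). \<forall>f\<in>cball 0 (norm e). \<forall>h k s. h \<noteq> 0 \<longrightarrow> k \<noteq> 0 \<longrightarrow>
          \<bar>h\<bar> < d \<longrightarrow> \<bar>k\<bar> < d \<longrightarrow> \<bar>s\<bar> \<le> \<bar>t\<bar> \<longrightarrow> norm (quot h s y f - quot k s y f) \<le> c / 2"
        using quot_cauchy[of "c / 2" "norm x" "norm e" "\<bar>t\<bar>"] by auto
      obtain N where N: "\<forall>n\<ge>N. inverse (real (Suc n)) < d" using small[OF d(1)] by blast
      have "dist (quot (inverse (real (Suc m))) t x e) (quot (inverse (real (Suc n))) t x e) < c"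
        if "m \<ge> N" "n \<ge> N" for m n
      proof -
        have "norm (quot (inverse (real (Suc m))) t x e - quot (inverse (real (Suc n))) t x e) \<le> c / 2"
          by (rule d(2)[rule_format]) (use N that in \<open>auto simp del: of_nat_Suc\<close>)
        then show ?thesis using c by (simp add: dist_norm)
      qed
      then show "\<exists>M. \<forall>m\<ge>M. \<forall>n\<ge>M. dist (quot (inverse (real (Suc m))) t x e) (quot (inverse (real (Suc n))) t x e) < c"
        by blast
    qed
    then show ?thesis
      by (simp only: Cauchy_convergent_iff convergent_LIMSEQ_iff Dflow_def)
  qed
  obtain d where d: "d > 0" "\<forall>x\<in>cball 0 R. \<forall>e\<in>cball 0 E. \<forall>h k t. h \<noteq> 0 \<longrightarrow> k \<noteq> 0 \<longrightarrow>
      \<bar>h\<bar> < d \<longrightarrow> \<bar>k\<bar> < d \<longrightarrow> \<bar>t\<bar> \<le> T \<longrightarrow> norm (quot h t x e - quot k t x e) \<le> \<epsilon>"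
    using quot_cauchy[OF assms] by blast
  obtain N where N: "\<forall>n\<ge>N. inverse (real (Suc n)) < d" using small[OF d(1)] by blast
  show ?thesis
  proof (intro exI[of _ d] conjI ballI allI impI d(1))
    fix x e :: 'a and h t :: real
    assume a: "x \<in> cball 0 R" "e \<in> cball 0 E" "h \<noteq> 0" "\<bar>h\<bar> < d" "\<bar>t\<bar> \<le> T"
    show "norm (quot h t x e - Dflow t x e) \<le> \<epsilon>"
    proof (rule Lim_norm_ubound[OF sequentially_bot])
      show "(\<lambda>n. quot h t x e - quot (inverse (real (Suc n))) t x e) \<longlonglongrightarrow> quot h t x e - Dflow t x e"
        by (intro tendsto_diff tendsto_const conv)
      show "\<forall>\<^sub>F n in sequentially. norm (quot h t x e - quot (inverse (real (Suc n))) t x e) \<le> \<epsilon>"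
        unfolding eventually_sequentially
      proof (intro exI[of _ N] allI impI)
        fix n assume "N \<le> n"
        then show "norm (quot h t x e - quot (inverse (real (Suc n))) t x e) \<le> \<epsilon>"
          using N a by (intro d(2)[rule_format]) (auto simp del: of_nat_Suc)
      qed
    qed
  qed
qed

lemma Dflow_LIM: "((\<lambda>h. quot h t x e) \<longlongrightarrow> Dflow t x e) (at 0)"
proof (rule LIM_I)
  fix r :: real assume "r > 0"
  then obtain d where "d > 0" and "\<forall>y\<in>cball 0 (norm x). \<forall>f\<in>cball 0 (norm e). \<forall>h s. h \<noteq> 0 \<longrightarrow> \<bar>h\<bar> < d \<longrightarrow> \<bar>s\<bar> \<le> \<bar>t\<bar> \<longrightarrow>
      norm (quot h s y f - Dflow s y f) \<le> r / 2"
    using quot_uniform[of "r / 2" "norm x" "norm e" "\<bar>t\<bar>"] by auto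
  then show "\<exists>d>0. \<forall>h. h \<noteq> 0 \<and> norm (h - 0) < d \<longrightarrow> norm (quot h t x e - Dflow t x e) < r"
    using \<open>r > 0\<close> by (intro exI[of _ d]) (force intro: le_less_trans[of _ "r / 2"])
qed

lemma Dflow_cont: "continuous_on UNIV (\<lambda>(t, x). Dflow t x e)"
proof (intro continuous_at_imp_continuous_on ballI)
  fix p :: "real \<times> 'a"
  define T where "T = \<bar>fst p\<bar> + 1"
  define R where "R = norm (snd p) + 1"
  let ?S = "{- T<..<T} \<times> ball 0 R"
  have "continuous_on ?S (\<lambda>(t, x). Dflow t x e)"
  proof (rule uniform_limit_theorem)
    show "\<forall>\<^sub>F n in sequentially. continuous_on ?S (\<lambda>(t, x). quot (inverse (real (Suc n))) t x e)"
    proof (intro always_eventually allI)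
      fix n
      show "continuous_on ?S (\<lambda>(t, x). quot (inverse (real (Suc n))) t x e)"
        unfolding quot_def split_beta by (intro continuous_intros)
    qed
    show "uniform_limit ?S (\<lambda>n (t, x). quot (inverse (real (Suc n))) t x e) (\<lambda>(t, x). Dflow t x e) sequentially"
    proof (rule uniform_limitI)
      fix r :: real assume r: "r > 0"
      then obtain d where d: "d > 0" "\<forall>y\<in>cball 0 R. \<forall>f\<in>cball 0 (norm e). \<forall>h s. h \<noteq> 0 \<longrightarrow> \<bar>h\<bar> < d \<longrightarrow> \<bar>s\<bar> \<le> T \<longrightarrow>
          norm (quot h s y f - Dflow s y f) \<le> r / 2"
        using quot_uniform[of "r / 2" R "norm e" T] by auto
      have "\<forall>\<^sub>F n in sequentially. inverse (real (Suc n)) < d"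
        using LIMSEQ_inverse_real_of_nat d(1) by (rule order_tendstoD(2))
      then show "\<forall>\<^sub>F n in sequentially. \<forall>x\<in>?S. dist (case x of (t, x) \<Rightarrow> quot (inverse (real (Suc n))) t x e)
          (case x of (t, x) \<Rightarrow> Dflow t x e) < r"
      proof eventually_elim
        case (elim n)
        show ?case
        proof
          fix q :: "real \<times> 'a" assume "q \<in> ?S"
          moreover obtain t x where q: "q = (t, x)" by force
          ultimately have "norm (quot (inverse (real (Suc n))) t x e - Dflow t x e) \<le> r / 2"
            using elim by (intro d(2)[rule_format]) (auto simp del: of_nat_Suc)
          then show "dist (case q of (t, x) \<Rightarrow> quot (inverse (real (Suc n))) t x e)
              (case q of (t, x) \<Rightarrow> Dflow t x e) < r"
            using r by (simp add: q dist_norm)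
        qed
      qed
    qed
  qed simp
  moreover have "open ?S" "p \<in> ?S"
    by (auto simp: T_def R_def mem_Times_iff intro: open_Times)
  ultimately show "isCont (\<lambda>(t, x). Dflow t x e) p"
    using continuous_on_eq_continuous_at by blast
qed

lemma Dflow_cont_compose:
  assumes "(f \<longlongrightarrow> t) F" "(g \<longlongrightarrow> x) F"
  shows "((\<lambda>a. Dflow (f a) (g a) e) \<longlongrightarrow> Dflow t x e) F"
proof -
  have "isCont (\<lambda>(t, x). Dflow t x e) (t, x)"
    using Dflow_cont by (simp add: continuous_on_eq_continuous_at)
  from isCont_tendsto_compose[OF this tendsto_Pair[OF assms]] show ?thesis by simp
qed

lemma Dflow_linear: "linear (Dflow t x)"
proof (rule linearI)
  fix e f
  show "Dflow t x (e + f) = Dflow t x e + Dflow t x f"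
  proof (rule LIM_unique)
    show "((\<lambda>h. quot h t x (e + f)) \<longlongrightarrow> Dflow t x (e + f)) (at 0)" by (rule Dflow_LIM)
    \<comment> \<open>The step along \<open>e + f\<close> is made in two moves, the second from the
      shifted point \<open>x + h *\<^sub>R e\<close>. Uniformity of the limit in the base point and
      continuity of \<open>Dflow\<close> bring it back to \<open>x\<close>.\<close>
    have eq: "quot h t x (e + f) = quot h t x e + (quot h t (x + h *\<^sub>R e) f - Dflow t (x + h *\<^sub>R e) f) + Dflow t (x + h *\<^sub>R e) f" for h
      by (simp add: quot_def algebra_simps)
    have "((\<lambda>h. quot h t (x + h *\<^sub>R e) f - Dflow t (x + h *\<^sub>R e) f) \<longlongrightarrow> 0) (at 0)"
    proof (rule LIM_I)
      fix r :: real assume r: "r > 0"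
      then obtain d where d: "d > 0" "\<forall>y\<in>cball 0 (norm x + norm e). \<forall>g\<in>cball 0 (norm f). \<forall>h s. h \<noteq> 0 \<longrightarrow> \<bar>h\<bar> < d \<longrightarrow> \<bar>s\<bar> \<le> \<bar>t\<bar> \<longrightarrow>
          norm (quot h s y g - Dflow s y g) \<le> r / 2"
        using quot_uniform[of "r / 2" "norm x + norm e" "norm f" "\<bar>t\<bar>"] by auto
      have "norm (quot h t (x + h *\<^sub>R e) f - Dflow t (x + h *\<^sub>R e) f) < r" if h: "h \<noteq> 0" "\<bar>h\<bar> < min d 1" for h
      proof -
        have "norm (x + h *\<^sub>R e) \<le> norm x + \<bar>h\<bar> * norm e"
          using norm_triangle_ineq[of x "h *\<^sub>R e"] by simp
        also have "\<dots> \<le> norm x + norm e" using h by (simp add: mult_left_le_one_le)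
        finally have "norm (quot h t (x + h *\<^sub>R e) f - Dflow t (x + h *\<^sub>R e) f) \<le> r / 2"
          using h by (intro d(2)[rule_format]) auto
        then show ?thesis using r by simp
      qed
      then show "\<exists>s>0. \<forall>h. h \<noteq> 0 \<and> norm (h - 0) < s \<longrightarrow> norm (quot h t (x + h *\<^sub>R e) f - Dflow t (x + h *\<^sub>R e) f - 0) < r"
        using d(1) by (intro exI[of _ "min d 1"]) simp
    qed
    moreover have "((\<lambda>h. Dflow t (x + h *\<^sub>R e) f) \<longlongrightarrow> Dflow t x f) (at 0)"
      by (rule Dflow_cont_compose) (auto intro!: tendsto_eq_intros)
    ultimately show "((\<lambda>h. quot h t x (e + f)) \<longlongrightarrow> Dflow t x e + Dflow t x f) (at 0)"
      unfolding eq using tendsto_add[OF tendsto_add[OF Dflow_LIM[of t x e]]] by fastforce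
  qed
next
  fix c e
  show "Dflow t x (c *\<^sub>R e) = c *\<^sub>R Dflow t x e"
  proof (cases "c = 0")
    case True
    have "Dflow t x 0 = 0"
      by (rule LIM_unique[OF Dflow_LIM]) (simp add: quot_def)
    then show ?thesis using True by simp
  next
    case False
    have "((\<lambda>h. c *\<^sub>R quot (c * h) t x e) \<longlongrightarrow> c *\<^sub>R Dflow t x e) (at 0)"
    proof (intro tendsto_scaleR tendsto_const filterlim_compose[OF Dflow_LIM])
      show "filterlim ((*) c) (at 0) (at 0)"
        using False by (auto simp: filterlim_at eventually_at intro!: tendsto_eq_intros exI[of _ 1])
    qed
    moreover have "c *\<^sub>R quot (c * h) t x e = quot h t x (c *\<^sub>R e)" for h
      using False by (simp add: quot_def mult.commute)
    ultimately show ?thesis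
      using LIM_unique[OF Dflow_LIM[of t x "c *\<^sub>R e"]] by simp
  qed
qed

definition flow' :: "real \<Rightarrow> 'a \<Rightarrow> 'a \<Rightarrow>\<^sub>L 'a" where
  "flow' t x = Blinfun (Dflow t x)"

lemma flow'_apply: "blinfun_apply (flow' t x) = Dflow t x"
  unfolding flow'_def using Dflow_linear by (simp add: bounded_linear_Blinfun_apply linear_conv_bounded_linear)

lemma flow'_cont: "continuous_on UNIV (\<lambda>(t, x). flow' t x)"
  using Dflow_cont by (intro continuous_on_blinfun_componentwise) (simp add: split_beta flow'_apply)

text \<open>Difference quotients converge uniformly over unit directions, which upgrades directional
  derivatives to a Frechet derivative.\<close>

lemma flow_has_derivative: "(\<phi> t has_derivative flow' t x) (at x)"
  unfolding has_derivative_at_alt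
proof (intro conjI allI impI)
  show "bounded_linear (blinfun_apply (flow' t x))" by (rule blinfun.bounded_linear_right)
  fix r :: real assume "r > 0"
  then obtain d where d: "d > 0" "\<forall>y\<in>cball 0 (norm x). \<forall>f\<in>cball 0 1. \<forall>h s. h \<noteq> 0 \<longrightarrow> \<bar>h\<bar> < d \<longrightarrow> \<bar>s\<bar> \<le> \<bar>t\<bar> \<longrightarrow>
      norm (quot h s y f - Dflow s y f) \<le> r"
    using quot_uniform[of r "norm x" 1 "\<bar>t\<bar>"] by auto
  show "\<exists>d>0. \<forall>y. norm (y - x) < d \<longrightarrow> norm (\<phi> t y - \<phi> t x - flow' t x (y - x)) \<le> r * norm (y - x)"
  proof (intro exI[of _ d] conjI allI impI d(1))
    fix y assume y: "norm (y - x) < d"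
    show "norm (\<phi> t y - \<phi> t x - flow' t x (y - x)) \<le> r * norm (y - x)"
    proof (cases "y = x")
      case True
      then show ?thesis by (simp add: blinfun.zero_right)
    next
      case False
      define h where "h = norm (y - x)"
      define e where "e = (y - x) /\<^sub>R h"
      have h: "h > 0" "h < d" and e: "norm e = 1" and y_eq: "y - x = h *\<^sub>R e" "y = x + h *\<^sub>R e"
        using False y by (auto simp: h_def e_def)
      have "norm (quot h t x e - Dflow t x e) \<le> r"
        using h e by (intro d(2)[rule_format]) auto
      then have "h * norm (quot h t x e - Dflow t x e) \<le> h * r" using h by (intro mult_left_mono) auto
      moreover have "\<phi> t y - \<phi> t x - flow' t x (y - x) = h *\<^sub>R (quot h t x e - Dflow t x e)"
        using h unfolding y_eq(1) blinfun.scaleR_right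
        by (simp add: flow'_apply quot_def y_eq(2) algebra_simps)
      ultimately show ?thesis using h unfolding h_def[symmetric] by (simp add: mult.commute)
    qed
  qed
qed

lemma flow'_0 [simp]: "flow' 0 x = id_blinfun"
proof (rule blinfun_eqI)
  fix e
  have "\<phi> 0 = (\<lambda>x. x)" by (simp add: fun_eq_iff)
  then have "blinfun_apply (flow' 0 x) = (\<lambda>h. h)"
    using has_derivative_unique[OF flow_has_derivative[of 0 x]] has_derivative_ident by auto
  then show "flow' 0 x e = id_blinfun e" by simp
qed

lemma flow'_add: "flow' (s + t) x = flow' s (\<phi> t x) o\<^sub>L flow' t x"
proof (rule blinfun_eqI)
  fix e
  have "\<phi> (s + t) = (\<lambda>x. \<phi> s (\<phi> t x))" by (simp add: fun_eq_iff flow_add)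
  moreover have "((\<lambda>x. \<phi> s (\<phi> t x)) has_derivative (\<lambda>h. flow' s (\<phi> t x) (flow' t x h))) (at x)"
    by (rule has_derivative_compose[OF flow_has_derivative flow_has_derivative])
  ultimately have "blinfun_apply (flow' (s + t) x) = (\<lambda>h. flow' s (\<phi> t x) (flow' t x h))"
    using has_derivative_unique[OF flow_has_derivative[of "s + t" x]] by auto
  then show "flow' (s + t) x e = (flow' s (\<phi> t x) o\<^sub>L flow' t x) e" by simp
qed

lemma flow'_inverse: "flow' t (\<phi> (- t) x) o\<^sub>L flow' (- t) x = id_blinfun"
  using flow'_add[of t "- t" x] by simp

text \<open>The bound is proved for the difference quotients, whose time derivative is known, and
  passes to the limit \<open>h = 0\<close>. Gronwall is used with \<open>L = 0\<close>, hence as a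
  mean value inequality.\<close>

lemma flow'_deriv_0: "((\<lambda>t. flow' t x) has_vector_derivative v' x) (at 0)"
  unfolding has_vector_derivative_def has_derivative_at_alt
proof (intro conjI allI impI)
  show "bounded_linear (\<lambda>h. h *\<^sub>R v' x)" by (rule bounded_linear_scaleR_left)
  fix r :: real assume r: "r > 0"
  \<comment> \<open>\<open>c\<close> and the later \<open>a\<close> are sized so that each of three
    errors is at most \<open>r / 4\<close>: that of the approximate linear equation, the change of
    \<open>v'\<close> along the orbit, and the distance of the quotient from \<open>e\<close>, which
    is at most \<open>2 * c\<close>.\<close>
  define c where "c = r / (8 * (norm (v' x) + 1))"
  have c: "c > 0" "norm (v' x) * c \<le> r / 8"
  proof -
    define N where "N = norm (v' x)"
    have "N \<ge> 0" by (simp add: N_def)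
    then show "c > 0" "norm (v' x) * c \<le> r / 8"
      using r by (auto simp: c_def field_simps simp flip: N_def)
  qed
  obtain K where K: "K \<ge> 0" "\<forall>y\<in>cball 0 (norm x). \<forall>e\<in>cball 0 1. \<forall>h t. \<bar>h\<bar> \<le> 1 \<longrightarrow> \<bar>t\<bar> \<le> 1 \<longrightarrow>
     norm (\<phi> t (y + h *\<^sub>R e) - \<phi> t y) \<le> K * \<bar>h\<bar> \<and> norm (quot h t y e) \<le> K"
    using flow_increment[of "norm x" 1 1] by blast
  define a where "a = r / (4 * (K + 1))"
  have a: "a > 0" "a * K \<le> r / 4" using r K by (auto simp: a_def field_simps)
  obtain d1 where d1: "d1 > 0" "\<forall>y\<in>cball 0 (norm x). \<forall>e\<in>cball 0 1. \<forall>h t. \<bar>h\<bar> < d1 \<longrightarrow> \<bar>t\<bar> \<le> 1 \<longrightarrow>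
    norm ((v (\<phi> t (y + h *\<^sub>R e)) - v (\<phi> t y)) /\<^sub>R h - v' (\<phi> t y) (quot h t y e)) \<le> r / 4"
    using quot_deriv_approx[of "r / 4"] r by (metis zero_less_divide_iff zero_less_numeral)
  obtain d2 where d2: "d2 > 0" "\<forall>y\<in>cball 0 (norm x). \<forall>e\<in>cball 0 1. \<forall>h t. h \<noteq> 0 \<longrightarrow> \<bar>h\<bar> < d2 \<longrightarrow> \<bar>t\<bar> \<le> 1 \<longrightarrow>
    norm (quot h t y e - Dflow t y e) \<le> c"
    using quot_uniform[OF c(1)] by blast
  have "isCont (\<lambda>t. v' (\<phi> t x)) 0"
    using continuous_on_compose2[OF v'_cont flow_cont_time[of UNIV x]]
    by (simp add: continuous_on_eq_continuous_at)
  then have "((\<lambda>t. v' (\<phi> t x)) \<longlongrightarrow> v' x) (at 0)" by (simp add: isCont_def)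
  from LIM_D[OF this a(1)] obtain s where s: "s > 0" "\<And>t. t \<noteq> 0 \<Longrightarrow> \<bar>t\<bar> < s \<Longrightarrow> norm (v' (\<phi> t x) - v' x) < a"
    by auto
  have "isCont (\<lambda>(t, x). flow' t x) (0, x)"
    using flow'_cont by (simp add: continuous_on_eq_continuous_at)
  from isCont_tendsto_compose[OF this tendsto_Pair[OF tendsto_ident_at tendsto_const]]
  have "((\<lambda>t. flow' t x) \<longlongrightarrow> id_blinfun) (at 0)" by simp
  from LIM_D[OF this c(1)] obtain s' where s': "s' > 0" "\<And>t. t \<noteq> 0 \<Longrightarrow> \<bar>t\<bar> < s' \<Longrightarrow> norm (flow' t x - id_blinfun) < c"
    by auto
  define \<tau> where "\<tau> = min 1 (min s s')"
  have \<tau>: "\<tau> > 0" "\<tau> \<le> 1" using s s' by (auto simp: \<tau>_def)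
  have near: "norm (v' (\<phi> t x) - v' x) \<le> a" "norm (flow' t x - id_blinfun) \<le> c" if "\<bar>t\<bar> < \<tau>" for t
    using s(2)[of t] s'(2)[of t] that a(1) c(1) by (cases "t = 0"; simp add: \<tau>_def less_imp_le)+
  have key: "norm (Dflow t x e - e - t *\<^sub>R v' x e) \<le> r * \<bar>t\<bar>" if t: "\<bar>t\<bar> < \<tau>" and e: "norm e = 1" for t e
  proof (rule Lim_norm_ubound[OF trivial_limit_at])
    show "((\<lambda>h. quot h t x e - e - t *\<^sub>R v' x e) \<longlongrightarrow> Dflow t x e - e - t *\<^sub>R v' x e) (at 0)"
      by (intro tendsto_diff Dflow_LIM tendsto_const)
    have "\<forall>\<^sub>F h in at 0. h \<noteq> 0 \<and> \<bar>h\<bar> < min 1 (min d1 d2)"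
      using d1(1) d2(1) unfolding eventually_at by (intro exI[of _ "min 1 (min d1 d2)"]) auto
    then show "\<forall>\<^sub>F h in at 0. norm (quot h t x e - e - t *\<^sub>R v' x e) \<le> r * \<bar>t\<bar>"
    proof eventually_elim
      case (elim h)
      then have h: "h \<noteq> 0" "\<bar>h\<bar> \<le> 1" "\<bar>h\<bar> < d1" "\<bar>h\<bar> < d2" by auto
      define q where "q s = (v (\<phi> s (x + h *\<^sub>R e)) - v (\<phi> s x)) /\<^sub>R h" for s
      have "norm (quot h t x e - e - t *\<^sub>R v' x e) \<le> (norm (quot h 0 x e - e - 0 *\<^sub>R v' x e) + r * \<bar>t\<bar>) * exp (0 * \<bar>t\<bar>)"
      proof (rule gronwall_two_sided[where u' = "\<lambda>s. q s - 0 - v' x e"])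
        fix s assume s: "\<bar>s\<bar> \<le> \<bar>t\<bar>"
        then have s1: "\<bar>s\<bar> < \<tau>" "\<bar>s\<bar> \<le> 1" using t \<tau> by auto
        have "((\<lambda>s. s *\<^sub>R v' x e) has_vector_derivative v' x e) (at s)"
          using bounded_linear.has_vector_derivative[OF bounded_linear_scaleR_left has_vector_derivative_id] by simp
        then show "((\<lambda>t. quot h t x e - e - t *\<^sub>R v' x e) has_vector_derivative q s - 0 - v' x e) (at s)"
          unfolding q_def by (intro has_vector_derivative_diff quot_deriv has_vector_derivative_const)
        let ?q = "quot h s x e"
        have 1: "norm (q s - v' (\<phi> s x) ?q) \<le> r / 4"
          unfolding q_def using h e s1 by (intro d1(2)[rule_format]) auto
        have "norm ?q \<le> K" using K(2)[rule_format, of x e h s] h e s1 by simp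
        then have 2: "norm ((v' (\<phi> s x) - v' x) ?q) \<le> r / 4"
          using order.trans[OF norm_blinfun mult_mono[OF near(1)[OF s1(1)]]] a K by fastforce
        have "norm (?q - Dflow s x e) \<le> c"
          using h e s1 by (intro d2(2)[rule_format]) auto
        moreover have "norm (Dflow s x e - e) \<le> c"
          using norm_blinfun[of "flow' s x - id_blinfun" e] near(2)[OF s1(1)] e
          by (simp add: blinfun.diff_left flow'_apply)
        ultimately have "norm (?q - e) \<le> 2 * c"
          using norm_triangle_ineq[of "?q - Dflow s x e" "Dflow s x e - e"] by simp
        then have "norm (v' x (?q - e)) \<le> norm (v' x) * (2 * c)"
          using norm_blinfun[of "v' x" "?q - e"] by (meson mult_left_mono norm_ge_zero order_trans)
        then have 3: "norm (v' x (?q - e)) \<le> r / 4" using c(2) by simp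
        have "q s - 0 - v' x e = (q s - v' (\<phi> s x) ?q) + (v' (\<phi> s x) - v' x) ?q + v' x (?q - e)"
          by (simp add: blinfun.bilinear_simps)
        also have "norm \<dots> \<le> r / 4 + r / 4 + r / 4"
          by (intro norm_triangle_le add_mono 1 2 3)
        finally show "norm (q s - 0 - v' x e) \<le> 0 * norm (?q - e - s *\<^sub>R v' x e) + r"
          using r by simp
      qed (use r in auto)
      then show ?case using h by (simp add: quot_0)
    qed
  qed
  show "\<exists>d>0. \<forall>t. norm (t - 0) < d \<longrightarrow> norm (flow' t x - flow' 0 x - (t - 0) *\<^sub>R v' x) \<le> r * norm (t - 0)"
  proof (intro exI[of _ \<tau>] conjI allI impI \<tau>(1))
    fix t :: real assume "norm (t - 0) < \<tau>"
    then have t: "\<bar>t\<bar> < \<tau>" by simp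
    show "norm (flow' t x - flow' 0 x - (t - 0) *\<^sub>R v' x) \<le> r * norm (t - 0)"
    proof (rule norm_blinfun_bound)
      fix e
      let ?B = "flow' t x - flow' 0 x - (t - 0) *\<^sub>R v' x"
      show "norm (?B e) \<le> r * norm (t - 0) * norm e"
      proof (cases "e = 0")
        case False
        define e1 where "e1 = e /\<^sub>R norm e"
        have e1: "norm e1 = 1" "e = norm e *\<^sub>R e1" using False by (auto simp: e1_def)
        have "norm (?B e1) \<le> r * \<bar>t\<bar>"
          using key[OF t e1(1)] by (simp add: blinfun.bilinear_simps flow'_apply)
        moreover have "norm (?B e) = norm e * norm (?B e1)"
          by (subst e1(2)) (simp only: blinfun.scaleR_right norm_scaleR abs_norm_cancel)
        ultimately show ?thesis
          by (simp add: mult.commute[of _ "norm e"] mult_left_mono)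
      qed (simp add: blinfun.zero_right)
    qed (use r in auto)
  qed
qed

lemma flow'_deriv: "((\<lambda>t. flow' t x) has_vector_derivative (v' (\<phi> t x) o\<^sub>L flow' t x)) (at t)"
proof -
  have "((\<lambda>s. flow' (s - t) (\<phi> t x)) has_vector_derivative v' (\<phi> t x)) (at t)"
    using vector_diff_chain_at[of "\<lambda>s. s - t" 1 t "\<lambda>s. flow' s (\<phi> t x)"] flow'_deriv_0[of "\<phi> t x"]
      has_vector_derivative_diff_const[THEN iffD2, OF has_vector_derivative_id]
    by (simp add: o_def)
  from bounded_linear.has_vector_derivative[OF bounded_bilinear.bounded_linear_left[OF bounded_bilinear_blinfun_compose] this]
  have "((\<lambda>s. flow' (s - t) (\<phi> t x) o\<^sub>L flow' t x) has_vector_derivative (v' (\<phi> t x) o\<^sub>L flow' t x)) (at t)" .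
  then show ?thesis by (simp flip: flow'_add)
qed

lemma reverse_C1_flow: "C1_flow (\<lambda>x. - v x) (\<lambda>x. - v' x) (\<lambda>t. \<phi> (- t))"
proof
  show "((\<lambda>x. - v x) has_derivative blinfun_apply (- v' x)) (at x)" for x
    using has_derivative_minus[OF v_deriv[of x]] by (simp add: uminus_blinfun.rep_eq fun_Compl_def)
  show "continuous_on UNIV (\<lambda>x. - v' x)" by (intro continuous_intros v'_cont)
  show "bounded (range (\<lambda>x. - v x))" using v_bdd by (auto simp: bounded_iff)
  show "\<phi> (- 0) x = x" for x by simp
  show "((\<lambda>s. \<phi> (- s) x) has_vector_derivative - v (\<phi> (- t) x)) (at t)" for t x
    using vector_diff_chain_at[of "uminus" "-1" t "\<lambda>s. \<phi> s x"] flow_deriv[of x "- t"]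
      has_vector_derivative_minus[OF has_vector_derivative_id, of "at t"]
    by (simp add: o_def)
qed

end

section \<open>Volume growth along a flow\<close>

text \<open>Jacobi's formula at the identity. In the Leibniz expansion a permutation other than
  \<open>id\<close> moves at least two indices, so after differentiating one factor a vanishing
  off-diagonal entry remains.\<close>

lemma has_real_derivative_det_at_id:
  fixes A :: "real \<Rightarrow> real ^ 'n ^ 'n"
  assumes der: "\<And>i j. ((\<lambda>t. A t $ i $ j) has_real_derivative B $ i $ j) (at s)" and id: "A s = mat 1"
  shows "((\<lambda>t. det (A t)) has_real_derivative trace B) (at s)"
proof -
  have "((\<lambda>t. det (A t)) has_real_derivative
      (\<Sum>p | p permutes UNIV. of_int (sign p) * (\<Sum>i\<in>UNIV. B $ i $ p i * (\<Prod>j\<in>UNIV - {i}. A s $ j $ p j)))) (at s)"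
    unfolding det_def by (intro DERIV_sum DERIV_cmult has_field_derivative_prod der)
  moreover have "(\<Sum>p | p permutes UNIV. of_int (sign p) * (\<Sum>i\<in>UNIV. B $ i $ p i * (\<Prod>j\<in>UNIV - {i}. A s $ j $ p j)))
      = (\<Sum>p\<in>{p. p permutes (UNIV :: 'n set)}. if p = id then trace B else 0)"
  proof (rule sum.cong[OF refl])
    fix p :: "'n \<Rightarrow> 'n" assume "p \<in> {p. p permutes UNIV}"
    then have p: "p permutes UNIV" by simp
    show "of_int (sign p) * (\<Sum>i\<in>UNIV. B $ i $ p i * (\<Prod>j\<in>UNIV - {i}. A s $ j $ p j)) = (if p = id then trace B else 0)"
    proof (cases "p = id")
      case True
      have "(\<Prod>j\<in>UNIV - {i}. (mat 1 :: real ^ 'n ^ 'n) $ j $ j) = 1" for i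
        by (rule prod.neutral) (simp add: mat_def)
      then show ?thesis using True by (simp add: id trace_def sign_id)
    next
      case False
      have "(\<Prod>j\<in>UNIV - {i}. A s $ j $ p j) = 0" for i
      proof -
        have "\<exists>j. j \<noteq> i \<and> p j \<noteq> j"
        proof (rule ccontr)
          assume *: "\<not> ?thesis"
          then have "p i = i"
            using permutes_inj[OF p] by (metis injD)
          with * have "p = id" by (auto simp: fun_eq_iff)
          with False show False by simp
        qed
        then obtain j where "j \<noteq> i" "p j \<noteq> j" by blast
        then have "A s $ j $ p j = 0" by (simp add: id mat_def)
        then show ?thesis using \<open>j \<noteq> i\<close> by (intro prod_zero) auto
      qed
      then have "(\<Sum>i\<in>UNIV. B $ i $ p i * (\<Prod>j\<in>UNIV - {i}. A s $ j $ p j)) = 0"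
        by (intro sum.neutral) (simp del: prod_zero_iff)
      then show ?thesis using False by simp
    qed
  qed
  moreover have "\<dots> = trace B"
    using finite_permutations[of "UNIV :: 'n set"] by (simp add: sum.delta' permutes_id)
  ultimately show ?thesis by simp
qed

locale C1_flow_vec = C1_flow v v' \<phi>
  for v :: "real ^ 'n \<Rightarrow> real ^ 'n" and v' :: "real ^ 'n \<Rightarrow> (real ^ 'n) \<Rightarrow>\<^sub>L (real ^ 'n)"
    and \<phi> :: "real \<Rightarrow> real ^ 'n \<Rightarrow> real ^ 'n"
begin

definition jac :: "real \<Rightarrow> real ^ 'n \<Rightarrow> real" where
  "jac t x = det (matrix (flow' t x))"

lemma jac_add: "jac (s + t) x = jac s (\<phi> t x) * jac t x"
proof -
  have "matrix (flow' (s + t) x) = matrix (flow' s (\<phi> t x)) ** matrix (flow' t x)"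
    unfolding flow'_add blinfun_apply_blinfun_compose
    by (subst matrix_compose[symmetric])
      (auto intro: bounded_linear.linear blinfun.bounded_linear_right simp: o_def)
  then show ?thesis by (simp add: jac_def det_mul)
qed

text \<open>Liouville's formula. The cocycle identity \<open>jac_add\<close> moves the
  differentiation to time 0, where the matrix is the identity and Jacobi's formula applies.\<close>

lemma jac_deriv: "((\<lambda>t. jac t x) has_real_derivative trace (matrix (v' (\<phi> t x))) * jac t x) (at t)"
proof -
  have "((\<lambda>h. jac h (\<phi> t x)) has_real_derivative trace (matrix (v' (\<phi> t x)))) (at 0)"
    unfolding jac_def
  proof (rule has_real_derivative_det_at_id)
    show "matrix (flow' 0 (\<phi> t x)) = mat 1"
      by (simp add: matrix_id_mat_1[unfolded id_def])
    fix i j :: 'n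
    have "bounded_linear (\<lambda>F :: (real ^ 'n) \<Rightarrow>\<^sub>L (real ^ 'n). blinfun_apply F (axis j 1) $ i)"
      using bounded_linear_compose[OF bounded_linear_vec_nth blinfun.bounded_linear_left] .
    from bounded_linear.has_vector_derivative[OF this flow'_deriv_0[of "\<phi> t x"]]
    show "((\<lambda>h. matrix (flow' h (\<phi> t x)) $ i $ j) has_real_derivative matrix (v' (\<phi> t x)) $ i $ j) (at 0)"
      by (simp add: matrix_def has_real_derivative_iff_has_vector_derivative)
  qed
  then have "((\<lambda>h. jac h (\<phi> t x)) has_real_derivative trace (matrix (v' (\<phi> t x)))) (at (t + (- t)))"
    by simp
  then have "((\<lambda>s. jac (s + (- t)) (\<phi> t x)) has_real_derivative trace (matrix (v' (\<phi> t x)))) (at t)"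
    by (subst (asm) DERIV_shift)
  from DERIV_cmult_right[OF this, of "jac t x"] show ?thesis
    by (simp flip: jac_add)
qed

lemma jac_bound:
  assumes t: "0 \<le> t" and tr: "\<And>u. 0 \<le> u \<Longrightarrow> u \<le> t \<Longrightarrow> trace (matrix (v' (\<phi> u x))) \<le> a"
  shows "\<bar>jac t x\<bar> \<le> exp (a * t)"
proof -
  \<comment> \<open>Squaring bounds the absolute value without a discussion of the sign of
    \<open>jac\<close>.\<close>
  let ?f = "\<lambda>u. (jac u x)\<^sup>2 * exp (- (2 * a * u))"
  have d: "(?f has_real_derivative 2 * (trace (matrix (v' (\<phi> u x))) - a) * ?f u) (at u)" for u
    by (rule derivative_eq_intros jac_deriv refl)+ (simp add: power2_eq_square algebra_simps)
  have "?f t \<le> ?f 0"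
  proof (rule DERIV_nonpos_imp_decreasing_open[OF t])
    show "continuous_on {0..t} ?f"
      using d by (meson DERIV_isCont continuous_at_imp_continuous_on)
    fix u assume u: "0 < u" "u < t"
    have "2 * (trace (matrix (v' (\<phi> u x))) - a) * ?f u \<le> 0"
      using tr[of u] u by (rule_tac mult_nonpos_nonneg) auto
    then show "\<exists>y. DERIV ?f u :> y \<and> y \<le> 0" using d by blast
  qed
  moreover have "jac 0 x = 1"
    by (simp add: jac_def matrix_id_mat_1[unfolded id_def])
  ultimately have "(jac t x)\<^sup>2 \<le> exp (2 * a * t)"
    by (simp add: exp_minus field_simps)
  also have "\<dots> = (exp (a * t))\<^sup>2" by (simp add: power2_eq_square flip: exp_add)
  finally show ?thesis
    by (simp add: abs_le_square_iff flip: abs_le_square_iff)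
qed

lemma jac_cont: "continuous_on UNIV (jac t)"
proof -
  have "continuous_on UNIV (\<lambda>x. flow' t x)"
    using continuous_on_compose2[OF flow'_cont continuous_on_Pair[OF continuous_on_const[of _ t] continuous_on_id]] by simp
  then show ?thesis
    unfolding jac_def det_def matrix_def by (auto intro!: continuous_intros)
qed

end

text \<open>A bound on the absolute Jacobian bounds the measure of a differentiable image, and
  \<open>jac_bound\<close> supplies it from the divergence along the orbits leaving
  \<open>A\<close>.\<close>

lemma emeasure_C1_flow_image_wellorder:
  fixes v :: "(real, 'n::{finite,wellorder}) vec \<Rightarrow> (real, 'n) vec"
  assumes "C1_flow v v' \<phi>" and A: "A \<in> sets borel" "bounded A" and t: "0 \<le> t"
    and tr: "\<And>x u. x \<in> A \<Longrightarrow> 0 \<le> u \<Longrightarrow> u \<le> t \<Longrightarrow> trace (matrix (v' (\<phi> u x))) \<le> a"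
  shows "emeasure lborel (\<phi> t ` A) \<le> ennreal (exp (a * t)) * emeasure lborel A"
proof -
  interpret C1_flow_vec v v' \<phi> using assms(1) by (simp add: C1_flow_vec_def)
  have A': "A \<in> lmeasurable"
    using A by (intro bounded_set_imp_lmeasurable) auto
  have B: "\<phi> t ` A \<in> sets borel"
    by (simp add: flow_image flow_vimage_borel A(1))
  have bound: "\<bar>jac t x\<bar> \<le> exp (a * t)" if "x \<in> A" for x
    using jac_bound[OF t tr] that by blast
  have der: "(\<phi> t has_derivative flow' t x) (at x within A)" for x
    by (rule has_derivative_at_withinI[OF flow_has_derivative])
  have "(\<lambda>x. \<bar>jac t x\<bar>) absolutely_integrable_on A"
  proof (rule measurable_bounded_by_integrable_imp_absolutely_integrable)
    have "(\<lambda>x. \<bar>jac t x\<bar>) \<in> borel_measurable borel"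
      by (intro borel_measurable_continuous_onI continuous_intros jac_cont)
    then show "(\<lambda>x. \<bar>jac t x\<bar>) \<in> borel_measurable (lebesgue_on A)"
      by (intro measurable_restrict_space1 measurable_completion) simp
    show "(\<lambda>x. exp (a * t)) integrable_on A" by (rule integrable_on_const[OF A'])
  qed (use A' bound in auto)
  then have int: "(\<lambda>x. \<bar>det (matrix (flow' t x))\<bar>) integrable_on A"
    by (simp add: absolutely_integrable_on_def jac_def)
  have *: "\<phi> t ` A \<in> lmeasurable" "measure lebesgue (\<phi> t ` A) \<le> exp (a * t) * measure lebesgue A"
    using measurable_bounded_differentiable_image[OF A' der int bound[unfolded jac_def]]
      measure_bounded_differentiable_image[OF A' der int bound[unfolded jac_def]] by auto
  have "emeasure lborel (\<phi> t ` A) = emeasure lebesgue (\<phi> t ` A)" using B by simp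
  also have "\<dots> = ennreal (measure lebesgue (\<phi> t ` A))" by (rule emeasure_eq_measure2[OF *(1)])
  also have "\<dots> \<le> ennreal (exp (a * t) * measure lebesgue A)" using *(2) by (rule ennreal_leI)
  also have "\<dots> = ennreal (exp (a * t)) * emeasure lebesgue A"
    by (simp add: ennreal_mult emeasure_eq_measure2[OF A'])
  also have "emeasure lebesgue A = emeasure lborel A" using A by simp
  finally show ?thesis .
qed

text \<open>The change of variables theorems of the library need a well-ordered index type; the index
  type of the statement is merely finite, so the coordinates are relabelled.\<close>

datatype 'a ordered = Ordered (unordered: 'a)

lemma bij_Ordered: "bij Ordered"
  by (metis bijI' ordered.exhaust ordered.inject)

lemma bij_unordered: "bij unordered"
  by (metis bijI' ordered.expand ordered.sel)

instance ordered :: (finite) finite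
proof
  have "(UNIV :: 'a ordered set) = range Ordered"
    by (rule sym, rule bij_is_surj[OF bij_Ordered])
  then show "finite (UNIV :: 'a ordered set)" by (metis finite_imageI finite_class.finite_UNIV)
qed

instantiation ordered :: (finite) wellorder
begin

definition ordered_index :: "'a ordered \<Rightarrow> nat" where
  "ordered_index = (SOME f. inj f)"

definition "less_eq_ordered a b \<longleftrightarrow> ordered_index a \<le> ordered_index b"
definition "less_ordered a b \<longleftrightarrow> ordered_index a < ordered_index b"

lemma inj_ordered_index: "inj (ordered_index :: 'a ordered \<Rightarrow> nat)"
proof -
  have "\<exists>f :: 'a ordered \<Rightarrow> nat. inj f"
    using finite_imp_inj_to_nat_seg[OF finite_class.finite_UNIV] by blast
  then show ?thesis unfolding ordered_index_def by (rule someI_ex)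
qed

instance
proof
  fix P :: "'a ordered \<Rightarrow> bool" and a
  assume step: "\<And>x. (\<And>y. y < x \<Longrightarrow> P y) \<Longrightarrow> P x"
  show "P a"
    by (induction a rule: measure_induct_rule[of ordered_index])
      (rule step, simp add: less_ordered_def)
qed (auto simp: less_eq_ordered_def less_ordered_def dest: injD[OF inj_ordered_index])

end

definition relabel :: "real ^ 'n \<Rightarrow> real ^ 'n ordered" where
  "relabel x = (\<chi> i. x $ unordered i)"

definition unlabel :: "real ^ 'n ordered \<Rightarrow> real ^ 'n" where
  "unlabel y = (\<chi> i. y $ Ordered i)"

lemma relabel_unlabel [simp]: "relabel (unlabel y) = y" "unlabel (relabel x) = x"
  by (simp_all add: relabel_def unlabel_def)

lemma linear_relabel: "linear relabel"
  by (rule linearI) (simp_all add: relabel_def vec_eq_iff)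

lemma linear_unlabel: "linear unlabel"
  by (rule linearI) (simp_all add: unlabel_def vec_eq_iff)

lemma bounded_linear_relabel: "bounded_linear (relabel :: real ^ 'n \<Rightarrow> _)"
  and bounded_linear_unlabel: "bounded_linear (unlabel :: _ \<Rightarrow> real ^ 'n)"
  using linear_relabel linear_unlabel by (simp_all add: linear_conv_bounded_linear)

lemma unlabel_axis: "unlabel (axis i 1) = axis (unordered i) 1"
  by (auto simp: unlabel_def axis_def vec_eq_iff)

lemma borel_measurable_unlabel: "(unlabel :: _ \<Rightarrow> real ^ 'n) \<in> borel_measurable borel"
  by (intro borel_measurable_continuous_onI linear_continuous_on bounded_linear_unlabel)

lemma relabel_image: "relabel ` A = unlabel -` A"
  by (force simp: image_iff)

lemma Basis_vec_real: "(Basis :: (real ^ 'n) set) = range (\<lambda>i. axis i 1)"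
  by (auto simp: Basis_vec_def)

lemma prod_Basis_vec: "(\<Prod>b\<in>(Basis :: (real ^ 'n) set). f b) = (\<Prod>i\<in>UNIV. f (axis i 1))"
  unfolding Basis_vec_real by (subst prod.reindex) (auto simp: inj_on_def axis_eq_axis)

lemma distr_lborel_unlabel: "distr lborel borel unlabel = (lborel :: (real ^ 'n) measure)"
proof (rule lborel_eqI[symmetric])
  fix l u :: "real ^ 'n" assume lu: "\<And>b. b \<in> Basis \<Longrightarrow> l \<bullet> b \<le> u \<bullet> b"
  have all: "(\<forall>i. P i) \<longleftrightarrow> (\<forall>i. P (Ordered i))" for P :: "'n ordered \<Rightarrow> bool"
    by (metis ordered.exhaust)
  have box: "unlabel -` box l u = box (relabel l) (relabel u)"
    by (simp add: set_eq_iff mem_box Basis_vec_real inner_axis all relabel_def unlabel_def)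
  have "emeasure (distr lborel borel unlabel) (box l u) = emeasure lborel (box (relabel l) (relabel u))"
    by (simp add: emeasure_distr borel_measurable_unlabel box)
  also have "\<dots> = (\<Prod>b\<in>Basis. (relabel u - relabel l) \<bullet> b)"
    using lu[of "axis i 1" for i] by (intro emeasure_lborel_box) (auto simp: Basis_vec_real inner_axis relabel_def)
  also have "(\<Prod>b\<in>Basis. (relabel u - relabel l) \<bullet> b) = (\<Prod>b\<in>Basis. (u - l) \<bullet> b)"
    using prod.reindex_bij_betw[OF bij_unordered, of "\<lambda>i. u $ i - l $ i"]
    by (simp add: prod_Basis_vec inner_axis relabel_def)
  finally show "emeasure (distr lborel borel unlabel) (box l u) = (\<Prod>b\<in>Basis. (u - l) \<bullet> b)" .
qed simp

lemma emeasure_relabel_image: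
  assumes "A \<in> sets borel"
  shows "emeasure lborel (relabel ` A) = emeasure lborel (A :: (real ^ 'n) set)"
proof -
  have "emeasure lborel (relabel ` A) = emeasure (distr lborel borel unlabel) A"
    using assms by (simp add: emeasure_distr borel_measurable_unlabel relabel_image)
  then show ?thesis by (simp add: distr_lborel_unlabel)
qed

lemma (in C1_flow_vec) C1_flow_relabel:
  "C1_flow (\<lambda>y. relabel (v (unlabel y))) (\<lambda>y. Blinfun relabel o\<^sub>L v' (unlabel y) o\<^sub>L Blinfun unlabel)
     (\<lambda>t y. relabel (\<phi> t (unlabel y)))"
proof
  note bl = bounded_linear_relabel bounded_linear_unlabel
  show "((\<lambda>y. relabel (v (unlabel y))) has_derivative
      (Blinfun relabel o\<^sub>L v' (unlabel y) o\<^sub>L Blinfun unlabel)) (at y)" for y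
  proof -
    have "((\<lambda>y. relabel (v (unlabel y))) has_derivative (\<lambda>h. relabel (v' (unlabel y) (unlabel h)))) (at y)"
      by (intro bounded_linear.has_derivative[OF bounded_linear_relabel] has_derivative_compose[OF _ v_deriv]
          bounded_linear_imp_has_derivative bounded_linear_unlabel)
    moreover have "blinfun_apply (Blinfun relabel o\<^sub>L v' (unlabel y) o\<^sub>L Blinfun unlabel) =
        (\<lambda>h. relabel (v' (unlabel y) (unlabel h)))"
      by (simp add: fun_eq_iff bl bounded_linear_Blinfun_apply)
    ultimately show ?thesis by simp
  qed
  show "continuous_on UNIV (\<lambda>y. Blinfun relabel o\<^sub>L v' (unlabel y) o\<^sub>L Blinfun unlabel)"
    by (intro continuous_intros continuous_on_compose2[OF v'_cont] linear_continuous_on bl) auto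
  show "bounded (range (\<lambda>y. relabel (v (unlabel y))))"
    using bounded_linear_image[OF bounded_subset[OF v_bdd] bounded_linear_relabel, of "range (\<lambda>y. v (unlabel y))"]
    by (simp add: image_image image_subset_iff)
  show "((\<lambda>s. relabel (\<phi> s (unlabel y))) has_vector_derivative relabel (v (unlabel (relabel (\<phi> t (unlabel y)))))) (at t)" for t y
    using bounded_linear.has_vector_derivative[OF bounded_linear_relabel flow_deriv] by simp
qed simp

lemma (in C1_flow_vec) emeasure_flow_image:
  assumes A: "A \<in> sets borel" "bounded A" and t: "0 \<le> t"
    and tr: "\<And>x u. x \<in> A \<Longrightarrow> 0 \<le> u \<Longrightarrow> u \<le> t \<Longrightarrow> trace (matrix (v' (\<phi> u x))) \<le> a"
  shows "emeasure lborel (\<phi> t ` A) \<le> ennreal (exp (a * t)) * emeasure lborel A"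
proof -
  let ?\<phi> = "\<lambda>t y. relabel (\<phi> t (unlabel y))"
  let ?v' = "\<lambda>y. Blinfun relabel o\<^sub>L v' (unlabel y) o\<^sub>L Blinfun unlabel"
  have trace_eq: "trace (matrix (?v' y)) = trace (matrix (v' (unlabel y)))" for y
  proof -
    have "trace (matrix (?v' y)) = (\<Sum>i\<in>UNIV. matrix (v' (unlabel y)) $ unordered i $ unordered i)"
      by (simp add: trace_def matrix_def bounded_linear_Blinfun_apply bounded_linear_relabel
          bounded_linear_unlabel unlabel_axis) (simp add: relabel_def)
    also have "\<dots> = (\<Sum>i\<in>UNIV. matrix (v' (unlabel y)) $ i $ i)"
      using sum.reindex_bij_betw[OF bij_unordered, of "\<lambda>i. matrix (v' (unlabel y)) $ i $ i"] by simp
    finally show ?thesis by (simp add: trace_def)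
  qed
  have "emeasure lborel (?\<phi> t ` (relabel ` A)) \<le> ennreal (exp (a * t)) * emeasure lborel (relabel ` A)"
  proof (rule emeasure_C1_flow_image_wellorder[OF C1_flow_relabel])
    show "relabel ` A \<in> sets borel" using measurable_sets[OF borel_measurable_unlabel A(1)] by (simp add: relabel_image)
    show "bounded (relabel ` A)" by (rule bounded_linear_image[OF A(2) bounded_linear_relabel])
    show "trace (matrix (?v' (?\<phi> u y))) \<le> a" if "y \<in> relabel ` A" "0 \<le> u" "u \<le> t" for y u
      unfolding trace_eq using tr that by auto
  qed (rule t)
  moreover have "?\<phi> t ` (relabel ` A) = relabel ` (\<phi> t ` A)" by (simp add: image_image)
  moreover have "\<phi> t ` A \<in> sets borel"
    by (simp add: flow_image flow_vimage_borel A(1))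
  ultimately show ?thesis using A(1) by (simp add: emeasure_relabel_image)
qed

section \<open>Backward invariant sets and the bracket condition\<close>

lemma Ck_continuous: "Ck k f \<Longrightarrow> continuous_on UNIV f"
  by (cases k) (auto intro: differentiable_imp_continuous_on simp: differentiable_on_def differentiable_at_withinI)

lemma Ck_mono: "Ck (Suc k) f \<Longrightarrow> Ck k f"
proof (induction k arbitrary: f)
  case 0
  then show ?case using Ck_continuous[of "Suc 0" f] by simp
next
  case (Suc k)
  have "f differentiable at x" for x
    using Suc.prems unfolding Ck.simps(2)[of "Suc k"] by blast
  moreover have "Ck k (\<lambda>x. frechet_derivative f (at x) h)" for h
    using Suc.prems Suc.IH unfolding Ck.simps(2)[of "Suc k"] by blast
  ultimately show ?case unfolding Ck.simps(2)[of k] by blast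
qed

lemma Ck_SucI:
  assumes "\<And>x. (f has_derivative f' x) (at x)" "\<And>h. Ck k (\<lambda>x. f' x h)"
  shows "Ck (Suc k) f"
proof -
  have "frechet_derivative f (at x) = f' x" for x
    using frechet_derivative_at[OF assms(1)] by simp
  then show ?thesis using assms by (auto simp: differentiable_def)
qed

lemma Ck_SucD:
  assumes "Ck (Suc k) f"
  shows "(f has_derivative frechet_derivative f (at x)) (at x)" "Ck k (\<lambda>x. frechet_derivative f (at x) h)"
  using assms by (auto simp flip: frechet_derivative_works)

lemma Ck_zero: "Ck k (\<lambda>x. 0)"
  by (induction k) (auto intro: Ck_SucI)

lemma Ck_add: "Ck k f \<Longrightarrow> Ck k g \<Longrightarrow> Ck k (\<lambda>x. f x + g x)"
proof (induction k arbitrary: f g)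
  case 0
  then show ?case by (auto intro: continuous_intros)
next
  case (Suc k)
  show ?case
    by (rule Ck_SucI[OF has_derivative_add[OF Ck_SucD(1)[OF Suc.prems(1)] Ck_SucD(1)[OF Suc.prems(2)]]])
      (intro Suc.IH Ck_SucD(2) Suc.prems)
qed

lemma Ck_sum: "finite A \<Longrightarrow> (\<And>i. i \<in> A \<Longrightarrow> Ck k (f i)) \<Longrightarrow> Ck k (\<lambda>x. \<Sum>i\<in>A. f i x)"
  by (induction A rule: finite_induct) (auto intro: Ck_zero Ck_add)

lemma Ck_bounded_linear: "bounded_linear L \<Longrightarrow> Ck k f \<Longrightarrow> Ck k (\<lambda>x. L (f x))"
proof (induction k arbitrary: f)
  case 0
  then show ?case by (auto intro: bounded_linear.continuous_on)
next
  case (Suc k)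
  show ?case
    by (rule Ck_SucI[OF bounded_linear.has_derivative[OF Suc.prems(1) Ck_SucD(1)[OF Suc.prems(2)]]])
      (intro Suc.IH Ck_SucD(2) Suc.prems)
qed

lemma Ck_scaleR:
  fixes f :: "'a::real_normed_vector \<Rightarrow> real"
  shows "Ck k f \<Longrightarrow> Ck k g \<Longrightarrow> Ck k (\<lambda>x. f x *\<^sub>R g x)"
proof (induction k arbitrary: f g)
  case 0
  then show ?case by (auto intro: continuous_intros)
next
  case (Suc k)
  show ?case
    by (rule Ck_SucI[OF has_derivative_scaleR[OF Ck_SucD(1)[OF Suc.prems(1)] Ck_SucD(1)[OF Suc.prems(2)]]])
      (intro Ck_add Suc.IH Ck_SucD(2) Suc.prems Suc.prems[THEN Ck_mono])
qed

lemma jacobian_apply: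
  fixes f :: "real ^ 'n \<Rightarrow> real ^ 'm"
  assumes "f differentiable (at x)"
  shows "jacobian f (at x) *v h = frechet_derivative f (at x) h"
  using assms frechet_derivative_at[of f "\<lambda>h. jacobian f (at x) *v h" x] jacobian_works[of f "at x"] by metis

lemma smooth_lie_bracket:
  fixes V W :: "real ^ 'd \<Rightarrow> real ^ 'd"
  assumes V: "smooth V" and W: "smooth W"
  shows "smooth (lie_bracket V W)"
proof -
  have diff: "f differentiable (at x)" if "smooth f" for f :: "real ^ 'd \<Rightarrow> real ^ 'd" and x
    using that unfolding smooth_def by (metis Ck.simps(2))
  have *: "Ck k (\<lambda>x. frechet_derivative f (at x) (g x))" if f: "smooth f" and g: "smooth g"
    for k and f g :: "real ^ 'd \<Rightarrow> real ^ 'd"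
  proof -
    \<comment> \<open>\<open>Ck\<close> only controls derivatives in a fixed direction. Expanding
      the moving direction \<open>g x\<close> in the basis leaves products of scalar coefficients
      with fixed-direction derivatives.\<close>
    have "frechet_derivative f (at x) (g x) = (\<Sum>b\<in>Basis. (g x \<bullet> b) *\<^sub>R frechet_derivative f (at x) b)" for x
    proof -
      have lin: "linear (frechet_derivative f (at x))"
        by (rule linear_frechet_derivative[OF diff[OF f]])
      have "frechet_derivative f (at x) (\<Sum>b\<in>Basis. (g x \<bullet> b) *\<^sub>R b) =
          (\<Sum>b\<in>Basis. (g x \<bullet> b) *\<^sub>R frechet_derivative f (at x) b)"
        by (simp add: linear_sum[OF lin] linear_cmul[OF lin])
      then show ?thesis by (simp add: euclidean_representation)
    qed
    moreover have "Ck k (\<lambda>x. \<Sum>b\<in>Basis. (g x \<bullet> b) *\<^sub>R frechet_derivative f (at x) b)"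
      using f g unfolding smooth_def
      by (intro Ck_sum Ck_scaleR Ck_bounded_linear[OF bounded_linear_inner_left]) (auto intro: Ck_SucD(2))
    ultimately show ?thesis by simp
  qed
  have "lie_bracket V W = (\<lambda>x. frechet_derivative W (at x) (V x) + - frechet_derivative V (at x) (W x))"
    by (simp add: fun_eq_iff lie_bracket_def jacobian_apply diff V W)
  moreover have "Ck k (\<lambda>x. frechet_derivative W (at x) (V x) + - frechet_derivative V (at x) (W x))" for k
    by (intro Ck_add * V W Ck_bounded_linear[OF bounded_linear_minus[OF bounded_linear_ident]])
  ultimately show ?thesis unfolding smooth_def by simp
qed

lemma smooth_bracket_fields:
  assumes "\<And>j. smooth (v j)" and "W \<in> bracket_fields v k"
  shows "smooth W"
  using assms(2) by (induction k arbitrary: W) (auto intro: assms(1) smooth_lie_bracket)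

lemma smooth_has_derivative: "smooth f \<Longrightarrow> (f has_derivative frechet_derivative f (at x)) (at x)"
  unfolding smooth_def using Ck_SucD(1) by blast

lemma smooth_continuous: "smooth f \<Longrightarrow> continuous_on UNIV f"
  unfolding smooth_def using Ck_continuous by blast

lemma smooth_C1_flow:
  fixes w :: "real ^ 'd \<Rightarrow> real ^ 'd"
  assumes "smooth w" "bounded (range w)" "is_flow w \<psi>"
  shows "C1_flow_vec w (\<lambda>x. Blinfun (frechet_derivative w (at x))) \<psi>"
proof (intro C1_flow_vec.intro C1_flow.intro)
  have app: "blinfun_apply (Blinfun (frechet_derivative w (at x))) = frechet_derivative w (at x)" for x
    using has_derivative_bounded_linear[OF smooth_has_derivative[OF assms(1)]]
    by (rule bounded_linear_Blinfun_apply)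
  show "(w has_derivative blinfun_apply (Blinfun (frechet_derivative w (at x)))) (at x)" for x
    unfolding app by (rule smooth_has_derivative[OF assms(1)])
  show "continuous_on UNIV (\<lambda>x. Blinfun (frechet_derivative w (at x)))"
    using assms(1) unfolding smooth_def
    by (intro continuous_on_blinfun_componentwise) (auto simp: app intro: Ck_continuous Ck_SucD(2))
qed (use assms in \<open>auto simp: is_flow_def\<close>)

lemma has_vector_derivative_quotient:
  assumes "(f has_vector_derivative f') (at 0)"
  shows "((\<lambda>t. (f t - f 0) /\<^sub>R t) \<longlongrightarrow> f') (at 0)"
proof -
  have lim: "((\<lambda>h. norm (f (0 + h) - f 0 - h *\<^sub>R f') / norm h) \<longlongrightarrow> 0) (at 0)"
    using assms by (simp add: has_vector_derivative_def has_derivative_at)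
  have ev: "\<forall>\<^sub>F h in at 0. norm (f (0 + h) - f 0 - h *\<^sub>R f') / norm h = norm ((f h - f 0) /\<^sub>R h - f')"
  proof (rule eventually_at_topological[THEN iffD2], intro exI[of _ UNIV] conjI ballI impI)
    fix h :: real assume "h \<noteq> 0"
    then have "(f h - f 0) /\<^sub>R h - f' = (f h - f 0 - h *\<^sub>R f') /\<^sub>R h" by (simp add: algebra_simps)
    then have "norm ((f h - f 0) /\<^sub>R h - f') = norm (f h - f 0 - h *\<^sub>R f') * inverse \<bar>h\<bar>"
      by (metis abs_inverse mult.commute norm_scaleR)
    then show "norm (f (0 + h) - f 0 - h *\<^sub>R f') / norm h = norm ((f h - f 0) /\<^sub>R h - f')"
      by (simp add: divide_inverse)
  qed auto
  show ?thesis
    by (rule LIM_zero_cancel, rule tendsto_norm_zero_cancel, rule Lim_transform_eventually[OF lim ev])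
qed

text \<open>The limit is the derivative at \<open>t = 0\<close> of the pullback of \<open>W\<close> along the backward flow.\<close>

lemma (in C1_flow) pullback_quotient:
  assumes W: "(W has_derivative W') (at y)"
  shows "((\<lambda>t. (flow' t (\<phi> (- t) y) (W (\<phi> (- t) y)) - W y) /\<^sub>R t) \<longlongrightarrow> v' y (W y) - W' (v y)) (at 0)"
proof -
  interpret rev: C1_flow "\<lambda>x. - v x" "\<lambda>x. - v' x" "\<lambda>t. \<phi> (- t)" by (rule reverse_C1_flow)
  define A where "A t = flow' t (\<phi> (- t) y)" for t
  \<comment> \<open>The base point of \<open>A t\<close> moves with \<open>t\<close>, and
    differentiating it directly would need second derivatives of the flow. Its inverse
    \<open>E t\<close> has the fixed base point \<open>y\<close>, and the derivative is transferred
    by \<open>A t - id = - A t (E t - id)\<close>.\<close>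
  define E where "E t = flow' (- t) y" for t
  define w where "w t = W (\<phi> (- t) y)" for t
  have AE: "A t o\<^sub>L E t = id_blinfun" for t
    unfolding A_def E_def by (rule flow'_inverse)
  have neg0: "filterlim uminus (at (0::real)) (at 0)"
    using filterlim_at[of "uminus" "0::real" UNIV "at 0"] by (auto simp: eventually_at intro!: tendsto_eq_intros exI[of _ 1])
  have E_quot: "((\<lambda>t. (E t - id_blinfun) /\<^sub>R t) \<longlongrightarrow> - v' y) (at 0)"
  proof -
    have "((\<lambda>t. (flow' t y - id_blinfun) /\<^sub>R t) \<longlongrightarrow> v' y) (at 0)"
      using has_vector_derivative_quotient[OF flow'_deriv_0[of y]] by simp
    from tendsto_minus[OF filterlim_compose[OF this neg0]]
    show ?thesis by (simp add: E_def)
  qed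
  have A_lim: "(A \<longlongrightarrow> id_blinfun) (at 0)"
  proof -
    have "isCont (\<lambda>(t, x). flow' t x) (0, y)"
      using flow'_cont by (simp add: continuous_on_eq_continuous_at)
    moreover have "((\<lambda>t. \<phi> (- t) y) \<longlongrightarrow> y) (at 0)"
      using has_vector_derivative_continuous[OF rev.flow_deriv[of y 0]] by (simp add: isCont_def)
    ultimately show ?thesis
      using isCont_tendsto_compose[OF _ tendsto_Pair[OF tendsto_ident_at]] unfolding A_def by fastforce
  qed
  have "((\<lambda>t. A t o\<^sub>L (- ((E t - id_blinfun) /\<^sub>R t))) \<longlongrightarrow> id_blinfun o\<^sub>L (- (- v' y))) (at 0)"
    by (intro bounded_bilinear.tendsto[OF bounded_bilinear_blinfun_compose] tendsto_minus A_lim E_quot)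
  moreover have "A t o\<^sub>L (- ((E t - id_blinfun) /\<^sub>R t)) = (A t - id_blinfun) /\<^sub>R t" for t
  proof (rule blinfun_eqI)
    fix h
    have "A t (E t h) = h" using AE[of t] by (metis blinfun_apply_blinfun_compose blinfun_apply_id_blinfun id_apply)
    then show "blinfun_apply (A t o\<^sub>L (- ((E t - id_blinfun) /\<^sub>R t))) h = blinfun_apply ((A t - id_blinfun) /\<^sub>R t) h"
      by (simp add: blinfun.bilinear_simps algebra_simps)
  qed
  moreover have "id_blinfun o\<^sub>L (- (- v' y)) = v' y" by (rule blinfun_eqI) simp
  ultimately have A_quot: "((\<lambda>t. (A t - id_blinfun) /\<^sub>R t) \<longlongrightarrow> v' y) (at 0)" by simp
  have "(w has_vector_derivative W' (- v y)) (at 0)"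
  proof -
    have 1: "((\<lambda>t. \<phi> (- t) y) has_derivative (\<lambda>h. h *\<^sub>R - v y)) (at 0)"
      using rev.flow_deriv[of y 0] by (simp add: has_vector_derivative_def)
    have 2: "(W has_derivative W') (at (\<phi> (- 0) y))" using W by simp
    have "linear W'" using W by (rule has_derivative_linear)
    then show ?thesis
      using has_derivative_compose[OF 1 2] unfolding w_def has_vector_derivative_def by (simp only: linear_cmul)
  qed
  note w_der = this
  have w0: "w 0 = W y" by (simp add: w_def)
  have w_quot: "((\<lambda>t. (w t - W y) /\<^sub>R t) \<longlongrightarrow> W' (- v y)) (at 0)"
    using has_vector_derivative_quotient[OF w_der] by (simp only: w0)
  have w_lim: "(w \<longlongrightarrow> W y) (at 0)"
    using has_vector_derivative_continuous[OF w_der] by (simp only: isCont_def w0)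
  have "((\<lambda>t. ((A t - id_blinfun) /\<^sub>R t) (w t) + (w t - W y) /\<^sub>R t) \<longlongrightarrow> v' y (W y) + W' (- v y)) (at 0)"
    by (intro tendsto_add blinfun.tendsto A_quot w_quot w_lim)
  moreover have "((A t - id_blinfun) /\<^sub>R t) (w t) + (w t - W y) /\<^sub>R t = (A t (w t) - W y) /\<^sub>R t" for t
    by (simp add: blinfun.bilinear_simps algebra_simps)
  moreover have "W' (- v y) = - W' (v y)" using has_derivative_linear[OF W] by (rule linear_neg)
  ultimately show ?thesis by (simp add: A_def w_def)
qed

lemma (in C1_flow) flow_joint_derivative:
  "((\<lambda>(t, x). \<phi> t x) has_derivative (\<lambda>(s, h). s *\<^sub>R v (\<phi> t x) + flow' t x h)) (at (t, x))"
proof -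
  have "((\<lambda>(t, x). \<phi> t x) has_derivative (\<lambda>(s, h). s *\<^sub>R v (\<phi> t x) + flow' t x h)) (at (t, x) within UNIV \<times> UNIV)"
  proof (rule has_derivative_partialsI)
    show "((\<lambda>s. \<phi> s x) has_derivative (\<lambda>s. s *\<^sub>R v (\<phi> t x))) (at t)"
      using flow_deriv by (simp add: has_vector_derivative_def)
    show "continuous (at (t, x) within UNIV \<times> UNIV) (\<lambda>(t, x). flow' t x)"
      using flow'_cont by (simp add: continuous_on_eq_continuous_at)
  qed (simp_all add: flow_has_derivative)
  then show ?thesis by simp
qed

section \<open>Families of flows, immersed patches and Krener's theorem\<close>

locale flow_family =
  fixes v :: "'e \<Rightarrow> real ^ 'd \<Rightarrow> real ^ 'd" and \<phi> :: "'e \<Rightarrow> real \<Rightarrow> real ^ 'd \<Rightarrow> real ^ 'd"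
  assumes smooth_v: "smooth (v j)" and bounded_v: "bounded (range (v j))" and flow: "is_flow (v j) (\<phi> j)"
begin

definition v' :: "'e \<Rightarrow> real ^ 'd \<Rightarrow> (real ^ 'd) \<Rightarrow>\<^sub>L (real ^ 'd)" where
  "v' j x = Blinfun (frechet_derivative (v j) (at x))"

sublocale C1: C1_flow_vec "v j" "v' j" "\<phi> j" for j
  unfolding v'_def[abs_def] by (rule smooth_C1_flow[OF smooth_v bounded_v flow])

lemma matrix_v': "matrix (v' j x) = jacobian (v j) (at x)"
  using frechet_derivative_at[OF C1.v_deriv] by (metis jacobian_def)

end

text \<open>The pairs of a point and a unit vector orthogonal to all bracket fields form a compact
  set near \<open>x\<close>, whatever the number of fields. Its projection to the points is closed
  and misses \<open>x\<close>.\<close>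

lemma weak_hormander_nhd:
  fixes v :: "'e \<Rightarrow> real ^ 'd \<Rightarrow> real ^ 'd"
  assumes smooth: "\<And>j. smooth (v j)" and x: "weak_hormander v x"
  shows "\<exists>e>0. \<forall>y\<in>ball x e. \<forall>\<xi>. \<xi> \<noteq> 0 \<longrightarrow> (\<exists>k. \<exists>V\<in>bracket_fields v k. V y \<bullet> \<xi> \<noteq> 0)"
proof -
  define F where "F = (\<Union>k. bracket_fields v k)"
  define S where "S = (cball x 1 \<times> sphere 0 1) \<inter> (\<Inter>V\<in>F. {p. V (fst p) \<bullet> snd p = 0})"
  have "closed {p. V (fst p) \<bullet> snd p = 0}" if "V \<in> F" for V
  proof (rule closed_Collect_eq)
    have "continuous_on UNIV V"
      using that smooth_continuous[OF smooth_bracket_fields[OF smooth]] by (auto simp: F_def)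
    then show "continuous_on UNIV (\<lambda>p. V (fst p) \<bullet> snd p)"
      by (intro continuous_on_inner continuous_on_snd continuous_on_id
          continuous_on_compose2[OF _ continuous_on_fst[OF continuous_on_id]]) auto
  qed (rule continuous_on_const)
  then have "compact S"
    unfolding S_def by (intro compact_Int_closed compact_Times closed_INT) auto
  then have "compact (fst ` S)"
    by (intro compact_continuous_image continuous_on_fst continuous_on_id)
  then have "open (- (fst ` S))" by (simp add: compact_imp_closed open_Compl)
  moreover have "x \<notin> fst ` S"
  proof
    assume "x \<in> fst ` S"
    then obtain \<xi> where \<xi>: "norm \<xi> = 1" "\<And>V. V \<in> F \<Longrightarrow> V x \<bullet> \<xi> = 0"
      by (auto simp: S_def)
    have "span {V x | V. V \<in> F} \<subseteq> {y. y \<bullet> \<xi> = 0}"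
      using \<xi>(2) by (intro span_minimal) (auto simp: subspace_def inner_add_left)
    moreover have "span {V x | V. V \<in> F} = UNIV" using x by (simp only: weak_hormander_def F_def)
    ultimately have "\<xi> \<in> {y. y \<bullet> \<xi> = 0}" by blast
    then show False using \<xi>(1) by simp
  qed
  ultimately obtain e where e: "e > 0" "ball x e \<subseteq> - (fst ` S)"
    by (meson ComplI openE)
  show ?thesis
  proof (intro exI[of _ "min e 1"] conjI ballI allI impI)
    fix y \<xi> :: "real ^ 'd" assume y: "y \<in> ball x (min e 1)" and "\<xi> \<noteq> 0"
    then have n: "norm (\<xi> /\<^sub>R norm \<xi>) = 1" by simp
    have "y \<notin> fst ` S" using y e by auto
    then have "(y, \<xi> /\<^sub>R norm \<xi>) \<notin> S" by (auto simp: image_iff)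
    then obtain V where "V \<in> F" "V y \<bullet> (\<xi> /\<^sub>R norm \<xi>) \<noteq> 0"
      using y n by (auto simp: S_def)
    then show "\<exists>k. \<exists>V\<in>bracket_fields v k. V y \<bullet> \<xi> \<noteq> 0" by (auto simp: F_def)
  qed (use e in simp)
qed

text \<open>An immersed patch of dimension \<open>card K\<close> inside \<open>D\<close>: \<open>F\<close> has injective derivative in the
  coordinates \<open>K\<close> and does not move in the others, so all patches share one parameter space.\<close>

definition patch ::
    "(real ^ 'd) set \<Rightarrow> 'd set \<Rightarrow> (real ^ 'd \<Rightarrow> real ^ 'd) \<Rightarrow> (real ^ 'd \<Rightarrow> (real ^ 'd) \<Rightarrow>\<^sub>L (real ^ 'd)) \<Rightarrow>
     (real ^ 'd) set \<Rightarrow> bool" where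
  "patch D K F F' S \<longleftrightarrow> open S \<and> S \<noteq> {} \<and> F ` S \<subseteq> D \<and>
     (\<forall>s\<in>S. (F has_derivative blinfun_apply (F' s)) (at s)) \<and> continuous_on S F' \<and>
     (\<forall>s\<in>S. (\<forall>m. m \<notin> K \<longrightarrow> F' s (axis m 1) = 0) \<and>
        (\<forall>h. (\<forall>m. m \<notin> K \<longrightarrow> h $ m = 0) \<longrightarrow> F' s h = 0 \<longrightarrow> h = 0))"

lemma patchD:
  assumes "patch D K F F' S"
  shows "open S" "S \<noteq> {}" "\<And>s. s \<in> S \<Longrightarrow> F s \<in> D"
    and "\<And>s. s \<in> S \<Longrightarrow> (F has_derivative blinfun_apply (F' s)) (at s)"
    and "continuous_on S F'" "continuous_on S F"
    and "\<And>s m. s \<in> S \<Longrightarrow> m \<notin> K \<Longrightarrow> F' s (axis m 1) = 0"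
    and "\<And>s h. s \<in> S \<Longrightarrow> (\<forall>m. m \<notin> K \<longrightarrow> h $ m = 0) \<Longrightarrow> F' s h = 0 \<Longrightarrow> h = 0"
proof -
  note p = assms[unfolded patch_def]
  show "open S" "S \<noteq> {}" "continuous_on S F'" using p by blast+
  show "F s \<in> D" if "s \<in> S" for s using p that by blast
  show d: "(F has_derivative blinfun_apply (F' s)) (at s)" if "s \<in> S" for s using p that by blast
  show "continuous_on S F"
    by (rule continuous_at_imp_continuous_on) (blast intro: has_derivative_continuous d)
  show "F' s (axis m 1) = 0" if "s \<in> S" "m \<notin> K" for s m using p that by blast
  show "h = 0" if "s \<in> S" "\<forall>m. m \<notin> K \<longrightarrow> h $ m = 0" "F' s h = 0" for s h using p that by blast
qed

lemma continuous_on_open_Collect: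
  "continuous_on S f \<Longrightarrow> open S \<Longrightarrow> open U \<Longrightarrow> open {x\<in>S. f x \<in> U}"
  using continuous_on_open_vimage[of S f] by (simp add: vimage_def Int_def conj_commute)

text \<open>An injective linear map on the coordinate subspace is bounded below by some
  \<open>c * norm h\<close>, and perturbations of norm below \<open>c\<close> stay
  injective.\<close>

lemma injective_on_coordinates_nhd:
  fixes G :: "real ^ 'd \<Rightarrow> (real ^ 'd) \<Rightarrow>\<^sub>L (real ^ 'd)"
  assumes cont: "isCont G s"
    and inj: "\<And>h. (\<forall>m. m \<notin> K \<longrightarrow> h $ m = 0) \<Longrightarrow> G s h = 0 \<Longrightarrow> h = 0"
  shows "\<exists>d>0. \<forall>r\<in>ball s d. \<forall>h. (\<forall>m. m \<notin> K \<longrightarrow> h $ m = 0) \<longrightarrow> G r h = 0 \<longrightarrow> h = 0"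
proof -
  define V where "V = {h :: real ^ 'd. \<forall>m. m \<notin> K \<longrightarrow> h $ m = 0}"
  have V: "subspace V" by (auto simp: V_def subspace_def)
  obtain c where c: "c > 0" "\<forall>h\<in>V. norm (G s h) \<ge> c * norm h"
    using injective_imp_isometric[OF closed_subspace[OF V] V blinfun.bounded_linear_right, of "G s"] inj
    by (auto simp: V_def)
  obtain d where d: "d > 0" "\<And>r. dist r s < d \<Longrightarrow> dist (G r) (G s) < c"
    using cont c(1) unfolding continuous_at_eps_delta by metis
  show ?thesis
  proof (intro exI[of _ d] conjI ballI allI impI d(1))
    fix r h assume r: "r \<in> ball s d" and h: "\<forall>m. m \<notin> K \<longrightarrow> h $ m = 0" and 0: "G r h = 0"
    show "h = 0"
    proof (rule ccontr)
      assume "h \<noteq> 0"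
      have "c * norm h \<le> norm (G s h)" using c(2) h by (simp add: V_def)
      also have "\<dots> = norm ((G r - G s) h)" using 0 by (simp add: blinfun.diff_left)
      also have "\<dots> \<le> norm (G r - G s) * norm h" by (rule norm_blinfun)
      also have "\<dots> < c * norm h"
        using d(2)[of r] r \<open>h \<noteq> 0\<close> by (intro mult_strict_right_mono) (auto simp: dist_norm norm_minus_commute)
      finally show False by simp
    qed
  qed
qed

context flow_family
begin

text \<open>Derivatives of the flow are invertible, so a patch pushed along a backward flow is a
  patch with the same index set \<open>K\<close>, as long as it stays in \<open>U\<close>. The
  tangency statement for \<open>K\<close> thus also applies at the earlier point of the
  orbit.\<close>

lemma patch_transport:
  assumes p: "patch (C \<inter> U) K F F' S" and U: "open U"
    and C: "\<And>y t. y \<in> C \<Longrightarrow> 0 \<le> t \<Longrightarrow> \<phi> j (- t) y \<in> C"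
    and t: "0 \<le> t" and s: "s \<in> S" "\<phi> j (- t) (F s) \<in> U"
  shows "\<exists>S'. s \<in> S' \<and> patch (C \<inter> U) K (\<lambda>s. \<phi> j (- t) (F s)) (\<lambda>s. C1.flow' j (- t) (F s) o\<^sub>L F' s) S'"
proof -
  note p' = patchD[OF p]
  have \<phi>F: "continuous_on S (\<lambda>s. \<phi> j (- t) (F s))"
    by (intro C1.flow_cont_compose continuous_on_const p'(6))
  define S' where "S' = {s\<in>S. \<phi> j (- t) (F s) \<in> U}"
  have S': "open S'" "S' \<subseteq> S"
    using continuous_on_open_Collect[OF \<phi>F p'(1) U] by (auto simp: S'_def)
  have inj: "h = 0" if "C1.flow' j (- t) y h = 0" for y h
  proof -
    have "C1.flow' j t (\<phi> j (- t) y) (C1.flow' j (- t) y h) = h"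
      using C1.flow'_inverse[of j t y] by (metis blinfun_apply_blinfun_compose blinfun_apply_id_blinfun id_apply)
    then show ?thesis using that by (simp add: blinfun.zero_right)
  qed
  have "patch (C \<inter> U) K (\<lambda>s. \<phi> j (- t) (F s)) (\<lambda>s. C1.flow' j (- t) (F s) o\<^sub>L F' s) S'"
    unfolding patch_def
  proof (intro conjI ballI)
    show "open S'" by (rule S')
    show "S' \<noteq> {}" using s by (auto simp: S'_def)
    show "(\<lambda>s. \<phi> j (- t) (F s)) ` S' \<subseteq> C \<inter> U"
      using p'(3) C t by (auto simp: S'_def)
    have "continuous_on S' (\<lambda>s. C1.flow' j (- t) (F s))"
      using continuous_on_compose2[OF C1.flow'_cont continuous_on_Pair[OF continuous_on_const[of _ "- t"]
          continuous_on_subset[OF p'(6) S'(2)]]] by simp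
    then show "continuous_on S' (\<lambda>s. C1.flow' j (- t) (F s) o\<^sub>L F' s)"
      by (rule bounded_bilinear.continuous_on[OF bounded_bilinear_blinfun_compose])
        (rule continuous_on_subset[OF p'(5) S'(2)])
    fix r assume "r \<in> S'"
    then have r: "r \<in> S" using S' by auto
    show "((\<lambda>s. \<phi> j (- t) (F s)) has_derivative blinfun_apply (C1.flow' j (- t) (F r) o\<^sub>L F' r)) (at r)"
      using has_derivative_compose[OF p'(4)[OF r] C1.flow_has_derivative[of j "- t" "F r"]]
      by (simp add: blinfun_apply_blinfun_compose[abs_def])
    show "\<forall>m. m \<notin> K \<longrightarrow> (C1.flow' j (- t) (F r) o\<^sub>L F' r) (axis m 1) = 0"
      using p'(7)[OF r] by (simp add: blinfun.zero_right)
    show "\<forall>h. (\<forall>m. m \<notin> K \<longrightarrow> h $ m = 0) \<longrightarrow> (C1.flow' j (- t) (F r) o\<^sub>L F' r) h = 0 \<longrightarrow> h = 0"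
      using p'(8)[OF r] inj by (metis blinfun_apply_blinfun_compose)
  qed
  moreover have "s \<in> S'" using s by (simp add: S'_def)
  ultimately show ?thesis by blast
qed

text \<open>A field transverse to a patch sweeps out one more dimension when the patch is moved
  along its backward flow for variable times.\<close>

lemma patch_extend:
  assumes p: "patch (C \<inter> U) K F F' S" and U: "open U"
    and C: "\<And>y t. y \<in> C \<Longrightarrow> 0 \<le> t \<Longrightarrow> \<phi> j (- t) y \<in> C"
    and s: "s \<in> S" "v j (F s) \<notin> range (F' s)" and m: "m \<notin> K"
  shows "\<exists>F F' S. patch (C \<inter> U) (insert m K) F F' S"
proof -
  note p' = patchD[OF p]
  \<comment> \<open>The free coordinate \<open>m\<close> serves as time, with value 0 at the centre
    \<open>s\<close>. As \<open>F' r\<close> annihilates that coordinate, the derivative of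
    \<open>G\<close> at \<open>s\<close> in direction \<open>m\<close> is
    \<open>- v j (F s)\<close>, which lies outside the range of \<open>F' s\<close>.\<close>
  define \<tau> where "\<tau> r = s $ m - r $ m" for r
  define G where "G r = \<phi> j (\<tau> r) (F r)" for r
  define G' where "G' r = (C1.flow' j (\<tau> r) (F r) o\<^sub>L F' r) -
      (blinfun_scaleR_left (v j (G r)) o\<^sub>L blinfun_inner_left (axis m 1))" for r
  have G'_apply: "G' r h = C1.flow' j (\<tau> r) (F r) (F' r h) - (h $ m) *\<^sub>R v j (G r)" for r h
    by (simp add: G'_def blinfun.bilinear_simps inner_axis)
  have \<tau>: "continuous_on A \<tau>" for A unfolding \<tau>_def by (intro continuous_intros)
  have G: "continuous_on S G"
    unfolding G_def by (intro C1.flow_cont_compose \<tau> p'(6))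
  have v: "continuous_on UNIV (v j)"
    by (rule smooth_continuous[OF smooth_v])
  have G': "continuous_on S G'"
  proof -
    have 1: "continuous_on S (\<lambda>r. C1.flow' j (\<tau> r) (F r))"
      using continuous_on_compose2[OF C1.flow'_cont continuous_on_Pair[OF \<tau> p'(6)]] by simp
    have 2: "continuous_on S (\<lambda>r. v j (G r))"
      using continuous_on_compose2[OF v G] by simp
    show ?thesis
    proof (rule continuous_on_blinfun_componentwise)
      fix i
      show "continuous_on S (\<lambda>r. G' r i)"
        unfolding G'_apply by (intro continuous_intros blinfun.continuous_on 1 2 p'(5))
    qed
  qed
  have G_deriv: "(G has_derivative G' r) (at r)" if r: "r \<in> S" for r
  proof -
    have \<tau>_der: "(\<tau> has_derivative (\<lambda>h. - (h $ m))) (at r)"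
      unfolding \<tau>_def
      by (rule has_derivative_eq_rhs, rule has_derivative_diff[OF has_derivative_const
            bounded_linear_imp_has_derivative[OF bounded_linear_vec_nth]]) simp
    have "((\<lambda>r. case (\<tau> r, F r) of (t, x) \<Rightarrow> \<phi> j t x) has_derivative
        (\<lambda>h. case (- (h $ m), F' r h) of (s, h) \<Rightarrow> s *\<^sub>R v j (\<phi> j (\<tau> r) (F r)) + C1.flow' j (\<tau> r) (F r) h)) (at r)"
      by (rule has_derivative_compose[OF has_derivative_Pair[OF \<tau>_der p'(4)[OF r]] C1.flow_joint_derivative])
    moreover have "(\<lambda>r. case (\<tau> r, F r) of (t, x) \<Rightarrow> \<phi> j t x) = G"
      by (simp add: fun_eq_iff G_def)
    moreover have "(\<lambda>h. case (- (h $ m), F' r h) of (s, h) \<Rightarrow> s *\<^sub>R v j (\<phi> j (\<tau> r) (F r)) + C1.flow' j (\<tau> r) (F r) h) = G' r"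
      by (simp add: fun_eq_iff G'_apply G_def)
    ultimately show ?thesis by simp
  qed
  have inj_s: "h = 0" if h: "\<forall>i. i \<notin> insert m K \<longrightarrow> h $ i = 0" and 0: "G' s h = 0" for h
  proof -
    have eq: "F' s h = (h $ m) *\<^sub>R v j (F s)"
      using 0 by (simp add: G'_apply \<tau>_def G_def)
    have "h $ m = 0"
    proof (rule ccontr)
      assume "h $ m \<noteq> 0"
      then have "v j (F s) = F' s (h /\<^sub>R (h $ m))" using eq by (simp add: blinfun.scaleR_right)
      then show False using s(2) by blast
    qed
    moreover from this have "F' s h = 0" using eq by simp
    ultimately show ?thesis using h by (intro p'(8)[OF s(1), of h]) (metis insert_iff)
  qed
  have "isCont G' s"
    using G' p'(1) s(1) continuous_on_eq_continuous_at by blast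
  from injective_on_coordinates_nhd[OF this inj_s]
  obtain d where d: "d > 0" "\<forall>r\<in>ball s d. \<forall>h. (\<forall>i. i \<notin> insert m K \<longrightarrow> h $ i = 0) \<longrightarrow> G' r h = 0 \<longrightarrow> h = 0"
    by blast
  have "open ({r\<in>S. G r \<in> U} \<inter> ball s d)"
    using continuous_on_open_Collect[OF G p'(1) U] by auto
  moreover have "s \<in> {r\<in>S. G r \<in> U} \<inter> ball s d"
    using s d p'(3)[OF s(1)] by (simp add: G_def \<tau>_def)
  ultimately obtain e where e: "e > 0" "ball s e \<subseteq> {r\<in>S. G r \<in> U} \<inter> ball s d"
    using openE by blast
  \<comment> \<open>Only backward motion stays in \<open>C\<close>, so the new patch uses the half
    of the ball on which \<open>\<tau>\<close> is negative; its centre \<open>s\<close> is lost, but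
    a patch need only be open and non-empty.\<close>
  define S' where "S' = ball s e \<inter> {r. s $ m < r $ m}"
  have S': "S' \<subseteq> S" "S' \<subseteq> ball s d" using e by (auto simp: S'_def)
  have "patch (C \<inter> U) (insert m K) G G' S'"
    unfolding patch_def
  proof (intro conjI ballI)
    have "open {r :: real ^ 'd. s $ m < r $ m}"
      by (intro open_Collect_less continuous_intros)
    then show "open S'" unfolding S'_def by auto
    have "s + (e / 2) *\<^sub>R axis m 1 \<in> S'"
      using e(1) by (simp add: S'_def dist_norm)
    then show "S' \<noteq> {}" by blast
    show "G ` S' \<subseteq> C \<inter> U"
    proof clarify
      fix r assume r: "r \<in> S'"
      then have "r \<in> S" "G r \<in> U" using e by (auto simp: S'_def)
      moreover have "\<phi> j (- (r $ m - s $ m)) (F r) \<in> C"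
        using r p'(3)[OF \<open>r \<in> S\<close>] by (intro C) (auto simp: S'_def)
      ultimately show "G r \<in> C \<inter> U" by (simp add: G_def \<tau>_def)
    qed
    show "continuous_on S' G'" by (rule continuous_on_subset[OF G' S'(1)])
    fix r assume r: "r \<in> S'"
    then show "(G has_derivative G' r) (at r)" using G_deriv S' by blast
    show "\<forall>i. i \<notin> insert m K \<longrightarrow> G' r (axis i 1) = 0"
      using p'(7)[of r] r S'(1) by (auto simp: G'_apply blinfun.zero_right axis_def)
    show "\<forall>h. (\<forall>i. i \<notin> insert m K \<longrightarrow> h $ i = 0) \<longrightarrow> G' r h = 0 \<longrightarrow> h = 0"
      using d(2) r S' by blast
  qed
  then show ?thesis by blast
qed

text \<open>Induction on the bracket depth, for all patches with index set \<open>K\<close> at once.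
  The fields \<open>v j\<close> are tangent by maximality. If \<open>V\<close> is tangent to every
  such patch, it is tangent to the transported ones, so its pullback along the backward flow stays
  in the fixed subspace \<open>range (F' s)\<close>, and so does the derivative of this curve, which
  is a bracket.\<close>

lemma brackets_tangent_to_maximal_patch:
  assumes U: "open U" and C: "\<And>j y t. y \<in> C \<Longrightarrow> 0 \<le> t \<Longrightarrow> \<phi> j (- t) y \<in> C"
    and max: "\<And>m. m \<notin> K \<Longrightarrow> \<not> (\<exists>F F' S. patch (C \<inter> U) (insert m K) F F' S)" and K: "K \<noteq> UNIV"
    and W: "W \<in> bracket_fields v k"
  shows "patch (C \<inter> U) K F F' S \<Longrightarrow> s \<in> S \<Longrightarrow> W (F s) \<in> range (F' s)"
  using W
proof (induction k arbitrary: W F F' S s)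
  case 0
  then obtain j where "W = v j" by auto
  moreover obtain m where "m \<notin> K" using K by blast
  ultimately show ?case
    using patch_extend[OF 0(1) U C 0(2), of j] max by blast
next
  case (Suc k)
  show ?case
  proof (cases "W \<in> bracket_fields v k")
    case True
    then show ?thesis using Suc by blast
  next
    case False
    then obtain j V where V: "V \<in> bracket_fields v k" and W_eq: "W = lie_bracket (v j) V"
      using Suc.prems(3) by auto
    define y where "y = F s"
    let ?T = "range (F' s)"
    have T: "subspace ?T"
      by (intro linear_subspace_image bounded_linear.linear blinfun.bounded_linear_right subspace_UNIV)
    have V_smooth: "smooth V" by (rule smooth_bracket_fields[OF smooth_v V])
    let ?u = "\<lambda>t. C1.flow' j t (\<phi> j (- t) y) (V (\<phi> j (- t) y))"
    have y: "y \<in> C \<inter> U" unfolding y_def by (rule patchD(3)[OF Suc.prems(1,2)])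
    have u: "?u t \<in> ?T" if t: "0 \<le> t" and tU: "\<phi> j (- t) y \<in> U" for t
    proof -
      obtain S' where "s \<in> S'" "patch (C \<inter> U) K (\<lambda>s. \<phi> j (- t) (F s)) (\<lambda>s. C1.flow' j (- t) (F s) o\<^sub>L F' s) S'"
        using patch_transport[OF Suc.prems(1) U C t Suc.prems(2)] tU y_def by blast
      from Suc.IH[OF this(2,1) V] obtain h where "V (\<phi> j (- t) y) = C1.flow' j (- t) y (F' s h)"
        by (auto simp: y_def)
      then have "?u t = (C1.flow' j t (\<phi> j (- t) y) o\<^sub>L C1.flow' j (- t) y) (F' s h)" by simp
      then show ?thesis unfolding C1.flow'_inverse by simp
    qed
    \<comment> \<open>Transport is possible for \<open>t \<ge> 0\<close> only, so the derivative is
      taken from the right; a finite-dimensional subspace is closed and contains the limit.\<close>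
    have ev: "\<forall>\<^sub>F t in at_right 0. (?u t - V y) /\<^sub>R t \<in> ?T"
    proof -
      have "open {t. \<phi> j (- t) y \<in> U}"
        using continuous_on_open_Collect[OF C1.flow_cont_compose[OF continuous_on_minus[OF continuous_on_id]
          continuous_on_const] open_UNIV U] by simp
      moreover have "0 \<in> {t. \<phi> j (- t) y \<in> U}" using y by simp
      ultimately have "\<forall>\<^sub>F t in at_right 0. t \<in> {t. \<phi> j (- t) y \<in> U}"
        by (meson eventually_at_topological)
      moreover have "\<forall>\<^sub>F t in at_right (0::real). 0 < t" by (rule eventually_at_right_less)
      ultimately show ?thesis
      proof eventually_elim
        case (elim t)
        have "?u t \<in> ?T" "?u 0 \<in> ?T" using elim u[of t] u[of 0] y by auto
        then show ?case using subspace_diff[OF T] subspace_scale[OF T] by simp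
      qed
    qed
    have "((\<lambda>t. (?u t - V y) /\<^sub>R t) \<longlongrightarrow> v' j y (V y) - frechet_derivative V (at y) (v j y)) (at_right 0)"
      by (rule tendsto_mono[OF at_le C1.pullback_quotient[OF smooth_has_derivative[OF V_smooth]]]) simp
    from Lim_in_closed_set[OF closed_subspace[OF T] ev _ this]
    have "v' j y (V y) - frechet_derivative V (at y) (v j y) \<in> ?T" by simp
    \<comment> \<open>The pullback derivative is the negative of \<open>lie_bracket (v j) V\<close>
      at \<open>y\<close>.\<close>
    then have "- (v' j y (V y) - frechet_derivative V (at y) (v j y)) \<in> ?T" by (rule subspace_neg[OF T])
    moreover have "jacobian (v j) (at y) *v V y = v' j y (V y)"
      using C1.v_deriv[of j y] frechet_derivative_at[OF C1.v_deriv[of j y]]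
      by (metis jacobian_apply differentiableI)
    moreover have "jacobian V (at y) *v v j y = frechet_derivative V (at y) (v j y)"
      using smooth_has_derivative[OF V_smooth, of y] by (intro jacobian_apply differentiableI)
    ultimately show ?thesis unfolding W_eq lie_bracket_def y_def[symmetric] by simp
  qed
qed

text \<open>Krener's theorem: a patch of maximal dimension is tangent to all bracket fields, hence has
  full dimension near a point satisfying the bracket condition.\<close>

theorem backward_invariant_has_interior:
  assumes x: "x \<in> C" "weak_hormander v x" and U: "open U" "x \<in> U"
    and C: "\<And>j y t. y \<in> C \<Longrightarrow> 0 \<le> t \<Longrightarrow> \<phi> j (- t) y \<in> C"
  shows "interior (C \<inter> U) \<noteq> {}"
proof -
  obtain e where e: "e > 0" "\<forall>y\<in>ball x e. \<forall>\<xi>. \<xi> \<noteq> 0 \<longrightarrow> (\<exists>k. \<exists>V\<in>bracket_fields v k. V y \<bullet> \<xi> \<noteq> 0)"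
    using weak_hormander_nhd[OF smooth_v x(2)] by blast
  define D where "D = U \<inter> ball x e"
  define \<K> where "\<K> = {K. \<exists>F F' S. patch (C \<inter> D) K F F' S}"
  have D: "open D" "x \<in> D" using U e by (auto simp: D_def)
  \<comment> \<open>The constant map is a patch of dimension 0, so a patch of largest dimension
    exists. Working in \<open>D\<close> keeps all patches where the bracket fields leave no
    direction orthogonal.\<close>
  have "patch (C \<inter> D) {} (\<lambda>_. x) (\<lambda>_. 0) UNIV"
    using x D by (auto simp: patch_def vec_eq_iff zero_blinfun.rep_eq intro: has_derivative_const)
  then have "\<K> \<noteq> {}" "finite \<K>" by (auto simp: \<K>_def)
  then have "Max (card ` \<K>) \<in> card ` \<K>" by (intro Max_in) auto
  then obtain K where K1: "K \<in> \<K>" "Max (card ` \<K>) = card K" by blast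
  have K: "K \<in> \<K>" "\<And>K'. K' \<in> \<K> \<Longrightarrow> card K' \<le> card K"
    using K1 Max_ge[of "card ` \<K>"] \<open>finite \<K>\<close> by auto
  then obtain F F' S where p: "patch (C \<inter> D) K F F' S" by (auto simp: \<K>_def)
  note p' = patchD[OF p]
  obtain s where s: "s \<in> S" using p'(2) by blast
  have lin: "linear (F' s)" by (intro bounded_linear.linear blinfun.bounded_linear_right)
  have "K = UNIV"
  proof (rule ccontr)
    assume K': "K \<noteq> UNIV"
    have max: "\<not> (\<exists>F F' S. patch (C \<inter> D) (insert m K) F F' S)" if "m \<notin> K" for m
    proof
      assume "\<exists>F F' S. patch (C \<inter> D) (insert m K) F F' S"
      then have "card (insert m K) \<le> card K" by (intro K(2)) (simp add: \<K>_def)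
      then show False using that by (simp add: card_insert_if)
    qed
    obtain m where m: "m \<notin> K" using K' by blast
    have "\<not> inj (F' s)"
    proof
      assume "inj (F' s)"
      moreover have "F' s (axis m 1) = F' s 0" using p'(7)[OF s m] by (simp add: blinfun.zero_right)
      ultimately have "axis m (1::real) = 0" by (rule injD)
      then show False by simp
    qed
    then have "range (F' s) \<noteq> UNIV" using linear_surjective_imp_injective[OF lin] by blast
    moreover have "subspace (range (F' s))" using lin linear_subspace_image subspace_UNIV by blast
    ultimately have "dim (range (F' s)) < DIM(real ^ 'd)"
      using dim_eq_full[of "range (F' s)"] dim_subset_UNIV[of "range (F' s)"] by (metis le_neq_implies_less span_eq_iff)
    then obtain \<xi> where \<xi>0: "\<xi> \<noteq> 0" "\<And>y. y \<in> span (range (F' s)) \<Longrightarrow> orthogonal \<xi> y"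
      by (rule orthogonal_to_subspace_exists[of "range (F' s)"]) blast
    have \<xi>: "\<xi> \<noteq> 0" "\<And>y. y \<in> range (F' s) \<Longrightarrow> orthogonal \<xi> y"
      by (rule \<xi>0(1), rule \<xi>0(2), rule span_base)
    have "F s \<in> ball x e" using p'(3)[OF s] by (simp add: D_def)
    then obtain k V where "V \<in> bracket_fields v k" "V (F s) \<bullet> \<xi> \<noteq> 0"
      using e(2) \<xi>(1) by blast
    moreover have "V (F s) \<in> range (F' s)" if "V \<in> bracket_fields v k" for V k
      by (rule brackets_tangent_to_maximal_patch[OF D(1) C max K' that p s])
    ultimately show False using \<xi>(2) by (metis inner_commute orthogonal_def)
  qed
  have "inj (F' s)"
    using p'(8)[OF s] \<open>K = UNIV\<close> by (simp add: linear_injective_0[OF lin])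
  then obtain g where g: "linear g" "F' s \<circ> g = id"
    using linear_injective_imp_surjective[OF lin] linear_surjective_right_inverse[OF lin] by auto
  have "F s \<in> interior (F ` S)"
  proof (rule sussmann_open_mapping[OF p'(1) p'(6) s p'(4)[OF s] _ g(2)])
    show "bounded_linear g" using g(1) by (simp add: linear_conv_bounded_linear)
    show "s \<in> interior S" using s p'(1) by (simp add: interior_open)
  qed simp
  moreover have "F ` S \<subseteq> C \<inter> U" using p'(3) by (auto simp: D_def)
  ultimately show ?thesis using interior_mono by blast
qed

end

section \<open>Stationary laws and the first jump\<close>

lemma sets_borel_pair_greaterThan:
  "sets ((borel :: 'a::topological_space measure) \<Otimes>\<^sub>M (borel :: real measure)) =
     sigma_sets UNIV {A \<times> B | A B. A \<in> sets borel \<and> B \<in> range greaterThan}"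
proof -
  have "sets ((borel :: 'a measure) \<Otimes>\<^sub>M (borel :: real measure)) =
      sets (sigma (space borel \<times> space borel) {A \<times> B | A B. A \<in> sets borel \<and> B \<in> range greaterThan})"
  proof (rule sets_pair_eq[where Ca = "{UNIV}" and Cb = "range (\<lambda>n::nat. {- real n<..})"])
    show "sets borel = sigma_sets (space borel) (sets (borel :: 'a measure))"
      by (metis sets.sigma_sets_eq)
    show "sets borel = sigma_sets (space borel) (range (greaterThan :: real \<Rightarrow> real set))"
      by (subst borel_Ioi) simp
    have "\<exists>n::nat. - real n < x" for x :: real
      using reals_Archimedean2[of "- x"] by (metis minus_less_iff)
    then show "(\<Union>n::nat. {- real n<..}) = space borel" by auto
  qed auto
  then show ?thesis by (simp add: sets_measure_of)
qed

text \<open>The tails over \<open>A \<times> {c<..}\<close> identify \<open>N\<close> with the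
  product of \<open>\<nu>\<close> and the exponential law of rate \<open>l\<close>. Integrating the
  sections of \<open>G\<close> over \<open>0 < s \<le> h\<close> gives the bound, since that
  interval has mass \<open>1 - exp (- (l * h))\<close>.\<close>

lemma exponential_product_lower_bound:
  fixes N :: "('a::topological_space \<times> real) measure" and \<nu> :: "'a measure"
  assumes N: "sets N = sets (borel \<Otimes>\<^sub>M borel)" and \<nu>: "sets \<nu> = sets borel" "finite_measure \<nu>"
    and l: "0 < l" and tail: "\<And>A c. A \<in> sets borel \<Longrightarrow> emeasure N (A \<times> {c<..}) = ennreal (exp (- (l * max 0 c))) * emeasure \<nu> A"
    and G: "G \<in> sets (borel \<Otimes>\<^sub>M borel)" and h: "0 \<le> h"
    and m: "\<And>s. 0 < s \<Longrightarrow> s \<le> h \<Longrightarrow> m \<le> emeasure \<nu> {x. (x, s) \<in> G}"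
  shows "m * ennreal (1 - exp (- (l * h))) \<le> emeasure N G"
proof -
  define E where "E = density lborel (exponential_density l)"
  interpret E: prob_space E unfolding E_def by (rule prob_space_exponential_density[OF l])
  interpret \<nu>: finite_measure \<nu> by (rule \<nu>(2))
  interpret PE: pair_sigma_finite \<nu> E
    by (intro pair_sigma_finite.intro \<nu>.sigma_finite_measure_axioms E.sigma_finite_measure_axioms)
  have sE: "sets E = sets borel" by (simp add: E_def)
  have E_le: "emeasure E {..c} = ennreal (if 0 \<le> c then 1 - exp (- (l * c)) else 0)" for c
    unfolding E_def by (subst emeasure_erlang_density[OF l]) (simp add: erlang_CDF_0)
  have E_gt: "emeasure E {c<..} = ennreal (exp (- (l * max 0 c)))" for c
  proof -
    have "measure E {..c} = (if 0 \<le> c then 1 - exp (- (l * c)) else 0)"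
      using E_le[of c] l by (simp add: measure_def)
    moreover have "{c<..} = space E - {..c}" by (auto simp: E_def)
    ultimately have "measure E {c<..} = exp (- (l * max 0 c))"
      using E.prob_compl[of "{..c}"] sE by (auto simp: max_def)
    then show ?thesis by (simp add: E.emeasure_eq_measure)
  qed
  have "\<nu> \<Otimes>\<^sub>M E = N"
  proof (rule measure_eqI_generator_eq[where \<Omega> = UNIV and A = "\<lambda>n::nat. UNIV \<times> {- real n<..}"
        and E = "{A \<times> B | A B. A \<in> sets borel \<and> B \<in> range greaterThan}"])
    let ?E = "{A \<times> B | A B. A \<in> sets (borel :: 'a measure) \<and> B \<in> range (greaterThan :: real \<Rightarrow> real set)}"
    show "Int_stable ?E"
    proof (rule Int_stableI)
      fix X Y assume "X \<in> ?E" "Y \<in> ?E"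
      then obtain A a B b where "X = A \<times> {a<..}" "Y = B \<times> {b<..}" "A \<in> sets borel" "B \<in> sets borel" by auto
      moreover from this have "X \<inter> Y = (A \<inter> B) \<times> {max a b<..}" by auto
      ultimately show "X \<inter> Y \<in> ?E" by blast
    qed
    show "emeasure (\<nu> \<Otimes>\<^sub>M E) X = emeasure N X" if "X \<in> ?E" for X
    proof -
      from that obtain A c where X: "X = A \<times> {c<..}" "A \<in> sets borel" by auto
      then have "emeasure (\<nu> \<Otimes>\<^sub>M E) X = emeasure \<nu> A * emeasure E {c<..}"
        by (simp add: E.emeasure_pair_measure_Times \<nu> sE)
      then show ?thesis using tail[OF X(2)] X(1) E_gt by (simp add: mult.commute)
    qed
    show "sets (\<nu> \<Otimes>\<^sub>M E) = sigma_sets UNIV ?E"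
      using sets_pair_measure_cong[OF \<nu>(1) sE] by (simp add: sets_borel_pair_greaterThan)
    show "sets N = sigma_sets UNIV ?E" by (simp add: N sets_borel_pair_greaterThan)
    have "\<exists>n::nat. - real n < x" for x :: real
      using reals_Archimedean2[of "- x"] by (metis minus_less_iff)
    then show "(\<Union>n::nat. (UNIV :: 'a set) \<times> {- real n<..}) = UNIV" by auto
    show "range (\<lambda>n::nat. UNIV \<times> {- real n<..}) \<subseteq> ?E"
    proof clarify
      fix n :: nat
      show "\<exists>A B. UNIV \<times> {- real n<..} = A \<times> B \<and> A \<in> sets (borel :: 'a measure) \<and> B \<in> range greaterThan"
        by (intro exI[of _ UNIV] exI[of _ "{- real n<..}"]) simp
    qed
    show "emeasure (\<nu> \<Otimes>\<^sub>M E) (UNIV \<times> {- real n<..}) \<noteq> \<infinity>" for n :: nat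
      using \<nu>.emeasure_finite by (simp add: E.emeasure_pair_measure_Times \<nu> sE E_gt ennreal_mult_eq_top_iff)
  qed auto
  moreover have G': "G \<in> sets (\<nu> \<Otimes>\<^sub>M E)"
    using G sets_pair_measure_cong[OF \<nu>(1) sE] by simp
  ultimately have "emeasure N G = (\<integral>\<^sup>+ s. emeasure \<nu> ((\<lambda>x. (x, s)) -` G) \<partial>E)"
    using PE.emeasure_pair_measure_alt2[OF G'] by simp
  also have "\<dots> \<ge> (\<integral>\<^sup>+ s. m * indicator {0<..h} s \<partial>E)"
    using m by (intro nn_integral_mono) (auto simp: indicator_def vimage_def)
  also have "(\<integral>\<^sup>+ s. m * indicator {0<..h} s \<partial>E) = m * emeasure E {0<..h}"
    by (simp add: nn_integral_cmult_indicator sE)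
  also have "emeasure E {0<..h} = ennreal (1 - exp (- (l * h)))"
  proof -
    have "emeasure E {0<..h} = emeasure E {..h} - emeasure E {..0}"
      using h by (subst emeasure_Diff[symmetric]) (auto simp: sE intro!: arg_cong[of _ _ "emeasure E"])
    then show ?thesis using h by (simp add: E_le)
  qed
  finally show ?thesis .
qed

context flow_family
begin

text \<open>On a stretch with constant discrete state the integrand is continuous, so the integrated
  equation can be differentiated there. The interval is half-open because the state may already have
  changed at the jump time \<open>b\<close>.\<close>

lemma integral_path_flow:
  assumes int: "\<And>t. 0 \<le> t \<Longrightarrow> ((\<lambda>s. v (p s) (x s)) has_integral (x t - x 0)) {0..t}"
    and ab: "0 \<le> a" "a \<le> b" and p: "\<And>s. a \<le> s \<Longrightarrow> s < b \<Longrightarrow> p s = j"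
  shows "x b = \<phi> j (b - a) (x a)"
proof -
  let ?f = "\<lambda>s. v (p s) (x s)"
  have b: "0 \<le> b" using ab by simp
  have int_b: "?f integrable_on {0..b}" using int[OF b] by blast
  have x_eq: "x t = x 0 + integral {0..t} ?f" if "0 \<le> t" for t
    using integral_unique[OF int[OF that]] by simp
  have "continuous_on {0..b} (\<lambda>t. x 0 + integral {0..t} ?f)"
    by (intro continuous_intros indefinite_integral_continuous_1 int_b)
  then have x_cont: "continuous_on {0..b} x"
    by (rule continuous_on_eq) (simp add: x_eq[symmetric])
  have v_cont: "continuous_on UNIV (v j)" by (rule smooth_continuous[OF smooth_v])
  have der: "((\<lambda>s. x (a + s)) has_vector_derivative v j (x (a + s))) (at s)" if s: "0 < s" "s < b - a" for s
  proof -
    define t where "t = a + s"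
    have t: "a < t" "t < b" "t \<in> interior {0..b}" using s ab by (auto simp: t_def)
    have at_t: "at t within {0..b} = at t" by (rule at_within_interior[OF t(3)])
    have "isCont x t" using x_cont t(3) by (meson continuous_on_interior)
    then have "isCont (\<lambda>s. v j (x s)) t"
      using isCont_o2[of t x "v j"] v_cont by (auto simp: continuous_on_eq_continuous_at)
    moreover have "\<forall>\<^sub>F s in nhds t. v j (x s) = ?f s"
      using eventually_nhds_in_open[of "{a<..<b}" t] t p by (auto elim!: eventually_mono)
    ultimately have f_cont: "continuous (at t within {0..b} - {}) ?f"
      using isCont_cong[of "\<lambda>s. v j (x s)" ?f t] at_t by simp
    have "((\<lambda>u. integral {0..u} ?f) has_vector_derivative ?f t) (at t within {0..b} - {})"
      by (rule integral_has_vector_derivative_continuous_at[OF int_b _ _ f_cont]) (use t ab in auto)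
    then have "((\<lambda>u. x 0 + integral {0..u} ?f) has_vector_derivative v j (x t)) (at t)"
      using p[of t] t at_t by (auto intro!: derivative_eq_intros)
    then have "(x has_vector_derivative v j (x t)) (at t)"
      by (rule has_vector_derivative_transform_within_open[of _ _ _ "{a<..<b}"])
        (use t ab in \<open>auto simp: x_eq[symmetric]\<close>)
    then have "(x has_vector_derivative v j (x t)) (at (a + s))" by (simp add: t_def)
    moreover have "((\<lambda>s. a + s) has_vector_derivative 1) (at s)"
      by (auto intro!: derivative_eq_intros)
    ultimately show ?thesis
      using vector_diff_chain_at[of "\<lambda>s. a + s" 1 s x "v j (x t)"] by (simp add: o_def t_def)
  qed
  have "(\<lambda>s. x (a + s)) (b - a) = \<phi> j (b - a) ((\<lambda>s. x (a + s)) 0)"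
  proof (rule C1.flow_unique)
    show "continuous_on {0..b - a} (\<lambda>s. x (a + s))"
      by (rule continuous_on_compose2[OF x_cont]) (use ab in \<open>auto intro!: continuous_intros\<close>)
  qed (use ab der in auto)
  then show ?thesis by simp
qed

end

section \<open>Stationary processes and their occupation measures\<close>

locale stationary_pdmp = flow_family v \<phi>
  for v :: "'e::finite \<Rightarrow> real ^ 'd \<Rightarrow> real ^ 'd" and \<phi> :: "'e \<Rightarrow> real \<Rightarrow> real ^ 'd \<Rightarrow> real ^ 'd" +
  fixes M :: "(real ^ 'd) set" and Q :: "real ^ 'e ^ 'e" and P :: "'w measure"
    and X :: "real \<Rightarrow> 'w \<Rightarrow> real ^ 'd" and I :: "real \<Rightarrow> 'w \<Rightarrow> 'e" and \<pi> :: "((real ^ 'd) \<times> 'e) measure"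
  assumes compact_M: "compact M" and Q: "Q \<in> positive_rate_matrices"
    and stationary: "stationary_realisation P M v Q X I \<pi>"
begin

lemma pdmp: "is_pdmp P M v Q X I"
  using stationary by (simp add: stationary_realisation_def)

sublocale P: prob_space P
  using pdmp by (simp add: is_pdmp_def)

lemma XI_measurable: "0 \<le> t \<Longrightarrow> (\<lambda>\<omega>. (X t \<omega>, I t \<omega>)) \<in> P \<rightarrow>\<^sub>M state_space M"
  using pdmp by (simp add: is_pdmp_def)

lemma X_measurable: "0 \<le> t \<Longrightarrow> X t \<in> borel_measurable P"
  and X_in_M: "0 \<le> t \<Longrightarrow> \<omega> \<in> space P \<Longrightarrow> X t \<omega> \<in> M"
  and I_measurable: "0 \<le> t \<Longrightarrow> I t \<in> P \<rightarrow>\<^sub>M count_space UNIV"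
proof -
  assume t: "0 \<le> t"
  note m = XI_measurable[OF t, unfolded state_space_def]
  have "X t \<in> P \<rightarrow>\<^sub>M restrict_space borel M"
    using measurable_compose[OF m measurable_fst] by simp
  then show "X t \<in> borel_measurable P" "\<omega> \<in> space P \<Longrightarrow> X t \<omega> \<in> M"
    by (auto simp: measurable_restrict_space2_iff)
  show "I t \<in> P \<rightarrow>\<^sub>M count_space UNIV"
    using measurable_compose[OF m measurable_snd] by simp
qed

lemma event_XI [measurable]:
  assumes "0 \<le> t" "A \<in> sets borel"
  shows "{\<omega>\<in>space P. X t \<omega> \<in> A \<and> I t \<omega> = j} \<in> sets P"
proof -
  note [measurable] = X_measurable[OF assms(1)] I_measurable[OF assms(1)] assms(2)
  show ?thesis by measurable
qed

text \<open>The part of the stationary law in state \<open>j\<close>, not normalised and carried by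
  all Borel sets of the space rather than by subsets of \<open>M\<close>, so that preimages under
  flows need no intersection with \<open>M\<close>.\<close>

definition occ :: "'e \<Rightarrow> (real ^ 'd) measure" where
  "occ j = distr (density P (indicator {\<omega>\<in>space P. I 0 \<omega> = j})) borel (X 0)"

lemma sets_occ [simp, measurable_cong]: "sets (occ j) = sets borel"
  by (simp add: occ_def)

lemma space_occ [simp]: "space (occ j) = UNIV"
  by (simp add: occ_def)

lemma emeasure_occ_0:
  assumes A: "A \<in> sets borel"
  shows "emeasure (occ j) A = emeasure P {\<omega>\<in>space P. X 0 \<omega> \<in> A \<and> I 0 \<omega> = j}"
proof -
  note [measurable] = X_measurable[OF order.refl] I_measurable[OF order.refl] A
  have "emeasure (occ j) A = emeasure (density P (indicator {\<omega>\<in>space P. I 0 \<omega> = j})) (X 0 -` A \<inter> space P)"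
    unfolding occ_def by (subst emeasure_distr) auto
  also have "\<dots> = (\<integral>\<^sup>+ \<omega>. indicator {\<omega>\<in>space P. I 0 \<omega> = j} \<omega> * indicator (X 0 -` A \<inter> space P) \<omega> \<partial>P)"
    by (rule emeasure_density) measurable
  also have "\<dots> = (\<integral>\<^sup>+ \<omega>. indicator {\<omega>\<in>space P. X 0 \<omega> \<in> A \<and> I 0 \<omega> = j} \<omega> \<partial>P)"
    by (rule nn_integral_cong) (auto simp: indicator_def)
  also have "\<dots> = emeasure P {\<omega>\<in>space P. X 0 \<omega> \<in> A \<and> I 0 \<omega> = j}"
    by (rule nn_integral_indicator) measurable
  finally show ?thesis .
qed

lemma emeasure_\<pi>:
  assumes "0 \<le> t" and A: "A \<in> sets borel"
  shows "emeasure \<pi> ((A \<inter> M) \<times> {j}) = emeasure P {\<omega>\<in>space P. X t \<omega> \<in> A \<and> I t \<omega> = j}"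
proof -
  have "A \<inter> M \<in> sets (restrict_space borel M)"
    using A by (auto simp: sets_restrict_space)
  then have "(A \<inter> M) \<times> {j} \<in> sets (state_space M :: ((real ^ 'd) \<times> 'e) measure)"
    unfolding state_space_def by (intro pair_measureI) auto
  moreover have "\<pi> = distr P (state_space M) (\<lambda>\<omega>. (X t \<omega>, I t \<omega>))"
    using stationary assms(1) by (simp add: stationary_realisation_def)
  ultimately have "emeasure \<pi> ((A \<inter> M) \<times> {j}) = emeasure P ((\<lambda>\<omega>. (X t \<omega>, I t \<omega>)) -` ((A \<inter> M) \<times> {j}) \<inter> space P)"
    using XI_measurable[OF assms(1)] by (simp add: emeasure_distr)
  also have "(\<lambda>\<omega>. (X t \<omega>, I t \<omega>)) -` ((A \<inter> M) \<times> {j}) \<inter> space P = {\<omega>\<in>space P. X t \<omega> \<in> A \<and> I t \<omega> = j}"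
    using X_in_M[OF assms(1)] by auto
  finally show ?thesis .
qed

text \<open>Both sides are the mass of \<open>(A \<inter> M) \<times> {j}\<close> under
  \<open>\<pi>\<close>. An event started at time 0 and observed at time \<open>t\<close> thereby
  becomes an inequality between occupation measures.\<close>

lemma emeasure_occ:
  "0 \<le> t \<Longrightarrow> A \<in> sets borel \<Longrightarrow> emeasure (occ j) A = emeasure P {\<omega>\<in>space P. X t \<omega> \<in> A \<and> I t \<omega> = j}"
  using emeasure_\<pi>[of t A j] emeasure_\<pi>[of 0 A j] emeasure_occ_0 by simp

lemma emeasure_occ_\<pi>: "A \<in> sets borel \<Longrightarrow> emeasure (occ j) A = emeasure \<pi> ((A \<inter> M) \<times> {j})"
  using emeasure_\<pi>[of 0 A j] emeasure_occ_0 by simp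

lemma finite_measure_occ: "finite_measure (occ j)"
  by (rule finite_measureI) (simp add: emeasure_occ_0)

lemma emeasure_occ_Int_M: "A \<in> sets borel \<Longrightarrow> emeasure (occ j) (A \<inter> M) = emeasure (occ j) A"
  using compact_M by (simp add: emeasure_occ_\<pi> compact_imp_closed Int_assoc)

lemma Q_diag: "Q $ k $ k = - (\<Sum>j\<in>UNIV - {k}. Q $ k $ j)" and Q_off: "k \<noteq> j \<Longrightarrow> 0 < Q $ k $ j"
  using Q by (auto simp: positive_rate_matrices_def)

lemma Q_diag_neg: "k \<noteq> j \<Longrightarrow> Q $ k $ k < 0"
  unfolding Q_diag by (subst neg_less_0_iff_less, rule sum_pos2[of _ j]) (auto simp: Q_off less_imp_le)

lemma jump_prob_sum: "(\<Sum>j\<in>UNIV. jump_prob Q k j) = 1"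
proof (cases "Q $ k $ k = 0")
  case True
  then show ?thesis by (simp add: jump_prob_def)
next
  case False
  have "(\<Sum>j\<in>UNIV. jump_prob Q k j) = (\<Sum>j\<in>UNIV - {k}. jump_prob Q k j)"
    using False by (intro sum.mono_neutral_right) (auto simp: jump_prob_def)
  also have "\<dots> = (\<Sum>j\<in>UNIV - {k}. Q $ k $ j) / (- Q $ k $ k)"
    using False by (simp add: jump_prob_def sum_divide_distrib sum_negf)
  also have "\<dots> = 1" using False by (subst (asm) Q_diag, subst Q_diag) simp
  finally show ?thesis .
qed

lemma jump_prob_pos: "k \<noteq> j \<Longrightarrow> 0 < jump_prob Q k j"
  using Q_diag_neg[of k j] Q_off[of k j] by (auto simp: jump_prob_def divide_simps)

end

section \<open>Paths without a jump and with one jump\<close>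

locale stationary_pdmp_jumps = stationary_pdmp +
  fixes Y :: "nat \<Rightarrow> 'c \<Rightarrow> 'a" and S :: "nat \<Rightarrow> 'c \<Rightarrow> ennreal"
  assumes jumps: "jump_holding P Q (X 0) Y S"
    and path: "AE \<omega> in P. markov_chain_path (\<lambda>k. Y k \<omega>) (\<lambda>k. S k \<omega>) (\<lambda>t. I t \<omega>)"
begin

lemma Y_measurable [measurable]: "Y k \<in> P \<rightarrow>\<^sub>M count_space UNIV"
  and S_measurable [measurable]: "S k \<in> borel_measurable P"
  using jumps by (auto simp: jump_holding_def)

lemma X0_measurable [measurable]: "X 0 \<in> borel_measurable P"
  by (rule X_measurable) simp

lemma measure_jumps:
  assumes "A \<in> sets borel" "\<And>k. k < n \<Longrightarrow> 0 \<le> c k"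
  shows "measure P {\<omega> \<in> space P. X 0 \<omega> \<in> A \<and> (\<forall>k\<le>n. Y k \<omega> = y k) \<and> (\<forall>k<n. ennreal (c k) < S k \<omega>)} =
        measure P {\<omega> \<in> space P. X 0 \<omega> \<in> A \<and> Y 0 \<omega> = y 0} *
          (\<Prod>k<n. exp (Q $ y k $ y k * c k) * jump_prob Q (y k) (y (Suc k)))"
  using jumps assms by (simp add: jump_holding_def)

lemma measure_split:
  assumes "E \<in> sets P"
  shows "measure P E = (\<Sum>l\<in>UNIV. measure P {\<omega>\<in>E. Y n \<omega> = l})"
proof -
  have "measure P (\<Union>l\<in>UNIV. {\<omega>\<in>E. Y n \<omega> = l}) = (\<Sum>l\<in>UNIV. measure P {\<omega>\<in>E. Y n \<omega> = l})"
  proof (rule P.finite_measure_finite_Union)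
    have "{\<omega>\<in>E. Y n \<omega> = l} = E \<inter> {\<omega>\<in>space P. Y n \<omega> = l}" for l
      using sets.sets_into_space[OF assms] by auto
    moreover have "{\<omega>\<in>space P. Y n \<omega> = l} \<in> sets P" for l by measurable
    ultimately show "(\<lambda>l. {\<omega>\<in>E. Y n \<omega> = l}) ` UNIV \<subseteq> sets P" using assms by auto
  qed (auto simp: disjoint_family_on_def)
  moreover have "(\<Union>l\<in>UNIV. {\<omega>\<in>E. Y n \<omega> = l}) = E" by auto
  ultimately show ?thesis by simp
qed

text \<open>The defining formula for the jump chain also prescribes the state after the last holding
  time that it constrains. Summing over that state removes it, because jump probabilities add up to
  1.\<close>

lemma measure_first_holding:
  assumes A [measurable]: "A \<in> sets borel" and c: "0 \<le> c"
  shows "measure P {\<omega>\<in>space P. X 0 \<omega> \<in> A \<and> Y 0 \<omega> = k \<and> ennreal c < S 0 \<omega>} =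
    measure P {\<omega>\<in>space P. X 0 \<omega> \<in> A \<and> Y 0 \<omega> = k} * exp (Q $ k $ k * c)"
proof -
  let ?E = "{\<omega>\<in>space P. X 0 \<omega> \<in> A \<and> Y 0 \<omega> = k \<and> ennreal c < S 0 \<omega>}"
  have "measure P {\<omega>\<in>?E. Y 1 \<omega> = l} =
      measure P {\<omega>\<in>space P. X 0 \<omega> \<in> A \<and> Y 0 \<omega> = k} * exp (Q $ k $ k * c) * jump_prob Q k l" for l
  proof -
    have "{\<omega>\<in>?E. Y 1 \<omega> = l} = {\<omega> \<in> space P. X 0 \<omega> \<in> A \<and> (\<forall>i\<le>1. Y i \<omega> = (if i = 0 then k else l)) \<and>
        (\<forall>i<1. ennreal c < S i \<omega>)}"
      by (auto simp: le_Suc_eq)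
    then show ?thesis
      using measure_jumps[OF A, of 1 "\<lambda>_. c" "\<lambda>i. if i = 0 then k else l"] c by simp
  qed
  moreover have "?E \<in> sets P" by measurable
  ultimately show ?thesis
    using measure_split[of ?E 1] jump_prob_sum[of k] by (simp flip: sum_distrib_left)
qed

lemma measure_second_holding:
  assumes A [measurable]: "A \<in> sets borel" and c: "0 \<le> c" "0 \<le> h"
  shows "measure P {\<omega>\<in>space P. X 0 \<omega> \<in> A \<and> Y 0 \<omega> = k \<and> Y 1 \<omega> = j \<and> ennreal c < S 0 \<omega> \<and> ennreal h < S 1 \<omega>} =
    measure P {\<omega>\<in>space P. X 0 \<omega> \<in> A \<and> Y 0 \<omega> = k} * exp (Q $ k $ k * c) * (jump_prob Q k j * exp (Q $ j $ j * h))"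
proof -
  let ?E = "{\<omega>\<in>space P. X 0 \<omega> \<in> A \<and> Y 0 \<omega> = k \<and> Y 1 \<omega> = j \<and> ennreal c < S 0 \<omega> \<and> ennreal h < S 1 \<omega>}"
  let ?r = "measure P {\<omega>\<in>space P. X 0 \<omega> \<in> A \<and> Y 0 \<omega> = k} * exp (Q $ k $ k * c) * (jump_prob Q k j * exp (Q $ j $ j * h))"
  have "measure P {\<omega>\<in>?E. Y 2 \<omega> = l} = ?r * jump_prob Q j l" for l
  proof -
    let ?y = "\<lambda>i::nat. if i = 0 then k else if i = 1 then j else l"
    have "{\<omega>\<in>?E. Y 2 \<omega> = l} = {\<omega> \<in> space P. X 0 \<omega> \<in> A \<and> (\<forall>i\<le>2. Y i \<omega> = ?y i) \<and>
        (\<forall>i<2. ennreal (if i = 0 then c else h) < S i \<omega>)}"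
    proof -
      have "(\<forall>i\<le>2. Y i \<omega> = ?y i) \<longleftrightarrow> Y 0 \<omega> = k \<and> Y 1 \<omega> = j \<and> Y 2 \<omega> = l"
        "(\<forall>i<2. ennreal (if i = 0 then c else h) < S i \<omega>) \<longleftrightarrow> ennreal c < S 0 \<omega> \<and> ennreal h < S 1 \<omega>" for \<omega>
        by (simp_all add: numeral_2_eq_2 All_less_Suc2 less_Suc_eq_le[symmetric] del: less_Suc_eq_le)
      then show ?thesis by auto
    qed
    then show ?thesis
      using measure_jumps[OF A, of 2 "\<lambda>i. if i = 0 then c else h" ?y] c by (simp add: numeral_2_eq_2)
  qed
  moreover have "?E \<in> sets P" by measurable
  ultimately show ?thesis
    using measure_split[of ?E 2] jump_prob_sum[of j] by (simp flip: sum_distrib_left)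
qed

text \<open>The holding formula with \<open>c = 0\<close> loses no mass. It is wanted because
  \<open>markov_chain_path\<close> ties \<open>I 0\<close> to \<open>Y 0\<close> only if time 0 lies
  in the first holding interval.\<close>

lemma AE_first_holding_pos: "AE \<omega> in P. 0 < S 0 \<omega>"
proof -
  let ?E = "{\<omega>\<in>space P. 0 < S 0 \<omega>}"
  have E: "?E \<in> sets P" by measurable
  have "measure P {\<omega>\<in>?E. Y 0 \<omega> = k} = measure P {\<omega>\<in>space P. Y 0 \<omega> = k}" for k
  proof -
    have "{\<omega>\<in>?E. Y 0 \<omega> = k} = {\<omega>\<in>space P. X 0 \<omega> \<in> UNIV \<and> Y 0 \<omega> = k \<and> ennreal 0 < S 0 \<omega>}" by auto
    then show ?thesis using measure_first_holding[of UNIV 0 k] by simp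
  qed
  then have "measure P ?E = measure P (space P)"
    using measure_split[OF E, of 0] measure_split[of "space P" 0] by simp
  then have "emeasure P ?E = 1" by (simp add: P.prob_space P.emeasure_eq_measure)
  then show ?thesis by (rule P.AE_I_eq_1) (rule E)
qed

lemma AE_initial_state: "AE \<omega> in P. I 0 \<omega> = Y 0 \<omega>"
  using path AE_first_holding_pos
proof eventually_elim
  case (elim \<omega>)
  then show ?case
    unfolding markov_chain_path_def by (auto dest!: spec[of _ 0])
qed

lemma measure_initial:
  assumes [measurable]: "A \<in> sets borel"
  shows "measure P {\<omega>\<in>space P. X 0 \<omega> \<in> A \<and> Y 0 \<omega> = k} = measure (occ k) A"
proof -
  have [measurable]: "I 0 \<in> P \<rightarrow>\<^sub>M count_space UNIV" by (rule I_measurable) simp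
  have "measure P {\<omega>\<in>space P. X 0 \<omega> \<in> A \<and> Y 0 \<omega> = k} = measure P {\<omega>\<in>space P. X 0 \<omega> \<in> A \<and> I 0 \<omega> = k}"
    by (rule P.finite_measure_eq_AE) (use AE_initial_state in \<open>auto elim: eventually_mono\<close>)
  then show ?thesis by (simp add: measure_def emeasure_occ_0)
qed

lemma emeasure_event_eq:
  assumes "measure P E = r * measure (occ k) A" "0 \<le> r"
  shows "emeasure P E = ennreal r * emeasure (occ k) A"
proof -
  interpret occ: finite_measure "occ k" by (rule finite_measure_occ)
  show ?thesis using assms by (simp add: P.emeasure_eq_measure occ.emeasure_eq_measure ennreal_mult)
qed

text \<open>A second state makes the exit rate of \<open>k\<close> positive, so the tail at
  \<open>n\<close> tends to 0. This lets \<open>jump_law_tail\<close> discard infinite holding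
  times, which \<open>one_jump\<close> excludes.\<close>

lemma AE_first_holding_finite:
  assumes "k \<noteq> j"
  shows "AE \<omega> in P. Y 0 \<omega> = k \<longrightarrow> S 0 \<omega> < \<infinity>"
proof -
  let ?E = "{\<omega>\<in>space P. Y 0 \<omega> = k \<and> S 0 \<omega> = \<infinity>}"
  have E: "?E \<in> sets P" by measurable
  have "measure P ?E \<le> exp (Q $ k $ k * real n)" for n
  proof -
    have "measure P ?E \<le> measure P {\<omega>\<in>space P. X 0 \<omega> \<in> UNIV \<and> Y 0 \<omega> = k \<and> ennreal (real n) < S 0 \<omega>}"
      by (intro P.finite_measure_mono) (auto simp: less_top[symmetric])
    also have "\<dots> \<le> 1 * exp (Q $ k $ k * real n)"
      by (subst measure_first_holding) (auto intro!: mult_right_mono)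
    finally show ?thesis by simp
  qed
  moreover have "(\<lambda>n. exp (Q $ k $ k * real n)) \<longlonglongrightarrow> 0"
  proof -
    have "filterlim (\<lambda>n. Q $ k $ k * real n) at_bot sequentially"
      using Q_diag_neg[OF assms] by (intro filterlim_tendsto_neg_mult_at_bot[OF tendsto_const _ filterlim_real_sequentially])
    then show ?thesis by (rule filterlim_compose[OF exp_at_bot])
  qed
  ultimately have "measure P ?E \<le> 0"
    by (intro LIMSEQ_le_const[of "\<lambda>n. exp (Q $ k $ k * real n)"]) auto
  then have "measure P ?E = 0" by (simp add: measure_le_0_iff)
  then have "?E \<in> null_sets P" using E by (simp add: P.emeasure_eq_measure null_setsI)
  then show ?thesis by (rule AE_I') (auto simp: not_less top_unique)
qed

lemma AE_path_no_jump:
  assumes t: "0 \<le> t"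
  shows "AE \<omega> in P. Y 0 \<omega> = j \<and> ennreal t < S 0 \<omega> \<longrightarrow> X t \<omega> = \<phi> j t (X 0 \<omega>) \<and> I t \<omega> = j"
proof -
  have "AE \<omega> in P. \<forall>t\<ge>0. ((\<lambda>s. v (I s \<omega>) (X s \<omega>)) has_integral (X t \<omega> - X 0 \<omega>)) {0..t}"
    using pdmp by (simp add: is_pdmp_def)
  with path show ?thesis
  proof eventually_elim
    case (elim \<omega>)
    show ?case
    proof
      assume a: "Y 0 \<omega> = j \<and> ennreal t < S 0 \<omega>"
      have "I s \<omega> = j" if "0 \<le> s" "s \<le> t" for s
        using elim(1)[unfolded markov_chain_path_def, rule_format, OF that(1), of 0] a that
        by (auto intro: le_less_trans[OF ennreal_leI])
      moreover from this have "X t \<omega> = \<phi> j (t - 0) (X 0 \<omega>)"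
        using elim(2) t by (intro integral_path_flow[where p = "\<lambda>s. I s \<omega>" and x = "\<lambda>s. X s \<omega>"]) auto
      ultimately show "X t \<omega> = \<phi> j t (X 0 \<omega>) \<and> I t \<omega> = j" using t by simp
    qed
  qed
qed

text \<open>The path is split at the first holding time. On the second stretch the state is
  \<open>j\<close> up to time \<open>h\<close>, because \<open>S 1\<close> alone exceeds
  \<open>h\<close>.\<close>

lemma AE_path_one_jump:
  assumes h: "0 \<le> h"
  shows "AE \<omega> in P. Y 0 \<omega> = k \<and> Y 1 \<omega> = j \<and> S 0 \<omega> \<le> ennreal h \<and> ennreal h < S 1 \<omega> \<longrightarrow>
    X h \<omega> = \<phi> j (h - enn2real (S 0 \<omega>)) (\<phi> k (enn2real (S 0 \<omega>)) (X 0 \<omega>)) \<and> I h \<omega> = j"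
proof -
  have "AE \<omega> in P. \<forall>t\<ge>0. ((\<lambda>s. v (I s \<omega>) (X s \<omega>)) has_integral (X t \<omega> - X 0 \<omega>)) {0..t}"
    using pdmp by (simp add: is_pdmp_def)
  with path show ?thesis
  proof eventually_elim
    case (elim \<omega>)
    show ?case
    proof
      assume a: "Y 0 \<omega> = k \<and> Y 1 \<omega> = j \<and> S 0 \<omega> \<le> ennreal h \<and> ennreal h < S 1 \<omega>"
      define \<sigma> where "\<sigma> = enn2real (S 0 \<omega>)"
      have fin: "S 0 \<omega> \<noteq> \<top>" using a by (auto simp: top_unique)
      have \<sigma>: "S 0 \<omega> = ennreal \<sigma>" "0 \<le> \<sigma>" "\<sigma> \<le> h"
        using fin a h by (auto simp: \<sigma>_def less_top ennreal_enn2real_if enn2real_leI)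
      note p = elim(1)[unfolded markov_chain_path_def, rule_format]
      have 1: "I s \<omega> = k" if "0 \<le> s" "s < \<sigma>" for s
        using p[OF that(1), of 0] a that \<sigma> by (auto simp: ennreal_less_iff)
      have 2: "I s \<omega> = j" if "\<sigma> \<le> s" "s \<le> h" for s
      proof -
        have "ennreal s < S 1 \<omega>" using a that by (auto intro: le_less_trans[OF ennreal_leI])
        also have "\<dots> \<le> S 0 \<omega> + S 1 \<omega>" by simp
        finally show ?thesis
          using p[of s 1] a that \<sigma> by (auto intro: ennreal_leI)
      qed
      have "X \<sigma> \<omega> = \<phi> k (\<sigma> - 0) (X 0 \<omega>)"
        using elim(2) \<sigma> 1 by (intro integral_path_flow[where p = "\<lambda>s. I s \<omega>" and x = "\<lambda>s. X s \<omega>"]) auto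
      moreover have "X h \<omega> = \<phi> j (h - \<sigma>) (X \<sigma> \<omega>)"
        using elim(2) \<sigma> 2 by (intro integral_path_flow[where p = "\<lambda>s. I s \<omega>" and x = "\<lambda>s. X s \<omega>"]) auto
      ultimately show "X h \<omega> = \<phi> j (h - enn2real (S 0 \<omega>)) (\<phi> k (enn2real (S 0 \<omega>)) (X 0 \<omega>)) \<and> I h \<omega> = j"
        using 2[of h] \<sigma> by simp
    qed
  qed
qed

text \<open>Of all paths that are in \<open>B\<close> and in state \<open>j\<close> at time
  \<open>t\<close>, only those that started in \<open>A\<close> and did not jump are
  counted.\<close>

lemma holding_flow_bound:
  assumes t: "0 \<le> t" and A [measurable]: "A \<in> sets borel" and B [measurable]: "B \<in> sets borel" and AB: "\<phi> j t ` A \<subseteq> B"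
  shows "ennreal (exp (Q $ j $ j * t)) * emeasure (occ j) A \<le> emeasure (occ j) B"
proof -
  have "emeasure P {\<omega>\<in>space P. X 0 \<omega> \<in> A \<and> Y 0 \<omega> = j \<and> ennreal t < S 0 \<omega>} =
      ennreal (exp (Q $ j $ j * t)) * emeasure (occ j) A"
    using measure_first_holding[OF A t, of j] by (intro emeasure_event_eq) (simp_all add: measure_initial mult.commute)
  moreover have "emeasure P {\<omega>\<in>space P. X 0 \<omega> \<in> A \<and> Y 0 \<omega> = j \<and> ennreal t < S 0 \<omega>} \<le>
      emeasure P {\<omega>\<in>space P. X t \<omega> \<in> B \<and> I t \<omega> = j}"
  proof (rule emeasure_mono_AE)
    show "AE \<omega> in P. \<omega> \<in> {\<omega>\<in>space P. X 0 \<omega> \<in> A \<and> Y 0 \<omega> = j \<and> ennreal t < S 0 \<omega>} \<longrightarrow>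
        \<omega> \<in> {\<omega>\<in>space P. X t \<omega> \<in> B \<and> I t \<omega> = j}"
      using AE_path_no_jump[OF t, of j] by eventually_elim (use AB in auto)
  qed (rule event_XI[OF t B])
  ultimately show ?thesis by (simp add: emeasure_occ[OF t B])
qed

text \<open>Finiteness of \<open>S 0\<close> is part of the event because \<open>enn2real\<close>
  sends infinity to 0, which would look like an immediate jump. Asking \<open>S 1\<close> itself to
  exceed \<open>h\<close> loses some paths but keeps the probability in product form.\<close>

definition one_jump :: "real \<Rightarrow> 'a \<Rightarrow> 'a \<Rightarrow> 'c set" where
  "one_jump h k j = {\<omega>\<in>space P. Y 0 \<omega> = k \<and> Y 1 \<omega> = j \<and> S 0 \<omega> < \<infinity> \<and> ennreal h < S 1 \<omega>}"

lemma one_jump_event [measurable]: "one_jump h k j \<in> sets P"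
  unfolding one_jump_def by measurable

definition jump_law :: "real \<Rightarrow> 'a \<Rightarrow> 'a \<Rightarrow> ((real ^ 'b) \<times> real) measure" where
  "jump_law h k j = distr (density P (indicator (one_jump h k j))) (borel \<Otimes>\<^sub>M borel) (\<lambda>\<omega>. (X 0 \<omega>, enn2real (S 0 \<omega>)))"

lemma emeasure_jump_law:
  assumes G [measurable]: "G \<in> sets (borel \<Otimes>\<^sub>M borel)"
  shows "emeasure (jump_law h k j) G = emeasure P {\<omega>\<in>one_jump h k j. (X 0 \<omega>, enn2real (S 0 \<omega>)) \<in> G}"
proof -
  have f: "(\<lambda>\<omega>. (X 0 \<omega>, enn2real (S 0 \<omega>))) \<in> P \<rightarrow>\<^sub>M borel \<Otimes>\<^sub>M borel" by measurable
  have E: "(\<lambda>\<omega>. (X 0 \<omega>, enn2real (S 0 \<omega>))) -` G \<inter> space P \<in> sets P"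
    using measurable_sets[OF f G] .
  have "emeasure (jump_law h k j) G =
      emeasure (density P (indicator (one_jump h k j))) ((\<lambda>\<omega>. (X 0 \<omega>, enn2real (S 0 \<omega>))) -` G \<inter> space P)"
    unfolding jump_law_def using f by (subst emeasure_distr) auto
  also have "\<dots> = (\<integral>\<^sup>+ \<omega>. indicator (one_jump h k j) \<omega> * indicator ((\<lambda>\<omega>. (X 0 \<omega>, enn2real (S 0 \<omega>))) -` G \<inter> space P) \<omega> \<partial>P)"
    by (rule emeasure_density[OF _ E]) measurable
  also have "\<dots> = (\<integral>\<^sup>+ \<omega>. indicator (one_jump h k j \<inter> ((\<lambda>\<omega>. (X 0 \<omega>, enn2real (S 0 \<omega>))) -` G \<inter> space P)) \<omega> \<partial>P)"
    by (rule nn_integral_cong) (auto simp: indicator_def)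
  also have "\<dots> = emeasure P (one_jump h k j \<inter> ((\<lambda>\<omega>. (X 0 \<omega>, enn2real (S 0 \<omega>))) -` G \<inter> space P))"
    by (rule nn_integral_indicator) (intro sets.Int one_jump_event E)
  also have "one_jump h k j \<inter> ((\<lambda>\<omega>. (X 0 \<omega>, enn2real (S 0 \<omega>))) -` G \<inter> space P) =
      {\<omega>\<in>one_jump h k j. (X 0 \<omega>, enn2real (S 0 \<omega>)) \<in> G}"
    by (auto simp: one_jump_def)
  finally show ?thesis .
qed

text \<open>The start and the jump time are independent up to a constant, with an exponential time
  of rate \<open>- Q $ k $ k\<close>; this is the input of
  \<open>exponential_product_lower_bound\<close>. The maximum occurs since the generating half-lines
  include negative \<open>c\<close>.\<close>

lemma jump_law_tail:
  assumes kj: "k \<noteq> j" and h: "0 \<le> h" and A [measurable]: "A \<in> sets borel"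
  shows "emeasure (jump_law h k j) (A \<times> {c<..}) =
    ennreal (exp (- ((- Q $ k $ k) * max 0 c))) * (ennreal (jump_prob Q k j * exp (Q $ j $ j * h)) * emeasure (occ k) A)"
proof -
  let ?c = "max 0 c" and ?r = "jump_prob Q k j * exp (Q $ j $ j * h)"
  have r: "0 \<le> ?r" using jump_prob_pos[OF kj] by simp
  let ?E = "{\<omega>\<in>space P. X 0 \<omega> \<in> A \<and> Y 0 \<omega> = k \<and> Y 1 \<omega> = j \<and> ennreal ?c < S 0 \<omega> \<and> ennreal h < S 1 \<omega>}"
  have "emeasure (jump_law h k j) (A \<times> {c<..}) = emeasure P {\<omega>\<in>one_jump h k j. (X 0 \<omega>, enn2real (S 0 \<omega>)) \<in> A \<times> {c<..}}"
    by (rule emeasure_jump_law) simp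
  also have "\<dots> = emeasure P ?E"
  proof (rule emeasure_eq_AE)
    show "AE \<omega> in P. \<omega> \<in> {\<omega>\<in>one_jump h k j. (X 0 \<omega>, enn2real (S 0 \<omega>)) \<in> A \<times> {c<..}} \<longleftrightarrow> \<omega> \<in> ?E"
      using AE_first_holding_pos AE_first_holding_finite[OF kj]
    proof eventually_elim
      case (elim \<omega>)
      have "c < enn2real s \<longleftrightarrow> ennreal ?c < s" if "0 < s" "s < \<infinity>" for s :: ennreal
        using that by (cases s) (auto simp: ennreal_less_iff max_def)
      then show ?case using elim by (auto simp: one_jump_def)
    qed
    show "{\<omega>\<in>one_jump h k j. (X 0 \<omega>, enn2real (S 0 \<omega>)) \<in> A \<times> {c<..}} \<in> sets P"
      unfolding one_jump_def mem_Times_iff by measurable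
    show "?E \<in> sets P" by measurable
  qed
  also have "\<dots> = ennreal (exp (Q $ k $ k * ?c) * ?r) * emeasure (occ k) A"
    using measure_second_holding[OF A _ h, of ?c k j] less_imp_le[OF jump_prob_pos[OF kj]]
    by (intro emeasure_event_eq) (simp_all add: measure_initial mult.commute mult.left_commute)
  finally show ?thesis using r by (simp add: ennreal_mult mult.assoc)
qed

text \<open>Two events lead to \<open>B\<close> in state \<open>j\<close> at time \<open>h\<close>:
  staying in \<open>j\<close> from a start in \<open>A\<close>, and one jump from \<open>k\<close>
  to \<open>j\<close>. They are disjoint because they start in different states, so their masses add
  up.\<close>

lemma one_jump_flow_bound:
  assumes kj: "k \<noteq> j" and h: "0 \<le> h" and A [measurable]: "A \<in> sets borel" and B [measurable]: "B \<in> sets borel"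
    and AB: "\<phi> j h ` A \<subseteq> B"
    and m: "\<And>s. 0 < s \<Longrightarrow> s \<le> h \<Longrightarrow> m \<le> emeasure (occ k) {x. \<phi> j (h - s) (\<phi> k s x) \<in> B}"
  shows "ennreal (exp (Q $ j $ j * h)) * emeasure (occ j) A +
      ennreal (jump_prob Q k j * exp (Q $ j $ j * h) * (1 - exp (Q $ k $ k * h))) * m \<le> emeasure (occ j) B"
proof -
  let ?r = "jump_prob Q k j * exp (Q $ j $ j * h)"
  have r: "0 \<le> ?r" using jump_prob_pos[OF kj] by simp
  have q: "0 < - Q $ k $ k" using Q_diag_neg[OF kj] by simp
  \<comment> \<open>Starts and jump times from which the one-jump path ends in \<open>B\<close>;
    \<open>s \<le> h\<close> ensures that the jump has happened by time \<open>h\<close>.\<close>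
  define G where "G = {(x, s). s \<le> h \<and> \<phi> j (h - s) (\<phi> k s x) \<in> B}"
  have G: "G \<in> sets (borel \<Otimes>\<^sub>M borel)"
  proof -
    have "continuous_on UNIV (\<lambda>p :: (real ^ 'b) \<times> real. \<phi> j (h - snd p) (\<phi> k (snd p) (fst p)))"
      by (intro C1.flow_cont_compose continuous_intros)
    then have [measurable]: "(\<lambda>p :: (real ^ 'b) \<times> real. \<phi> j (h - snd p) (\<phi> k (snd p) (fst p))) \<in> borel_measurable borel"
      by (rule borel_measurable_continuous_onI)
    have [measurable]: "(snd :: (real ^ 'b) \<times> real \<Rightarrow> real) \<in> borel_measurable borel"
      by (intro borel_measurable_continuous_onI continuous_intros)
    have "G = {p \<in> space borel. snd p \<le> h \<and> \<phi> j (h - snd p) (\<phi> k (snd p) (fst p)) \<in> B}"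
      by (auto simp: G_def)
    also have "\<dots> \<in> sets borel" by measurable
    finally show ?thesis by (subst borel_prod)
  qed
  define \<nu> where "\<nu> = scale_measure (ennreal ?r) (occ k)"
  have "ennreal ?r * m * ennreal (1 - exp (- ((- Q $ k $ k) * h))) \<le> emeasure (jump_law h k j) G"
  proof (rule exponential_product_lower_bound[where \<nu> = \<nu>])
    show "sets (jump_law h k j) = sets (borel \<Otimes>\<^sub>M borel)" by (simp add: jump_law_def)
    show "finite_measure \<nu>"
      using finite_measure.emeasure_finite[OF finite_measure_occ, of k UNIV]
      by (intro finite_measureI) (auto simp: \<nu>_def ennreal_mult_eq_top_iff space_scale_measure)
    show "ennreal ?r * m \<le> emeasure \<nu> {x. (x, s) \<in> G}" if "0 < s" "s \<le> h" for s
      using m[OF that] that by (auto simp: \<nu>_def G_def intro!: mult_left_mono)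
  qed (use q h G jump_law_tail[OF kj h] in \<open>auto simp: \<nu>_def\<close>)
  also have "\<dots> = emeasure P {\<omega>\<in>one_jump h k j. (X 0 \<omega>, enn2real (S 0 \<omega>)) \<in> G}"
    by (rule emeasure_jump_law[OF G])
  finally have E2: "ennreal ?r * m * ennreal (1 - exp (Q $ k $ k * h)) \<le>
      emeasure P {\<omega>\<in>one_jump h k j. (X 0 \<omega>, enn2real (S 0 \<omega>)) \<in> G}" by simp
  let ?E1 = "{\<omega>\<in>space P. X 0 \<omega> \<in> A \<and> Y 0 \<omega> = j \<and> ennreal h < S 0 \<omega>}"
  let ?E2 = "{\<omega>\<in>one_jump h k j. (X 0 \<omega>, enn2real (S 0 \<omega>)) \<in> G}"
  have E1: "emeasure P ?E1 = ennreal (exp (Q $ j $ j * h)) * emeasure (occ j) A"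
    using measure_first_holding[OF A h, of j] by (intro emeasure_event_eq) (simp_all add: measure_initial mult.commute)
  have "?E2 = one_jump h k j \<inter> ((\<lambda>\<omega>. (X 0 \<omega>, enn2real (S 0 \<omega>))) -` G \<inter> space P)"
    by (auto simp: one_jump_def)
  moreover have "(\<lambda>\<omega>. (X 0 \<omega>, enn2real (S 0 \<omega>))) -` G \<inter> space P \<in> sets P"
    by (rule measurable_sets[OF _ G]) measurable
  ultimately have E2_sets: "?E2 \<in> sets P" by simp
  have E1_sets: "?E1 \<in> sets P" by measurable
  have "emeasure P ?E1 + emeasure P ?E2 = emeasure P (?E1 \<union> ?E2)"
    using kj by (intro plus_emeasure E1_sets E2_sets) (auto simp: one_jump_def)
  also have "\<dots> \<le> emeasure P {\<omega>\<in>space P. X h \<omega> \<in> B \<and> I h \<omega> = j}"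
  proof (rule emeasure_mono_AE)
    show "AE \<omega> in P. \<omega> \<in> ?E1 \<union> ?E2 \<longrightarrow> \<omega> \<in> {\<omega>\<in>space P. X h \<omega> \<in> B \<and> I h \<omega> = j}"
      using AE_path_no_jump[OF h, of j] AE_path_one_jump[OF h, of k j]
    proof eventually_elim
      case (elim \<omega>)
      have "S 0 \<omega> \<le> ennreal h" if "enn2real (S 0 \<omega>) \<le> h" "S 0 \<omega> < \<infinity>"
        using that by (cases "S 0 \<omega>") (auto intro: ennreal_leI)
      then show ?case using elim AB by (auto simp: one_jump_def G_def)
    qed
  qed (rule event_XI[OF h B])
  also have "\<dots> = emeasure (occ j) B" by (rule emeasure_occ[OF h B, symmetric])
  finally have le: "emeasure P ?E1 + emeasure P ?E2 \<le> emeasure (occ j) B" .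
  have "0 \<le> 1 - exp (Q $ k $ k * h)" using q h by (simp add: mult_nonpos_nonneg)
  then have "ennreal (?r * (1 - exp (Q $ k $ k * h))) * m = ennreal ?r * m * ennreal (1 - exp (Q $ k $ k * h))"
    by (subst ennreal_mult[OF r]) (simp_all only: mult.assoc mult.commute[of m])
  with add_left_mono[OF E2, of "emeasure P ?E1"] le E1 show ?thesis
    by (simp only: order.trans)
qed

end

lemma (in stationary_pdmp) ex_jumps: "\<exists>Y S. stationary_pdmp_jumps v \<phi> M Q P X I \<pi> Y S"
proof -
  obtain Y S where "jump_holding P Q (X 0) Y S"
    "AE \<omega> in P. markov_chain_path (\<lambda>k. Y k \<omega>) (\<lambda>k. S k \<omega>) (\<lambda>t. I t \<omega>)"
    using pdmp by (auto simp: is_pdmp_def)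
  then have "stationary_pdmp_jumps v \<phi> M Q P X I \<pi> Y S"
    by unfold_locales
  then show ?thesis by blast
qed

context stationary_pdmp
begin

lemma occ_flow:
  assumes "0 \<le> t" "A \<in> sets borel" "B \<in> sets borel" "\<phi> j t ` A \<subseteq> B"
  shows "ennreal (exp (Q $ j $ j * t)) * emeasure (occ j) A \<le> emeasure (occ j) B"
proof -
  obtain Y S where "stationary_pdmp_jumps v \<phi> M Q P X I \<pi> Y S" using ex_jumps by blast
  then interpret stationary_pdmp_jumps v \<phi> M Q P X I \<pi> Y S .
  show ?thesis by (rule holding_flow_bound[OF assms])
qed

lemma occ_flow_jump:
  assumes "k \<noteq> j" "0 \<le> h" "A \<in> sets borel" "B \<in> sets borel" "\<phi> j h ` A \<subseteq> B"
    and "\<And>s. 0 < s \<Longrightarrow> s \<le> h \<Longrightarrow> m \<le> emeasure (occ k) {x. \<phi> j (h - s) (\<phi> k s x) \<in> B}"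
  shows "ennreal (exp (Q $ j $ j * h)) * emeasure (occ j) A +
      ennreal (jump_prob Q k j * exp (Q $ j $ j * h) * (1 - exp (Q $ k $ k * h))) * m \<le> emeasure (occ j) B"
proof -
  obtain Y S where "stationary_pdmp_jumps v \<phi> M Q P X I \<pi> Y S" using ex_jumps by blast
  then interpret stationary_pdmp_jumps v \<phi> M Q P X I \<pi> Y S .
  show ?thesis by (rule one_jump_flow_bound[OF assms])
qed

end

section \<open>Regions of positive density\<close>

locale invariant_pdmp = stationary_pdmp +
  assumes invariant_M: "forward_invariant \<phi> M"
begin

lemma flow_in_M: "x \<in> M \<Longrightarrow> 0 \<le> t \<Longrightarrow> \<phi> j t x \<in> M"
  using invariant_M by (simp add: forward_invariant_def)

definition div_v :: "'a \<Rightarrow> real ^ 'b \<Rightarrow> real" where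
  "div_v j x = trace (matrix (v' j x))"

lemma div_v_cont: "continuous_on UNIV (div_v j)"
proof -
  have "continuous_on UNIV (\<lambda>x. v' j x (axis i 1) $ i)" for i
    by (intro continuous_intros blinfun.continuous_on C1.v'_cont)
  then show ?thesis
    unfolding div_v_def[abs_def] trace_def matrix_def by (simp add: continuous_on_sum)
qed

lemma div_v_bound: "\<exists>a\<ge>0. \<forall>j. \<forall>x\<in>M. div_v j x \<le> a"
proof -
  have "\<exists>a. \<forall>x\<in>M. div_v j x \<le> a" for j
  proof -
    have "compact (div_v j ` M)"
      by (rule compact_continuous_image[OF continuous_on_subset[OF div_v_cont subset_UNIV] compact_M])
    then have "bdd_above (div_v j ` M)" by (intro bounded_imp_bdd_above compact_imp_bounded)
    then show ?thesis by (auto simp: bdd_above_def)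
  qed
  then obtain a where a: "\<And>j x. x \<in> M \<Longrightarrow> div_v j x \<le> a j" by metis
  show ?thesis
  proof (intro exI[of _ "Max (insert 0 (range a))"] conjI allI ballI)
    fix j x assume "x \<in> M"
    then have "div_v j x \<le> a j" by (rule a)
    also have "\<dots> \<le> Max (insert 0 (range a))" by (intro Max_ge) auto
    finally show "div_v j x \<le> Max (insert 0 (range a))" .
  qed (intro Max_ge, auto)
qed

text \<open>Mass found in \<open>B\<close> at time \<open>t\<close> started in the preimage of
  \<open>B\<close>, so the forward volume estimate is needed as a lower bound for preimages.\<close>

lemma lborel_flow_vimage:
  assumes B: "B \<in> sets borel" and bd: "bounded (\<phi> j t -` B)" and t: "0 \<le> t"
    and div: "\<And>x u. \<phi> j t x \<in> B \<Longrightarrow> 0 \<le> u \<Longrightarrow> u \<le> t \<Longrightarrow> div_v j (\<phi> j u x) \<le> a"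
  shows "ennreal (exp (- (a * t))) * emeasure lborel B \<le> emeasure lborel (\<phi> j t -` B)"
proof -
  have "emeasure lborel (\<phi> j t ` (\<phi> j t -` B)) \<le> ennreal (exp (a * t)) * emeasure lborel (\<phi> j t -` B)"
    by (rule C1.emeasure_flow_image[OF C1.flow_vimage_borel[OF B] bd t]) (use div in \<open>auto simp: div_v_def\<close>)
  then have "ennreal (exp (- (a * t))) * emeasure lborel B \<le>
      ennreal (exp (- (a * t))) * (ennreal (exp (a * t)) * emeasure lborel (\<phi> j t -` B))"
    by (simp add: C1.flow_image vimage_def mult_left_mono)
  also have "\<dots> = emeasure lborel (\<phi> j t -` B)"
    by (simp add: mult.assoc[symmetric] exp_minus_inverse flip: ennreal_mult exp_add)
  finally show ?thesis .
qed

text \<open>The density in state \<open>j\<close> is at least \<open>c\<close> on \<open>U\<close>,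
  expressed through the measure so that no version has to be chosen.\<close>

definition dominates :: "'a \<Rightarrow> (real ^ 'b) set \<Rightarrow> real \<Rightarrow> bool" where
  "dominates j U c \<longleftrightarrow> (\<forall>B\<in>sets borel. B \<subseteq> U \<longrightarrow> ennreal c * emeasure lborel B \<le> emeasure (occ j) B)"

lemma dominates_mono: "dominates j U c \<Longrightarrow> V \<subseteq> U \<Longrightarrow> d \<le> c \<Longrightarrow> dominates j V d"
  unfolding dominates_def by (meson ennreal_leI mult_right_mono order_trans subset_trans zero_le)

lemma dominates_Un:
  assumes "dominates j U c" "dominates j V c" "open U"
  shows "dominates j (U \<union> V) c"
  unfolding dominates_def
proof (intro ballI impI)
  fix B assume B: "B \<in> sets borel" "B \<subseteq> U \<union> V"
  have s: "B \<inter> U \<in> sets borel" "B - U \<in> sets borel" using B assms(3) by auto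
  have split: "emeasure \<mu> (B \<inter> U) + emeasure \<mu> (B - U) = emeasure \<mu> B" if "sets \<mu> = sets borel" for \<mu>
    using s that by (subst plus_emeasure) (auto intro!: arg_cong[of _ _ "emeasure \<mu>"])
  have "ennreal c * emeasure lborel B = ennreal c * emeasure lborel (B \<inter> U) + ennreal c * emeasure lborel (B - U)"
    using split[of lborel] by (simp flip: distrib_left)
  also have "\<dots> \<le> emeasure (occ j) (B \<inter> U) + emeasure (occ j) (B - U)"
  proof (rule add_mono)
    show "ennreal c * emeasure lborel (B \<inter> U) \<le> emeasure (occ j) (B \<inter> U)"
      using assms(1) s(1) by (simp add: dominates_def)
    have "B - U \<subseteq> V" using B(2) by blast
    then show "ennreal c * emeasure lborel (B - U) \<le> emeasure (occ j) (B - U)"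
      using assms(2) s(2) by (simp add: dominates_def)
  qed
  also have "\<dots> = emeasure (occ j) B" by (rule split) simp
  finally show "ennreal c * emeasure lborel B \<le> emeasure (occ j) B" .
qed

text \<open>The points called \<open>O\<close> in the overview; by \<open>good_jump\<close> they do
  not depend on \<open>j\<close>. Requiring \<open>U \<subseteq> M\<close> makes the divergence
  bound on \<open>M\<close> available.\<close>

definition good :: "'a \<Rightarrow> real ^ 'b \<Rightarrow> bool" where
  "good j x \<longleftrightarrow> (\<exists>c>0. \<exists>U. open U \<and> x \<in> U \<and> U \<subseteq> M \<and> dominates j U c)"

lemma goodI: "0 < c \<Longrightarrow> open U \<Longrightarrow> x \<in> U \<Longrightarrow> U \<subseteq> M \<Longrightarrow> dominates j U c \<Longrightarrow> good j x"
  unfolding good_def by blast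

lemma bounded_M: "bounded M"
  by (rule compact_imp_bounded[OF compact_M])

lemma good_flow:
  assumes "good j x" and t: "0 \<le> t"
  shows "good j (\<phi> j t x)"
proof -
  from assms(1) obtain c U where c: "c > 0" and U: "open U" "x \<in> U" "U \<subseteq> M" and dom: "dominates j U c"
    by (auto simp: good_def)
  obtain a where a: "a \<ge> 0" "\<And>j x. x \<in> M \<Longrightarrow> div_v j x \<le> a" using div_v_bound by blast
  have sub: "\<phi> j (- t) -` U \<subseteq> M"
  proof
    fix y assume "y \<in> \<phi> j (- t) -` U"
    then show "y \<in> M" using flow_in_M[OF _ t, of "\<phi> j (- t) y" j] U(3) by auto
  qed
  show ?thesis
  proof (rule goodI)
    \<comment> \<open>\<open>exp (Q $ j $ j * t)\<close> is the probability of not jumping,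
      \<open>c\<close> the old density bound and \<open>exp (- (a * t))\<close> the worst loss of
      volume under pullback, as the divergence is at most \<open>a\<close> on
      \<open>M\<close>.\<close>
    show "dominates j (\<phi> j (- t) -` U) (exp (Q $ j $ j * t) * (c * exp (- (a * t))))"
      unfolding dominates_def
    proof (intro ballI impI)
      fix B assume B: "B \<in> sets borel" "B \<subseteq> \<phi> j (- t) -` U"
      let ?A = "\<phi> j t -` B"
      have AU: "?A \<subseteq> U"
      proof
        fix y assume "y \<in> ?A"
        then have "\<phi> j (- t) (\<phi> j t y) \<in> U" using B(2) by auto
        then show "y \<in> U" by simp
      qed
      then have AM: "?A \<subseteq> M" using U(3) by blast
      have "ennreal (exp (- (a * t))) * emeasure lborel B \<le> emeasure lborel ?A"
        by (rule lborel_flow_vimage[OF B(1) bounded_subset[OF bounded_M AM] t])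
          (use AM in \<open>auto intro!: a(2) flow_in_M\<close>)
      then have "ennreal c * (ennreal (exp (- (a * t))) * emeasure lborel B) \<le> ennreal c * emeasure lborel ?A"
        by (rule mult_left_mono) simp
      also have "\<dots> \<le> emeasure (occ j) ?A"
        using dom C1.flow_vimage_borel[OF B(1)] AU by (auto simp: dominates_def)
      finally have "ennreal (exp (Q $ j $ j * t)) * (ennreal c * (ennreal (exp (- (a * t))) * emeasure lborel B)) \<le>
          ennreal (exp (Q $ j $ j * t)) * emeasure (occ j) ?A"
        by (rule mult_left_mono) simp
      also have "\<dots> \<le> emeasure (occ j) B"
        by (rule occ_flow[OF t C1.flow_vimage_borel[OF B(1)] B(1)]) auto
      finally show "ennreal (exp (Q $ j $ j * t) * (c * exp (- (a * t)))) * emeasure lborel B \<le> emeasure (occ j) B"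
        using c by (simp add: ennreal_mult mult.assoc)
    qed
    show "0 < exp (Q $ j $ j * t) * (c * exp (- (a * t)))" using c by simp
  qed (use U sub C1.flow_vimage_open in auto)
qed

lemma flow_flow_dist:
  assumes "0 < e"
  shows "\<exists>h>0. \<forall>r x. 0 \<le> r \<longrightarrow> r \<le> h \<longrightarrow> dist x (\<phi> j (h - r) (\<phi> k r x)) < e"
proof -
  define s where "s = C1.speed j + C1.speed k + 1"
  have s: "s > 0" using C1.speed(1)[of j] C1.speed(1)[of k] by (simp add: s_def)
  define h where "h = e / s"
  have h: "h > 0" "s * h = e" using assms s by (auto simp: h_def)
  have "dist x (\<phi> j (h - r) (\<phi> k r x)) < e" if r: "0 \<le> r" "r \<le> h" for r x
  proof -
    have "norm (\<phi> j (h - r) (\<phi> k r x) - \<phi> k r x) \<le> C1.speed j * h"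
      using C1.flow_dist[of j "h - r" "\<phi> k r x"] r C1.speed(1)[of j] mult_left_mono[of "h - r" h "C1.speed j"] by simp
    moreover have "norm (\<phi> k r x - x) \<le> C1.speed k * h"
      using C1.flow_dist[of k r x] r C1.speed(1)[of k] mult_left_mono[of r h "C1.speed k"] by simp
    moreover have "C1.speed j * h + C1.speed k * h < e"
      using h by (simp add: s_def algebra_simps)
    ultimately show ?thesis
      using norm_triangle_ineq[of "\<phi> j (h - r) (\<phi> k r x) - \<phi> k r x" "\<phi> k r x - x"]
      by (simp add: dist_norm norm_minus_commute)
  qed
  then show ?thesis using h(1) by blast
qed

text \<open>The source term: jumps from \<open>k\<close> within time \<open>h\<close> feed state
  \<open>j\<close> with a density at least \<open>c'\<close> near \<open>Z\<close>. The same
  \<open>h\<close> and \<open>c'\<close> serve all \<open>A\<close> and \<open>B\<close>, so the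
  inequality can be iterated.\<close>

lemma jump_gain:
  assumes Z: "compact Z" "Z \<subseteq> U" and U: "open U" "U \<subseteq> M" and c: "0 < c" and dom: "dominates k U c" and kj: "k \<noteq> j"
  shows "\<exists>h>0. \<exists>c'>0. \<exists>U'. open U' \<and> Z \<subseteq> U' \<and> U' \<subseteq> U \<and>
    (\<forall>A B. A \<in> sets borel \<longrightarrow> B \<in> sets borel \<longrightarrow> B \<subseteq> U' \<longrightarrow> \<phi> j h ` A \<subseteq> B \<longrightarrow>
      ennreal (exp (Q $ j $ j * h)) * emeasure (occ j) A + ennreal c' * emeasure lborel B \<le> emeasure (occ j) B)"
proof -
  obtain a where a: "a \<ge> 0" "\<And>j x. x \<in> M \<Longrightarrow> div_v j x \<le> a" using div_v_bound by blast
  obtain e where e: "e > 0" "(\<Union>x\<in>Z. ball x e) \<subseteq> U"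
    using compact_subset_open_imp_ball_epsilon_subset[OF Z(1) U(1) Z(2)] by blast
  obtain h where h: "h > 0" "\<And>r x. 0 \<le> r \<Longrightarrow> r \<le> h \<Longrightarrow> dist x (\<phi> j (h - r) (\<phi> k r x)) < e / 2"
    using flow_flow_dist[of "e / 2" j k] e(1) by auto
  \<comment> \<open>A path of duration \<open>h\<close> moves points by less than
    \<open>e / 2\<close>, so starting points of paths that end in \<open>U'\<close> lie within
    \<open>e\<close> of \<open>Z\<close>, hence in \<open>U\<close>.\<close>
  define U' where "U' = (\<Union>x\<in>Z. ball x (e / 2))"
  define \<kappa> where "\<kappa> = jump_prob Q k j * exp (Q $ j $ j * h) * (1 - exp (Q $ k $ k * h))"
  have \<kappa>: "\<kappa> > 0"
    unfolding \<kappa>_def using jump_prob_pos[OF kj] Q_diag_neg[OF kj] h by (simp add: mult_neg_pos)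
  define c' where "c' = \<kappa> * (c * exp (- (a * h)))"
  have c': "c' > 0" using \<kappa> c by (simp add: c'_def)
  have "open U'" "Z \<subseteq> U'" using e by (auto simp: U'_def)
  moreover have "U' \<subseteq> U"
  proof -
    have "ball x (e / 2) \<subseteq> ball x e" for x :: "real ^ 'b" using e by (intro subset_ball) simp
    then show ?thesis using e(2) unfolding U'_def by blast
  qed
  moreover have "ennreal (exp (Q $ j $ j * h)) * emeasure (occ j) A + ennreal c' * emeasure lborel B \<le> emeasure (occ j) B"
    if A: "A \<in> sets borel" and B: "B \<in> sets borel" "B \<subseteq> U'" and AB: "\<phi> j h ` A \<subseteq> B" for A B
  proof -
    have "ennreal (exp (Q $ j $ j * h)) * emeasure (occ j) A +
        ennreal \<kappa> * (ennreal (c * exp (- (a * h))) * emeasure lborel B) \<le> emeasure (occ j) B"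
      unfolding \<kappa>_def
    proof (rule occ_flow_jump[OF kj less_imp_le[OF h(1)] A B(1) AB])
      fix r assume r: "0 < r" "r \<le> h"
      let ?B1 = "\<phi> j (h - r) -` B" and ?A = "{x. \<phi> j (h - r) (\<phi> k r x) \<in> B}"
      have A_eq: "?A = \<phi> k r -` ?B1" by auto
      have AU: "?A \<subseteq> U"
      proof
        fix x assume "x \<in> ?A"
        then obtain z where z: "z \<in> Z" "dist z (\<phi> j (h - r) (\<phi> k r x)) < e / 2"
          using B(2) by (auto simp: U'_def)
        have "dist z x < e"
          using z(2) h(2)[of r x] r dist_triangle[of z x "\<phi> j (h - r) (\<phi> k r x)"] by (simp add: dist_commute)
        then have "x \<in> (\<Union>x\<in>Z. ball x e)" using z(1) by auto
        then show "x \<in> U" using e(2) by blast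
      qed
      have B1: "?B1 \<in> sets borel" by (rule C1.flow_vimage_borel[OF B(1)])
      have AM: "?A \<subseteq> M" using AU U(2) by blast
      have B1M: "?B1 \<subseteq> M"
      proof
        fix y assume "y \<in> ?B1"
        then have "\<phi> k (- r) y \<in> ?A" by simp
        then have "\<phi> k (- r) y \<in> ?A" by simp
        then have "\<phi> k (- r) y \<in> M" using AM by blast
        from flow_in_M[OF this less_imp_le[OF r(1)], of k] show "y \<in> M" by simp
      qed
      have "ennreal (exp (- (a * r))) * (ennreal (exp (- (a * (h - r)))) * emeasure lborel B) \<le>
          ennreal (exp (- (a * r))) * emeasure lborel ?B1"
        by (intro mult_left_mono lborel_flow_vimage[OF B(1) bounded_subset[OF bounded_M B1M]])
          (use B1M r in \<open>auto intro!: a(2) flow_in_M\<close>)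
      also have "\<dots> \<le> emeasure lborel ?A"
        unfolding A_eq
        by (rule lborel_flow_vimage[OF B1 bounded_subset[OF bounded_M AM[unfolded A_eq]]])
          (use AM r in \<open>auto intro!: a(2) flow_in_M\<close>)
      finally have *: "ennreal (exp (- (a * r))) * (ennreal (exp (- (a * (h - r)))) * emeasure lborel B) \<le> emeasure lborel ?A" .
      have "exp (- (a * r)) * exp (- (a * (h - r))) = exp (- (a * h))"
        by (simp only: exp_add[symmetric]) (simp add: algebra_simps)
      with * have "ennreal (exp (- (a * h))) * emeasure lborel B \<le> emeasure lborel ?A"
        by (simp only: mult.assoc[symmetric] ennreal_mult[OF exp_ge_zero exp_ge_zero, symmetric])
      then have "ennreal c * (ennreal (exp (- (a * h))) * emeasure lborel B) \<le> ennreal c * emeasure lborel ?A"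
        by (rule mult_left_mono) simp
      also have "\<dots> \<le> emeasure (occ k) ?A"
        using dom C1.flow_vimage_borel[OF B1, of k r] AU A_eq by (auto simp: dominates_def)
      finally show "ennreal (c * exp (- (a * h))) * emeasure lborel B \<le> emeasure (occ k) ?A"
        using c by (simp add: ennreal_mult mult.assoc)
    qed
    then show ?thesis using \<kappa> c by (simp add: c'_def ennreal_mult mult.assoc)
  qed
  ultimately show ?thesis using h(1) c' by blast
qed

text \<open>\<open>jump_gain\<close> for the compact set \<open>{x}\<close> with
  \<open>A = {}\<close>: the one-jump term alone already bounds the density below.\<close>

lemma good_jump:
  assumes "good k x"
  shows "good j x"
proof (cases "k = j")
  case False
  from assms obtain c U where c: "c > 0" and U: "open U" "x \<in> U" "U \<subseteq> M" and dom: "dominates k U c"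
    by (auto simp: good_def)
  obtain h c' U' where *: "0 < h" "0 < c'" "open U'" "{x} \<subseteq> U'" "U' \<subseteq> U"
    "\<And>A B. A \<in> sets borel \<Longrightarrow> B \<in> sets borel \<Longrightarrow> B \<subseteq> U' \<Longrightarrow> \<phi> j h ` A \<subseteq> B \<Longrightarrow>
      ennreal (exp (Q $ j $ j * h)) * emeasure (occ j) A + ennreal c' * emeasure lborel B \<le> emeasure (occ j) B"
    using jump_gain[of "{x}" U c k j] c U dom False by auto
  have "dominates j U' c'"
    using *(6)[of "{}"] by (auto simp: dominates_def)
  then show ?thesis using * U(3) by (intro goodI[of c' U']) auto
qed (use assms in simp)

section \<open>Topological support of the stationary law\<close>

definition supp :: "'a \<Rightarrow> real ^ 'b \<Rightarrow> bool" where
  "supp j z \<longleftrightarrow> (\<forall>W. open W \<longrightarrow> z \<in> W \<longrightarrow> 0 < emeasure (occ j) W)"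

lemma supp_flow:
  assumes "supp j z" and t: "0 \<le> t"
  shows "supp j (\<phi> j t z)"
  unfolding supp_def
proof (intro allI impI)
  fix W assume W: "open W" "\<phi> j t z \<in> W"
  then have "0 < emeasure (occ j) (\<phi> j t -` W)"
    using assms(1) C1.flow_vimage_open by (auto simp: supp_def)
  then have "0 < ennreal (exp (Q $ j $ j * t)) * emeasure (occ j) (\<phi> j t -` W)"
    by (simp add: ennreal_zero_less_mult_iff)
  also have "\<dots> \<le> emeasure (occ j) W"
    using W C1.flow_vimage_open by (intro occ_flow[OF t]) auto
  finally show "0 < emeasure (occ j) W" .
qed

text \<open>A one-jump path that is short enough ends in \<open>W\<close> from anywhere in a smaller
  ball around \<open>z\<close>, and that ball has positive mass in state \<open>k\<close>.\<close>

lemma supp_jump: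
  assumes "supp k z"
  shows "supp j z"
proof (cases "k = j")
  case kj: False
  show ?thesis
    unfolding supp_def
  proof (intro allI impI)
    fix W assume W: "open W" "z \<in> W"
    then obtain e where e: "e > 0" "ball z e \<subseteq> W" by (meson openE)
    obtain h where h: "h > 0" "\<And>r x. 0 \<le> r \<Longrightarrow> r \<le> h \<Longrightarrow> dist x (\<phi> j (h - r) (\<phi> k r x)) < e / 2"
      using flow_flow_dist[of "e / 2" j k] e(1) by auto
    let ?\<kappa> = "jump_prob Q k j * exp (Q $ j $ j * h) * (1 - exp (Q $ k $ k * h))"
    have \<kappa>: "?\<kappa> > 0"
      using jump_prob_pos[OF kj] Q_diag_neg[OF kj] h by (simp add: mult_neg_pos)
    have "0 < emeasure (occ k) (ball z (e / 2))"
      using assms e unfolding supp_def by (auto intro: half_gt_zero)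
    then have "0 < ennreal ?\<kappa> * emeasure (occ k) (ball z (e / 2))"
      using \<kappa> by (simp add: ennreal_zero_less_mult_iff)
    also have "\<dots> \<le> ennreal (exp (Q $ j $ j * h)) * emeasure (occ j) {} + ennreal ?\<kappa> * emeasure (occ k) (ball z (e / 2))"
      by simp
    also have "\<dots> \<le> emeasure (occ j) W"
    proof (rule occ_flow_jump[OF kj less_imp_le[OF h(1)]])
      fix r assume r: "0 < r" "r \<le> h"
      have "ball z (e / 2) \<subseteq> {x. \<phi> j (h - r) (\<phi> k r x) \<in> W}"
      proof clarify
        fix x assume x: "x \<in> ball z (e / 2)"
        have "dist z (\<phi> j (h - r) (\<phi> k r x)) < e"
          using x h(2)[of r x] r dist_triangle[of z "\<phi> j (h - r) (\<phi> k r x)" x] by simp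
        then show "\<phi> j (h - r) (\<phi> k r x) \<in> W" using e(2) by auto
      qed
      moreover have "{x. \<phi> j (h - r) (\<phi> k r x) \<in> W} \<in> sets (occ k)"
        using C1.flow_vimage_borel[OF C1.flow_vimage_borel[OF borel_open[OF W(1)]], of k r j "h - r"] by (simp add: vimage_def)
      ultimately show "emeasure (occ k) (ball z (e / 2)) \<le> emeasure (occ k) {x. \<phi> j (h - r) (\<phi> k r x) \<in> W}"
        by (rule emeasure_mono)
    qed (use W in auto)
    finally show "0 < emeasure (occ j) W" .
  qed
qed (use assms in simp)

lemma flow_comp_induct:
  assumes "R x" "\<And>j t y. R y \<Longrightarrow> 0 \<le> t \<Longrightarrow> R (\<phi> j t y)" "\<forall>(j, t)\<in>set its. 0 \<le> t"
  shows "R (flow_comp \<phi> its x)"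
  using assms(1,3) unfolding flow_comp_def
  by (induction its arbitrary: x) (auto intro: assms(2))

text \<open>Otherwise finitely many null open sets would cover the compact \<open>M\<close> in every
  state, against total mass 1.\<close>

lemma supp_exists: "\<exists>z\<in>M. \<exists>k. supp k z"
proof (rule ccontr)
  assume *: "\<not> ?thesis"
  have null: "emeasure (occ k) UNIV = 0" for k
  proof -
    have "\<forall>z\<in>M. \<exists>W. open W \<and> z \<in> W \<and> emeasure (occ k) W = 0"
      using * unfolding supp_def by (metis not_gr_zero)
    then obtain W where W: "\<And>z. z \<in> M \<Longrightarrow> open (W z) \<and> z \<in> W z \<and> emeasure (occ k) (W z) = 0" by metis
    then have "M \<subseteq> (\<Union>z\<in>M. W z)" "\<And>z. z \<in> M \<Longrightarrow> open (W z)" by auto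
    then obtain F where F: "F \<subseteq> M" "finite F" "M \<subseteq> (\<Union>z\<in>F. W z)"
      using compactE_image[OF compact_M] by metis
    have "(\<Union>z\<in>F. W z) \<in> null_sets (occ k)"
      using F W by (intro null_sets.finite_UN) (auto intro!: null_setsI)
    moreover have "M \<in> sets (occ k)" using compact_M by (simp add: compact_imp_closed)
    ultimately have "M \<in> null_sets (occ k)" using F(3) null_sets_subset by blast
    then show ?thesis using emeasure_occ_Int_M[of UNIV k] by auto
  qed
  have I0: "I 0 \<in> P \<rightarrow>\<^sub>M count_space UNIV" by (rule I_measurable) simp
  have "(\<Union>k. {\<omega>\<in>space P. X 0 \<omega> \<in> UNIV \<and> I 0 \<omega> = k}) \<in> null_sets P"
    using null event_XI[of 0 UNIV] by (intro null_sets.finite_UN) (auto intro!: null_setsI simp: emeasure_occ_0)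
  moreover have "(\<Union>k. {\<omega>\<in>space P. X 0 \<omega> \<in> UNIV \<and> I 0 \<omega> = k}) = space P" by auto
  ultimately show False using P.emeasure_space_1 by auto
qed

text \<open>Lying in the support for every state at once is preserved by all forward flows, so a
  word leading from a support point into \<open>W\<close> carries the support there.\<close>

lemma supp_everywhere:
  assumes x: "accessible \<phi> M x" and W: "open W" "x \<in> W"
  shows "0 < emeasure (occ j) W"
proof -
  obtain z k where z: "z \<in> M" "supp k z" using supp_exists by blast
  obtain its where its: "\<forall>(j, t)\<in>set its. 0 \<le> t" "flow_comp \<phi> its z \<in> W"
    using x W z(1) unfolding accessible_def by metis
  have "\<forall>j. supp j (flow_comp \<phi> its z)"
    by (rule flow_comp_induct[where R = "\<lambda>y. \<forall>j. supp j y", OF _ _ its(1)])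
      (use z(2) in \<open>blast intro: supp_jump supp_flow\<close>)+
  then show ?thesis using its(2) W(1) by (auto simp: supp_def)
qed

end

section \<open>Passing between densities and measure bounds\<close>

context stationary_pdmp
begin

lemma density_component_measurable:
  fixes f :: "(real ^ 'd) \<times> 'e \<Rightarrow> ennreal"
  assumes f: "f \<in> borel_measurable (lebesgue_on_states M)"
  shows "(\<lambda>y. f (y, j) * indicator M y) \<in> borel_measurable lborel"
proof -
  have 1: "(\<lambda>y. f (y, j)) \<in> borel_measurable (restrict_space lborel M)"
    using f unfolding lebesgue_on_states_def by (rule measurable_compose[OF measurable_Pair2', rotated]) simp
  have M: "M \<inter> space lborel \<in> sets lborel" using compact_M by (simp add: compact_imp_closed)
  show ?thesis
    using borel_measurable_restrict_space_iff_ennreal[OF M, of "\<lambda>y. f (y, j)"] 1 by blast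
qed

lemma emeasure_occ_density:
  assumes f: "f \<in> borel_measurable (lebesgue_on_states M)" "\<pi> = density (lebesgue_on_states M) f"
    and B: "B \<in> sets borel"
  shows "emeasure (occ j) B = (\<integral>\<^sup>+ y. f (y, j) * indicator M y * indicator B y \<partial>lborel)"
proof -
  let ?L = "restrict_space lborel M :: (real ^ 'd) measure" and ?C = "count_space (UNIV :: 'e set)"
  have M: "M \<in> sets borel" using compact_M by (simp add: compact_imp_closed)
  interpret pair_sigma_finite ?L ?C by (rule pair_sigma_finite_lebesgue_on_states[OF M])
  have BM: "(B \<inter> M) \<times> {j} \<in> sets (lebesgue_on_states M)"
    unfolding lebesgue_on_states_def using B M by (intro pair_measureI) (auto simp: sets_restrict_space)
  have "emeasure (occ j) B = emeasure (density (lebesgue_on_states M) f) ((B \<inter> M) \<times> {j})"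
    using B f(2) by (simp add: emeasure_occ_\<pi>)
  also have "\<dots> = (\<integral>\<^sup>+ z. f z * indicator ((B \<inter> M) \<times> {j}) z \<partial>lebesgue_on_states M)"
    by (rule emeasure_density[OF f(1) BM])
  also have "\<dots> = (\<integral>\<^sup>+ x. \<integral>\<^sup>+ j'. f (x, j') * indicator ((B \<inter> M) \<times> {j}) (x, j') \<partial>?C \<partial>?L)"
    unfolding lebesgue_on_states_def
    by (rule M2.nn_integral_fst[symmetric])
      (intro borel_measurable_times_ennreal borel_measurable_indicator
        f(1)[unfolded lebesgue_on_states_def] BM[unfolded lebesgue_on_states_def])
  also have "\<dots> = (\<integral>\<^sup>+ x. f (x, j) * indicator (B \<inter> M) x \<partial>?L)"
  proof (rule nn_integral_cong)
    fix x
    have "(\<integral>\<^sup>+ j'. f (x, j') * indicator ((B \<inter> M) \<times> {j}) (x, j') \<partial>?C) =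
        (\<Sum>j'\<in>UNIV. if j' = j then f (x, j) * indicator (B \<inter> M) x else 0)"
      by (subst nn_integral_count_space_finite) (auto intro!: sum.cong simp: indicator_def)
    then show "(\<integral>\<^sup>+ j'. f (x, j') * indicator ((B \<inter> M) \<times> {j}) (x, j') \<partial>?C) = f (x, j) * indicator (B \<inter> M) x" by simp
  qed
  also have "\<dots> = (\<integral>\<^sup>+ y. f (y, j) * indicator (B \<inter> M) y * indicator M y \<partial>lborel)"
    using M by (subst nn_integral_restrict_space) auto
  also have "\<dots> = (\<integral>\<^sup>+ y. f (y, j) * indicator M y * indicator B y \<partial>lborel)"
    by (rule nn_integral_cong) (auto simp: indicator_def)
  finally show ?thesis .
qed

end

context invariant_pdmp
begin

lemma dominatesI_AE:
  assumes f: "f \<in> borel_measurable (lebesgue_on_states M)" "\<pi> = density (lebesgue_on_states M) f"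
    and U: "U \<subseteq> M" and AE: "AE y in lborel. y \<in> U \<longrightarrow> ennreal c \<le> f (y, j)"
  shows "dominates j U c"
  unfolding dominates_def
proof (intro ballI impI)
  fix B assume B: "B \<in> sets borel" "B \<subseteq> U"
  have "ennreal c * emeasure lborel B = (\<integral>\<^sup>+ y. ennreal c * indicator B y \<partial>lborel)"
    using B(1) by (simp add: nn_integral_cmult_indicator)
  also have "\<dots> \<le> (\<integral>\<^sup>+ y. f (y, j) * indicator M y * indicator B y \<partial>lborel)"
    using AE by (intro nn_integral_mono_AE, eventually_elim) (use B(2) U in \<open>auto simp: indicator_def\<close>)
  finally show "ennreal c * emeasure lborel B \<le> emeasure (occ j) B"
    by (simp add: emeasure_occ_density[OF f B(1)])
qed

lemma dominatesD_AE:
  assumes f: "f \<in> borel_measurable (lebesgue_on_states M)" "\<pi> = density (lebesgue_on_states M) f"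
    and U: "open U" "U \<subseteq> M" and dom: "dominates j U c"
  shows "AE y in lborel. y \<in> U \<longrightarrow> ennreal c \<le> f (y, j)"
proof -
  define g where "g y = f (y, j) * indicator M y" for y
  have g [measurable]: "g \<in> borel_measurable borel"
    using density_component_measurable[OF f(1), of j] by (simp add: g_def[abs_def])
  \<comment> \<open>Where the bound fails. If \<open>B\<close> had positive volume, the integral of
    \<open>g\<close> over it, finite because \<open>occ j\<close> is finite, would be strictly below
    \<open>c\<close> times the volume of \<open>B\<close>.\<close>
  define B where "B = {y\<in>U. g y < ennreal c}"
  have [measurable]: "U \<in> sets borel" using U(1) by simp
  have B: "B \<in> sets borel" unfolding B_def by measurable
  have g_B: "(\<integral>\<^sup>+ y. g y * indicator B y \<partial>lborel) = emeasure (occ j) B"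
    using emeasure_occ_density[OF f B, of j] by (simp add: g_def)
  have c_B: "(\<integral>\<^sup>+ y. ennreal c * indicator B y \<partial>lborel) = ennreal c * emeasure lborel B"
    using B by (simp add: nn_integral_cmult_indicator)
  have not_less: "\<not> (\<integral>\<^sup>+ y. g y * indicator B y \<partial>lborel) < (\<integral>\<^sup>+ y. ennreal c * indicator B y \<partial>lborel)"
    unfolding g_B c_B using dom B by (auto simp: dominates_def B_def not_less)
  have "AE y in lborel. ennreal c * indicator B y \<le> g y * indicator B y"
  proof (rule ccontr)
    assume "\<not> (AE y in lborel. ennreal c * indicator B y \<le> g y * indicator B y)"
    then have "(\<integral>\<^sup>+ y. g y * indicator B y \<partial>lborel) < (\<integral>\<^sup>+ y. ennreal c * indicator B y \<partial>lborel)"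
    proof (rule nn_integral_less[rotated 4])
      show "(\<integral>\<^sup>+ y. g y * indicator B y \<partial>lborel) \<noteq> \<infinity>"
        unfolding g_B using finite_measure.emeasure_finite[OF finite_measure_occ] by simp
      show "AE y in lborel. g y * indicator B y \<le> ennreal c * indicator B y"
        by (auto simp: B_def indicator_def)
    qed (use B in \<open>auto intro!: borel_measurable_times_ennreal\<close>)
    then show False using not_less by blast
  qed
  then show ?thesis
  proof eventually_elim
    case (elim y)
    show ?case
    proof
      assume y: "y \<in> U"
      show "ennreal c \<le> f (y, j)"
      proof (rule ccontr)
        assume "\<not> ennreal c \<le> f (y, j)"
        moreover have "g y = f (y, j)" using y U(2) by (auto simp: g_def)
        ultimately have "y \<in> B" "g y < ennreal c" using y by (auto simp: B_def)
        then show False using elim by simp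
      qed
    qed
  qed
qed

lemma good_exists:
  assumes f: "f \<in> borel_measurable (lebesgue_on_states M)" "\<pi> = density (lebesgue_on_states M) f"
    and \<rho>: "AE z in lebesgue_on_states M. \<rho> z = f z" "lsc_on_states M \<rho>"
    and x: "x \<in> interior M" "accessible \<phi> M x"
  shows "\<exists>y. good j y"
proof (rule ccontr)
  assume *: "\<nexists>y. good j y"
  have M: "M \<in> sets borel" using compact_M by (simp add: compact_imp_closed)
  have \<rho>f: "AE y in lborel. y \<in> M \<longrightarrow> \<rho> (y, j) = f (y, j)"
    using \<rho>(1) by (simp add: AE_lebesgue_on_states[OF M])
  \<comment> \<open>A positive value would spread to a neighbourhood by lower semi-continuity and
    make \<open>y\<close> good. With all values 0 the open set \<open>interior M\<close> is null,
    although it contains an accessible point.\<close>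
  have zero: "\<rho> (y, j) = 0" if y: "y \<in> interior M" for y
  proof (rule ccontr)
    assume "\<rho> (y, j) \<noteq> 0"
    then obtain b where "0 < b" "b < \<rho> (y, j)" using dense[of 0 "\<rho> (y, j)"] by (auto simp: zero_less_iff_neq_zero)
    moreover from this obtain a where a: "b = ennreal a" "0 < a" by (cases b) auto
    ultimately have "eventually (\<lambda>w. ennreal a < \<rho> (w, j)) (at y within M)"
      using \<rho>(2) y interior_subset unfolding lsc_on_states_def by blast
    then obtain U where U: "open U" "y \<in> U" "\<forall>w\<in>U. w \<noteq> y \<longrightarrow> w \<in> M \<longrightarrow> ennreal a < \<rho> (w, j)"
      by (auto simp: eventually_at_topological)
    have "AE w in lborel. w \<in> U \<inter> interior M \<longrightarrow> ennreal a \<le> f (w, j)"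
      using \<rho>f
    proof eventually_elim
      case (elim w)
      then show ?case
        using U(3) \<open>b < \<rho> (y, j)\<close> a interior_subset[of M] by (cases "w = y") (auto simp: less_imp_le subset_iff)
    qed
    then have "dominates j (U \<inter> interior M) a"
      using interior_subset[of M] by (intro dominatesI_AE[OF f]) auto
    then have "good j y"
      using U y a interior_subset[of M] by (intro goodI[of a "U \<inter> interior M"]) auto
    then show False using * by blast
  qed
  have "AE y in lborel. f (y, j) * indicator M y * indicator (interior M) y = 0"
    using \<rho>f by eventually_elim (use interior_subset[of M] zero in \<open>auto simp: indicator_def subset_iff\<close>)
  then have "(\<integral>\<^sup>+ y. f (y, j) * indicator M y * indicator (interior M) y \<partial>lborel) = (\<integral>\<^sup>+ y. 0 \<partial>(lborel :: (real ^ 'b) measure))"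
    by (rule nn_integral_cong_AE)
  then have "emeasure (occ j) (interior M) = 0"
    by (simp add: emeasure_occ_density[OF f])
  then show False using supp_everywhere[OF x(2) open_interior x(1), of j] by simp
qed

lemma good_accessible_hormander:
  assumes y0: "good k y0" and N: "open N" "\<And>w. w \<in> N \<Longrightarrow> accessible \<phi> M w"
    and x: "x \<in> N" "weak_hormander v x"
  shows "good j x"
proof (rule ccontr)
  assume nx: "\<not> good j x"
  define C where "C = {x. \<not> good j x}"
  \<comment> \<open>Goodness in state \<open>j\<close> travels along every flow
    \<open>\<phi> i\<close>: switch to state \<open>i\<close>, flow, and switch back. Hence its
    complement is backward invariant under all flows.\<close>
  have good_flow': "good j (\<phi> i t y)" if "good j y" "0 \<le> t" for i t y
    using that good_jump good_flow by blast
  have "interior (C \<inter> N) \<noteq> {}"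
  proof (rule backward_invariant_has_interior[OF _ x(2) N(1) x(1)])
    show "x \<in> C" using nx by (simp add: C_def)
    fix i y t assume "y \<in> C" "0 \<le> (t::real)"
    then show "\<phi> i (- t) y \<in> C"
      using good_flow'[of "\<phi> i (- t) y" t i] by (auto simp: C_def)
  qed
  then obtain w where w: "w \<in> interior (C \<inter> N)" by blast
  then have "accessible \<phi> M w" using N(2) interior_subset by blast
  moreover have "y0 \<in> M" using y0 by (auto simp: good_def)
  ultimately obtain its where its: "\<forall>(j, t)\<in>set its. 0 \<le> t" "flow_comp \<phi> its y0 \<in> interior (C \<inter> N)"
    using w unfolding accessible_def by (metis open_interior)
  have "good j (flow_comp \<phi> its y0)"
    by (rule flow_comp_induct[OF good_jump[OF y0] good_flow' its(1)])
  then show False using its(2) interior_subset[of "C \<inter> N"] by (auto simp: C_def)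
qed

lemma dominates_nhd_compact:
  assumes K: "compact K" and good: "\<And>x. x \<in> K \<Longrightarrow> good j x"
  shows "\<exists>c>0. \<exists>U. open U \<and> K \<subseteq> U \<and> U \<subseteq> M \<and> dominates j U c"
proof -
  obtain c U where cU: "\<And>x. x \<in> K \<Longrightarrow> c x > 0 \<and> open (U x) \<and> x \<in> U x \<and> U x \<subseteq> M \<and> dominates j (U x) (c x)"
    using good unfolding good_def by metis
  obtain F where F: "F \<subseteq> K" "finite F" "K \<subseteq> (\<Union>x\<in>F. U x)"
    using compactE_image[OF K, of K U] cU by blast
  have "\<exists>d>0. dominates j (\<Union>x\<in>F. U x) d"
    using F(2,1)
  proof (induction F rule: finite_induct)
    case empty
    then show ?case by (intro exI[of _ 1]) (auto simp: dominates_def)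
  next
    case (insert x F)
    then obtain d where d: "d > 0" "dominates j (\<Union>x\<in>F. U x) d" by auto
    have x: "c x > 0" "open (U x)" "dominates j (U x) (c x)" using cU insert.prems by auto
    have "dominates j (U x \<union> (\<Union>x\<in>F. U x)) (min d (c x))"
      by (rule dominates_Un[OF dominates_mono[OF x(3)] dominates_mono[OF d(2)] x(2)]) auto
    then show ?case using d x by (intro exI[of _ "min d (c x)"]) auto
  qed
  then obtain d where "d > 0" "dominates j (\<Union>x\<in>F. U x) d" by blast
  moreover have "open (\<Union>x\<in>F. U x)" "(\<Union>x\<in>F. U x) \<subseteq> M" using F(1) cU by blast+
  ultimately show ?thesis using F(3) by blast
qed

text \<open>Backward orbits from \<open>K\<close> stay in \<open>K\<close>, and on
  \<open>{- T..0}\<close> nearby orbits diverge by at most a Lipschitz factor. This factor depends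
  on \<open>T\<close>, so the neighbourhood does as well.\<close>

lemma backward_tube:
  assumes K: "compact K" "K \<subseteq> U" "open U" and bi: "\<And>x t. x \<in> K \<Longrightarrow> 0 \<le> t \<Longrightarrow> \<phi> j (- t) x \<in> K" and x: "x \<in> K"
  shows "\<exists>V. open V \<and> x \<in> V \<and> (\<forall>y\<in>V. \<forall>t. 0 \<le> t \<longrightarrow> t \<le> T \<longrightarrow> \<phi> j (- t) y \<in> U)"
proof -
  obtain e where e: "e > 0" "(\<Union>z\<in>K. ball z e) \<subseteq> U"
    using compact_subset_open_imp_ball_epsilon_subset[OF K(1,3,2)] by blast
  obtain L where L: "L \<ge> 0" "\<forall>y\<in>cball 0 (norm x + 1). \<forall>z\<in>cball 0 (norm x + 1). \<forall>t. \<bar>t\<bar> \<le> T \<longrightarrow>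
      norm (\<phi> j t y - \<phi> j t z) \<le> L * norm (y - z)"
    using C1.flow_lipschitz[of "norm x + 1" T j] by blast
  define d where "d = min 1 (e / (L + 1))"
  have d: "d > 0" "d \<le> 1" "d \<le> e / (L + 1)" using e L by (auto simp: d_def)
  have "\<phi> j (- t) y \<in> U" if y: "y \<in> ball x d" and t: "0 \<le> t" "t \<le> T" for y t
  proof -
    have "norm y \<le> norm x + 1"
      using y d(2) norm_triangle_sub[of y x] by (simp add: dist_norm norm_minus_commute)
    then have "norm (\<phi> j (- t) x - \<phi> j (- t) y) \<le> L * norm (x - y)"
      using L(2)[rule_format, of x y "- t"] t by simp
    also have "\<dots> \<le> (L + 1) * norm (x - y)" by (intro mult_right_mono) auto
    also have "\<dots> < (L + 1) * d" using y L by (intro mult_strict_left_mono) (auto simp: dist_norm)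
    also have "\<dots> \<le> e" using d(3) L by (simp add: field_simps)
    finally have "\<phi> j (- t) y \<in> ball (\<phi> j (- t) x) e" by (simp add: dist_norm)
    then show ?thesis using e(2) bi[OF x t(1)] by blast
  qed
  then show ?thesis using d(1) by (intro exI[of _ "ball x d"]) auto
qed

text \<open>\<open>lborel_flow_vimage\<close> with the divergence bound \<open>- r\<close> along the
  backward orbits of \<open>B\<close>. The rate \<open>r\<close> may have either sign, since
  \<open>R - 1 / T\<close> can be negative.\<close>

lemma lborel_backward_growth:
  assumes B: "B \<in> sets borel" and t: "0 \<le> t"
    and tube: "\<And>y s. y \<in> B \<Longrightarrow> 0 \<le> s \<Longrightarrow> s \<le> t \<Longrightarrow> \<phi> j (- s) y \<in> M \<and> div_v j (\<phi> j (- s) y) \<le> - r"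
  shows "ennreal (exp (r * t)) * emeasure lborel B \<le> emeasure lborel (\<phi> j t -` B)"
proof -
  have back_eq: "\<phi> j (- s) (\<phi> j t x) = \<phi> j (t - s) x" for s x
    using C1.flow_add[of j "- s" t x] by simp
  have "ennreal (exp (- ((- r) * t))) * emeasure lborel B \<le> emeasure lborel (\<phi> j t -` B)"
  proof (rule lborel_flow_vimage[OF B _ t])
    have "\<phi> j t -` B \<subseteq> M"
    proof
      fix x assume "x \<in> \<phi> j t -` B"
      then show "x \<in> M" using tube[of "\<phi> j t x" t] t by (simp add: back_eq)
    qed
    then show "bounded (\<phi> j t -` B)" by (rule bounded_subset[OF bounded_M])
    fix x u assume "\<phi> j t x \<in> B" "0 \<le> u" "u \<le> t"
    then show "div_v j (\<phi> j u x) \<le> - r" using tube[of "\<phi> j t x" "t - u"] C1.flow_add[of j "u - t" t x] by simp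
  qed
  then show ?thesis by simp
qed

text \<open>A discrete Duhamel formula: \<open>gain\<close> is applied to \<open>B\<close>, then to
  its preimage after time \<open>h\<close>, and so on. Mass that entered state \<open>i\<close>
  about \<open>l\<close> steps ago has survived with factor \<open>p ^ l\<close>; the mass older
  than \<open>m\<close> steps is dropped.\<close>

lemma iterated_gain:
  assumes gain: "\<And>A B. A \<in> sets borel \<Longrightarrow> B \<in> sets borel \<Longrightarrow> B \<subseteq> U \<Longrightarrow> \<phi> j h ` A \<subseteq> B \<Longrightarrow>
      ennreal p * emeasure (occ j) A + ennreal c * emeasure lborel B \<le> emeasure (occ j) B"
    and p: "0 \<le> p" and B: "B \<in> sets borel" and tube: "\<And>l. l < m \<Longrightarrow> \<phi> j (real l * h) -` B \<subseteq> U"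
  shows "(\<Sum>l<m. ennreal (p ^ l) * (ennreal c * emeasure lborel (\<phi> j (real l * h) -` B))) \<le> emeasure (occ j) B"
  using B tube
proof (induction m arbitrary: B)
  case 0
  then show ?case by simp
next
  case (Suc m)
  let ?A = "\<phi> j h -` B"
  have shift: "\<phi> j (real l * h) -` ?A = \<phi> j (real (Suc l) * h) -` B" for l
    using C1.flow_add[of j h "real l * h"] by (auto simp: algebra_simps)
  have A: "?A \<in> sets borel" by (rule C1.flow_vimage_borel[OF Suc.prems(1)])
  have IH: "(\<Sum>l<m. ennreal (p ^ l) * (ennreal c * emeasure lborel (\<phi> j (real (Suc l) * h) -` B))) \<le> emeasure (occ j) ?A"
    using Suc.IH[OF A] Suc.prems(2) by (simp only: shift)
  have "(\<Sum>l<Suc m. ennreal (p ^ l) * (ennreal c * emeasure lborel (\<phi> j (real l * h) -` B))) =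
      ennreal c * emeasure lborel B +
      ennreal p * (\<Sum>l<m. ennreal (p ^ l) * (ennreal c * emeasure lborel (\<phi> j (real (Suc l) * h) -` B)))"
    by (subst sum.lessThan_Suc_shift) (simp add: sum_distrib_left ennreal_mult[OF p zero_le_power[OF p]] mult.assoc vimage_def)
  also have "\<dots> \<le> ennreal c * emeasure lborel B + ennreal p * emeasure (occ j) ?A"
    by (intro add_left_mono mult_left_mono IH) simp
  also have "\<dots> \<le> emeasure (occ j) B"
    using gain[OF A Suc.prems(1)] Suc.prems(2)[of 0] by (auto simp: add.commute vimage_def)
  finally show ?case .
qed

end

section \<open>Blow-up of the density\<close>

context invariant_pdmp
begin

text \<open>After \<open>l\<close> steps survival contributes \<open>exp (Q $ i $ i * h) ^ l\<close>
  and backward volume growth \<open>exp (r * l * h)\<close>. With \<open>- Q $ i $ i \<le> R\<close>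
  the product stays above \<open>exp (- 1)\<close> up to the horizon, so each of \<open>m\<close>
  terms is at least \<open>d\<close> times the volume of \<open>B\<close>, for \<open>m\<close> as
  large as wanted.\<close>

lemma dominates_arbitrarily:
  assumes \<Gamma>: "compact \<Gamma>" and bwd: "\<And>y t. y \<in> \<Gamma> \<Longrightarrow> 0 \<le> t \<Longrightarrow> \<phi> i (- t) y \<in> \<Gamma>"
    and good: "\<And>j y. y \<in> \<Gamma> \<Longrightarrow> good j y" and div: "\<And>y. y \<in> \<Gamma> \<Longrightarrow> div_v i y \<le> - R"
    and R: "0 < R" "- Q $ i $ i \<le> R" and x: "x \<in> \<Gamma>"
  shows "\<exists>V. open V \<and> x \<in> V \<and> V \<subseteq> M \<and> dominates i V K"
proof -
  have tube: "\<exists>V. open V \<and> x \<in> V \<and> (\<forall>y\<in>V. \<forall>t. 0 \<le> t \<longrightarrow> t \<le> T \<longrightarrow> \<phi> i (- t) y \<in> U \<and> div_v i (\<phi> i (- t) y) \<le> - r)"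
    if U: "open U" "\<Gamma> \<subseteq> U" and r: "r < R" for U r T
  proof -
    have "open {y. div_v i y < - r}"
      using continuous_on_open_Collect[OF div_v_cont open_UNIV open_lessThan, of i "- r"] by simp
    then have "open (U \<inter> {y. div_v i y < - r})" using U(1) by blast
    moreover have "\<Gamma> \<subseteq> U \<inter> {y. div_v i y < - r}" using U(2) div r by force
    ultimately obtain V where "open V" "x \<in> V"
      "\<forall>y\<in>V. \<forall>t. 0 \<le> t \<longrightarrow> t \<le> T \<longrightarrow> \<phi> i (- t) y \<in> U \<inter> {y. div_v i y < - r}"
      using backward_tube[OF \<Gamma> _ _ bwd x] by blast
    then show ?thesis by (intro exI[of _ V]) (auto intro: less_imp_le)
  qed
  show ?thesis
  proof (cases "\<exists>k. k \<noteq> i")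
    case True
    then obtain k where k: "k \<noteq> i" by blast
    obtain c U0 where c: "c > 0" and U0: "open U0" "\<Gamma> \<subseteq> U0" "U0 \<subseteq> M" "dominates k U0 c"
      using dominates_nhd_compact[OF \<Gamma> good] by blast
    obtain h c' U where h: "h > 0" and c': "c' > 0" and U: "open U" "\<Gamma> \<subseteq> U" "U \<subseteq> U0"
      and gain: "\<And>A B. A \<in> sets borel \<Longrightarrow> B \<in> sets borel \<Longrightarrow> B \<subseteq> U \<Longrightarrow> \<phi> i h ` A \<subseteq> B \<Longrightarrow>
        ennreal (exp (Q $ i $ i * h)) * emeasure (occ i) A + ennreal c' * emeasure lborel B \<le> emeasure (occ i) B"
      using jump_gain[OF \<Gamma> U0(2,1,3) c U0(4) k] by blast
    \<comment> \<open>\<open>d\<close> is the gain per step \<open>c'\<close> after the total loss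
      of volume growth up to the horizon; it does not depend on \<open>K\<close>, so
      \<open>m\<close> can be chosen to match \<open>K\<close> afterwards.\<close>
    define d where "d = c' * exp (- 1)"
    have d: "d > 0" using c' by (simp add: d_def)
    obtain m0 :: nat where m0: "K / d < real m0" using reals_Archimedean2 by blast
    define m where "m = Suc m0"
    have m: "m > 0" "K \<le> real m * d" using m0 d by (auto simp: m_def field_simps)
    define T where "T = real m * h"
    have T: "T > 0" using m h by (simp add: T_def)
    \<comment> \<open>The deficit \<open>1 / T\<close> in the rate, accumulated over any time up to
      \<open>T\<close>, costs an exponent of at most 1; this is the \<open>exp (- 1)\<close> in
      \<open>d\<close>.\<close>
    define r where "r = R - 1 / T"
    have "r < R" using T by (simp add: r_def)
    then obtain V where V: "open V" "x \<in> V"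
      "\<And>y t. y \<in> V \<Longrightarrow> 0 \<le> t \<Longrightarrow> t \<le> T \<Longrightarrow> \<phi> i (- t) y \<in> U \<and> div_v i (\<phi> i (- t) y) \<le> - r"
      using tube[OF U(1,2), of r T] by blast
    have UM: "U \<subseteq> M" using U(3) U0(3) by blast
    have VM: "V \<subseteq> M" using V(3)[of _ 0] T UM by auto
    have "dominates i V K"
      unfolding dominates_def
    proof (intro ballI impI)
      fix B assume B: "B \<in> sets borel" "B \<subseteq> V"
      let ?p = "exp (Q $ i $ i * h)"
      let ?B = "\<lambda>l. \<phi> i (real l * h) -` B"
      have lT: "0 \<le> real l * h" "real l * h \<le> T" if "l < m" for l
        using that h by (auto simp: T_def intro!: mult_right_mono)
      have "?B l \<subseteq> U" if l: "l < m" for l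
      proof
        fix y assume "y \<in> ?B l"
        then show "y \<in> U" using V(3)[OF _ lT[OF l], of "\<phi> i (real l * h) y"] B(2) by auto
      qed
      then have sum: "(\<Sum>l<m. ennreal (?p ^ l) * (ennreal c' * emeasure lborel (?B l))) \<le> emeasure (occ i) B"
        by (intro iterated_gain[OF gain _ B(1)]) auto
      have "ennreal d * emeasure lborel B \<le> ennreal (?p ^ l) * (ennreal c' * emeasure lborel (?B l))" if l: "l < m" for l
      proof -
        let ?t = "real l * h"
        have "d \<le> ?p ^ l * (c' * exp (r * ?t))"
        proof -
          have "?t / T \<le> 1" using lT[OF l] T by simp
          moreover have "0 \<le> (Q $ i $ i + R) * ?t" using R(2) h by (intro mult_nonneg_nonneg) auto
          ultimately have "- 1 \<le> real l * (Q $ i $ i * h) + r * ?t" by (simp add: r_def algebra_simps)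
          then have "c' * exp (- 1) \<le> c' * exp (real l * (Q $ i $ i * h) + r * ?t)" using c' by simp
          also have "\<dots> = ?p ^ l * (c' * exp (r * ?t))"
            by (simp add: exp_add flip: exp_of_nat_mult)
          finally show ?thesis by (simp add: d_def)
        qed
        then have "ennreal d * emeasure lborel B \<le> ennreal (?p ^ l * (c' * exp (r * ?t))) * emeasure lborel B"
          by (intro mult_right_mono ennreal_leI) auto
        also have "\<dots> = ennreal (?p ^ l) * (ennreal c' * (ennreal (exp (r * ?t)) * emeasure lborel B))"
          using c' by (simp add: ennreal_mult mult.assoc)
        also have "\<dots> \<le> ennreal (?p ^ l) * (ennreal c' * emeasure lborel (?B l))"
        proof (intro mult_left_mono lborel_backward_growth[OF B(1) lT(1)[OF l]])
          fix y s assume "y \<in> B" "0 \<le> s" "s \<le> ?t"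
          then show "\<phi> i (- s) y \<in> M \<and> div_v i (\<phi> i (- s) y) \<le> - r"
            using V(3)[of y s] B(2) lT(2)[OF l] UM by auto
        qed auto
        finally show ?thesis .
      qed
      then have "(\<Sum>l<m. ennreal d * emeasure lborel B) \<le> emeasure (occ i) B"
        by (intro order.trans[OF sum_mono sum]) auto
      moreover have "(\<Sum>l<m. ennreal d * emeasure lborel B) = ennreal (real m * d) * emeasure lborel B"
        using d by (simp add: ennreal_mult ennreal_of_nat_eq_real_of_nat mult.assoc)
      moreover have "ennreal K * emeasure lborel B \<le> ennreal (real m * d) * emeasure lborel B"
        using m(2) by (intro mult_right_mono ennreal_leI) auto
      ultimately show "ennreal K * emeasure lborel B \<le> emeasure (occ i) B" by simp
    qed
    then show ?thesis using V(1,2) VM by blast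
  next
    case False
    \<comment> \<open>With a single state there are no jumps to feed the density, but the exit rate
      is 0: nothing is lost on the way, and volume contraction alone makes the density grow.\<close>
    have single: "UNIV - {i} = {}" using False by auto
    have Qi: "Q $ i $ i = 0" using Q_diag[of i] by (simp only: single sum.empty minus_zero)
    obtain c U where c: "c > 0" and U: "open U" "\<Gamma> \<subseteq> U" "U \<subseteq> M" "dominates i U c"
      using dominates_nhd_compact[OF \<Gamma> good] by blast
    \<comment> \<open>Chosen so that \<open>c * (R / 2 * T) = \<bar>K\<bar>\<close>; the linear
      lower bound for the exponential then reaches \<open>K\<close>. Half of the strictly positive
      rate \<open>R\<close> leaves room for a neighbourhood.\<close>
    define T where "T = 2 * \<bar>K\<bar> / (c * R)"
    have T: "0 \<le> T" using c R by (simp add: T_def)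
    have "R / 2 < R" using R by simp
    then obtain V where V: "open V" "x \<in> V"
      "\<And>y t. y \<in> V \<Longrightarrow> 0 \<le> t \<Longrightarrow> t \<le> T \<Longrightarrow> \<phi> i (- t) y \<in> U \<and> div_v i (\<phi> i (- t) y) \<le> - (R / 2)"
      using tube[OF U(1,2), of "R / 2" T] by blast
    have VM: "V \<subseteq> M" using V(3)[of _ 0] T U(3) by auto
    have "dominates i V K"
      unfolding dominates_def
    proof (intro ballI impI)
      fix B assume B: "B \<in> sets borel" "B \<subseteq> V"
      let ?A = "\<phi> i T -` B"
      have A: "?A \<in> sets borel" by (rule C1.flow_vimage_borel[OF B(1)])
      have AU: "?A \<subseteq> U"
      proof
        fix y assume "y \<in> ?A"
        then show "y \<in> U" using V(3)[OF _ T order.refl, of "\<phi> i T y"] B(2) by auto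
      qed
      have "c * (R / 2 * T) = \<bar>K\<bar>" using c R by (simp add: T_def)
      then have "K \<le> c * (1 + R / 2 * T)" using c by (simp only: distrib_left)
      also have "\<dots> \<le> c * exp (R / 2 * T)" using c exp_ge_add_one_self[of "R / 2 * T"] by simp
      finally have "ennreal K * emeasure lborel B \<le> ennreal (c * exp (R / 2 * T)) * emeasure lborel B"
        by (intro mult_right_mono ennreal_leI) auto
      also have "\<dots> = ennreal c * (ennreal (exp (R / 2 * T)) * emeasure lborel B)"
        using c by (simp add: ennreal_mult mult.assoc)
      also have "\<dots> \<le> ennreal c * emeasure lborel ?A"
      proof (intro mult_left_mono lborel_backward_growth[OF B(1) T])
        fix y s assume "y \<in> B" "0 \<le> s" "s \<le> T"
        then show "\<phi> i (- s) y \<in> M \<and> div_v i (\<phi> i (- s) y) \<le> - (R / 2)"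
          using V(3)[of y s] B(2) U(3) by auto
      qed auto
      also have "\<dots> \<le> emeasure (occ i) ?A" using U(4) A AU by (simp add: dominates_def)
      also have "\<dots> \<le> emeasure (occ i) B" using occ_flow[OF T A B(1), of i] Qi by auto
      finally show "ennreal K * emeasure lborel B \<le> emeasure (occ i) B" .
    qed
    then show ?thesis using V(1,2) VM by blast
  qed
qed

end

text \<open>If the value were finite, raising the version to a larger constant on an open set where
  it already holds almost everywhere would give another lower semi-continuous version, larger at
  \<open>x\<close>.\<close>

lemma greatest_lsc_version_ess_infinite:
  fixes \<rho> :: "(real ^ 'd) \<times> 'e::finite \<Rightarrow> ennreal"
  assumes M: "M \<in> sets borel" and g: "greatest_lsc_version M \<pi> \<rho>" and x: "x \<in> M"
    and inf: "ess_infinite_at M (\<lambda>y. \<rho> (y, i)) x"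
  shows "\<rho> (x, i) = \<infinity>"
proof (rule ccontr)
  assume fin: "\<rho> (x, i) \<noteq> \<infinity>"
  define K where "K = \<rho> (x, i) + 1"
  have K: "K < \<infinity>" "\<rho> (x, i) < K"
    using fin by (cases "\<rho> (x, i)"; simp add: K_def ennreal_less_iff flip: ennreal_plus ennreal_1)+
  obtain U where U: "open U" "x \<in> U" "AE y in lborel. y \<in> U \<inter> M \<longrightarrow> K \<le> \<rho> (y, i)"
    using inf K(1) unfolding ess_infinite_at_def by blast
  define \<sigma> where "\<sigma> z = (if z \<in> U \<times> {i} then max (\<rho> z) K else \<rho> z)" for z
  have lsc: "lsc_version M \<pi> \<rho>" using g by (simp add: greatest_lsc_version_def)
  then obtain f where f: "f \<in> borel_measurable (lebesgue_on_states M)"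
    "\<pi> = density (lebesgue_on_states M) f" "AE z in lebesgue_on_states M. \<rho> z = f z"
    by (auto simp: lsc_version_def density_version_def)
  have "AE z in lebesgue_on_states M. \<sigma> z = \<rho> z"
    unfolding AE_lebesgue_on_states[OF M]
  proof
    fix j
    show "AE y in lborel. y \<in> M \<longrightarrow> \<sigma> (y, j) = \<rho> (y, j)"
      using U(3) by eventually_elim (auto simp: \<sigma>_def max_def)
  qed
  with f(3) have "AE z in lebesgue_on_states M. \<sigma> z = f z" by eventually_elim simp
  moreover have "lsc_on_states M \<sigma>"
    unfolding lsc_on_states_def
  proof (intro allI ballI impI)
    fix j y a assume y: "y \<in> M" and a: "a < \<sigma> (y, j)"
    have \<rho>_ev: "eventually (\<lambda>w. a < \<sigma> (w, j)) (at y within M)" if "a < \<rho> (y, j)"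
    proof -
      have "eventually (\<lambda>w. a < \<rho> (w, j)) (at y within M)"
        using lsc y that by (auto simp: lsc_version_def lsc_on_states_def)
      then show ?thesis by eventually_elim (auto simp: \<sigma>_def less_max_iff_disj)
    qed
    show "eventually (\<lambda>w. a < \<sigma> (w, j)) (at y within M)"
    proof (cases "a < \<rho> (y, j)")
      case False
      then have *: "y \<in> U" "j = i" "a < K" using a by (auto simp: \<sigma>_def less_max_iff_disj split: if_splits)
      then have "eventually (\<lambda>w. w \<in> U) (at y within M)"
        using U(1) by (auto simp: eventually_at_topological)
      then show ?thesis by eventually_elim (use * in \<open>auto simp: \<sigma>_def less_max_iff_disj\<close>)
    qed (rule \<rho>_ev)
  qed
  ultimately have "lsc_version M \<pi> \<sigma>"
    using f by (auto simp: lsc_version_def density_version_def)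
  then have "\<sigma> (x, i) \<le> \<rho> (x, i)" using g x by (simp add: greatest_lsc_version_def)
  then show False using U(2) K(2) by (simp add: \<sigma>_def)
qed

theorem theorem2p11:
  fixes v :: "'e::finite \<Rightarrow> real ^ 'd \<Rightarrow> real ^ 'd"
    and \<phi> :: "'e \<Rightarrow> real \<Rightarrow> real ^ 'd \<Rightarrow> real ^ 'd"
    and M \<Gamma> :: "(real ^ 'd) set"
    and i :: 'e
    and Q :: "real ^ 'e ^ 'e"
    and P :: "'w measure"
    and X :: "real \<Rightarrow> 'w \<Rightarrow> real ^ 'd"
    and I :: "real \<Rightarrow> 'w \<Rightarrow> 'e"
    and \<pi> :: "((real ^ 'd) \<times> 'e) measure"
    and \<rho> :: "(real ^ 'd) \<times> 'e \<Rightarrow> ennreal"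
  assumes smooth_v: "\<And>j. smooth (v j)"
    and bounded_v: "\<And>j. bounded (range (v j))"
    and flow: "\<And>j. is_flow (v j) (\<phi> j)"
    and compact_M: "compact M"
    and invariant_M: "forward_invariant \<phi> M"
    and accessible_hormander: "\<exists>x\<in>M. accessible \<phi> M x \<and> weak_hormander v x"
    and closed_\<Gamma>: "closed \<Gamma>" "\<Gamma> \<subseteq> interior M"
    and backward_\<Gamma>: "backward_invariant (\<phi> i) \<Gamma>"
    and accessible_\<Gamma>: "\<exists>N. open N \<and> \<Gamma> \<subseteq> N \<and> (\<forall>x\<in>N. accessible \<phi> M x)"
    and hormander_\<Gamma>: "\<And>x. x \<in> \<Gamma> \<Longrightarrow> weak_hormander v x"
    and contraction: "(SUP x\<in>\<Gamma>. trace (jacobian (v i) (at x))) < 0"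
    and Q: "Q \<in> positive_rate_matrices"
    and rate: "- Q $ i $ i \<le> contraction_rate (v i) \<Gamma>"
    and stationary: "stationary_realisation P M v Q X I \<pi>"
    and version: "lsc_version M \<pi> \<rho>"
  shows "(greatest_lsc_version M \<pi> \<rho> \<longrightarrow> (\<forall>x\<in>\<Gamma>. \<rho> (x, i) = \<infinity>)) \<and>
         (\<forall>x\<in>\<Gamma>. ess_infinite_at M (\<lambda>y. \<rho> (y, i)) x)"
proof -
  interpret invariant_pdmp v \<phi> M Q P X I \<pi>
    by unfold_locales (fact smooth_v bounded_v flow compact_M Q stationary invariant_M)+
  have M: "M \<in> sets borel" using compact_M by (simp add: compact_imp_closed)
  have \<Gamma>M: "\<Gamma> \<subseteq> M" using closed_\<Gamma>(2) interior_subset by blast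
  have \<Gamma>: "compact \<Gamma>" using compact_Int_closed[OF compact_M closed_\<Gamma>(1)] \<Gamma>M by (simp add: Int_absorb1)
  obtain f where f: "f \<in> borel_measurable (lebesgue_on_states M)"
    "\<pi> = density (lebesgue_on_states M) f" "AE z in lebesgue_on_states M. \<rho> z = f z"
    and lsc: "lsc_on_states M \<rho>"
    using version by (auto simp: lsc_version_def density_version_def)
  obtain N where N: "open N" "\<Gamma> \<subseteq> N" "\<And>x. x \<in> N \<Longrightarrow> accessible \<phi> M x"
    using accessible_\<Gamma> by blast
  \<comment> \<open>The accessible point \<open>y\<close> lies in the interior of \<open>M\<close>,
    which yields a good point somewhere; accessibility near \<open>y\<close> and the bracket
    condition at \<open>y\<close> then make \<open>y\<close> itself good.\<close>
  have good: "good j y" if y: "y \<in> \<Gamma>" for j y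
  proof -
    obtain y0 where "good j y0"
      using good_exists[OF f lsc, of y j] y closed_\<Gamma>(2) N by blast
    then show ?thesis
      using good_accessible_hormander[OF _ N(1,3)] y N(2) hormander_\<Gamma> by blast
  qed
  have tr: "trace (jacobian (v i) (at y)) = div_v i y" for y
    by (simp add: div_v_def matrix_v')
  have cont: "compact (div_v i ` \<Gamma>)"
    by (rule compact_continuous_image[OF continuous_on_subset[OF div_v_cont subset_UNIV] \<Gamma>])
  then have bdd_above: "bdd_above (div_v i ` \<Gamma>)"
    by (intro bounded_imp_bdd_above compact_imp_bounded)
  then obtain m where "\<And>y. y \<in> \<Gamma> \<Longrightarrow> div_v i y \<le> m" by (auto simp: bdd_above_def)
  then have bdd_below: "bdd_below ((\<lambda>y. - div_v i y) ` \<Gamma>)"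
    by (intro bdd_belowI2[of _ "- m"]) simp
  define R where "R = contraction_rate (v i) \<Gamma>"
  have R_eq: "R = (INF y\<in>\<Gamma>. - div_v i y)"
    by (simp add: R_def contraction_rate_def tr)
  have div: "div_v i y \<le> - R" if "y \<in> \<Gamma>" for y
    using cINF_lower[OF bdd_below that] by (simp add: R_eq)
  have inf: "ess_infinite_at M (\<lambda>y. \<rho> (y, i)) x" if x: "x \<in> \<Gamma>" for x
    unfolding ess_infinite_at_def
  proof (intro allI impI)
    fix K :: ennreal assume "K < \<infinity>"
    then obtain k where k: "K = ennreal k" by (cases K) auto
    \<comment> \<open>The supremum and infimum are over a set containing \<open>x\<close> and
      bounded on the relevant side by compactness of \<open>\<Gamma>\<close>, so they compare as
      expected.\<close>
    have "0 < - (SUP y\<in>\<Gamma>. div_v i y)" using contraction by (simp add: tr)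
    also have "\<dots> \<le> R"
      unfolding R_eq using x cSUP_upper[OF _ bdd_above] by (intro cINF_greatest) auto
    finally have R: "0 < R" .
    obtain V where V: "open V" "x \<in> V" "V \<subseteq> M" "dominates i V k"
      using dominates_arbitrarily[OF \<Gamma> _ good div R _ x, of k] backward_\<Gamma> rate
      by (auto simp: backward_invariant_def R_def)
    have "AE y in lborel. y \<in> V \<longrightarrow> K \<le> f (y, i)"
      using dominatesD_AE[OF f(1,2) V(1,3,4)] by (simp add: k)
    moreover have "AE y in lborel. y \<in> M \<longrightarrow> \<rho> (y, i) = f (y, i)"
      using f(3) by (simp add: AE_lebesgue_on_states[OF M])
    ultimately have "AE y in lborel. y \<in> V \<inter> M \<longrightarrow> K \<le> \<rho> (y, i)"
      by eventually_elim auto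
    then show "\<exists>U. open U \<and> x \<in> U \<and> (AE y in lborel. y \<in> U \<inter> M \<longrightarrow> K \<le> \<rho> (y, i))"
      using V(1,2) by blast
  qed
  then show ?thesis
    using greatest_lsc_version_ess_infinite[OF M] \<Gamma>M by blast
qed

end
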